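(* Joachimsthal surfaces are Darboux transforms of two Dupin cyclides: if $f$ is a regular umbilic-free Legendre map that projects to a Joachimsthal surface in a Euclidean space form $\mathfrak{Q}^3$, then there exist two distinct Dupin cyclides $\hat f$ such that $f$ is a Darboux transform of each of them.
   Context: Let $\mathbb{R}^{4,2}$ be $\mathbb{R}^6$ with a symmetric bilinear form $(\cdot,\cdot)$ of signature $(4,2)$, $\mathcal{L}$ its light cone, $\mathcal{Z}$ the Grassmannian of totally isotropic 2-planes, and $\wedge^2\mathbb{R}^{4,2}\cong\mathfrak{o}(4,2)$ via $(a\wedge b)c=(a,c)b-(b,c)a$. $\Sigma$ is a simply connected 2-manifold. A smooth map $f:\Sigma\to\mathcal{Z}$ is identified with a rank 2 null subbundle of $\Sigma\times\mathbb{R}^{4,2}$; $f^{(1)}$ is the set of sections and derivatives of sections of $f$. $f$ is a Legendre map if $f^{(1)}\le f^\perp$ and, for any $x$, if $X\in T_x\Sigma$ satisfies $d\sigma(X)\in f$ for all $\sigma\in\Gamma f$, then $X=0$. $f$ is umbilic-free if there are rank 1 subbundles (curvature sphere congruences) $s_1,s_2\le f$ with $s_1\cap s_2=\{0\}$ and rank 1 curvature subbundles $T_1,T_2$ with $d_X\sigma_i\in\Gamma f$ for $\sigma_i\in\Gamma s_i$, $X\in\Gamma T_i$; the leaves of $T_i$ are the curvature lines. $f$ is regular if $s_1,s_2:\Sigma\to\mathbb{P}(\mathcal{L})$ are immersions. A Dupin cyclide is a Legendre map for which both families of curvature lines are circular, i.e. $s_i$ is constant along the leaves of $T_i$ for $i=1,2$.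 Euclidean space form: unit timelike $\mathfrak{p}$ and non-zero lightlike $\mathfrak{q}\perp\mathfrak{p}$, $\mathfrak{Q}^3=\{y\in\mathcal{L}:(y,\mathfrak{q})=-1,(y,\mathfrak{p})=0\}$; $f$ projects to $\mathfrak{f}=f\cap\mathfrak{Q}^3$. Osculating complexes and bundles (of regular $f$): $S_1=\langle\sigma_1,d_Y\sigma_1,d_Yd_Y\sigma_1\rangle$, $S_2=\langle\sigma_2,d_X\sigma_2,d_Xd_X\sigma_2\rangle$ for nowhere-zero $\sigma_i\in\Gamma s_i$, $X\in\Gamma T_1$, $Y\in\Gamma T_2$; these give an orthogonal splitting of the trivial bundle, with $d=\mathcal{D}+\mathcal{N}$, $\mathcal{D}$ the sum of the induced connections, $\mathcal{N}\in\Omega^1(S_1\wedge S_2)$. The osculating complex $L_i$ is the unique spacelike rank 1 subbundle of $S_i$ with $\mathcal{N}L_i=0$. With unit $l_i\in\Gamma L_i$, the osculating bundles are $\mathcal{H}_1=\langle l_1,d_Yl_1,d_Yd_Yl_1\rangle$, $\mathcal{H}_2=\langle l_2,d_Xl_2,d_Xd_Xl_2\rangle$, rank 3 and mutually orthogonal. Spherical curvature lines along $T_i$ lie on the spheres represented by $L_i$. Joachimsthal surface: $\mathfrak{f}$ has one family of planar curvature lines (lying in planes through a fixed line) while the curvature lines of the other family lie on spheres intersecting the surface orthogonally (spheres with centres on that line). In the paper's terms: up to interchanging indices, $\mathcal{H}_1$ and $\mathcal{H}_2$ are constant of signature $(2,1)$ with $\mathfrak{p}\in\mathcal{H}_1$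 and $\mathfrak{q}\in\mathcal{H}_2$. Lie applicable: $f$ is Lie applicable if there is a gauge potential $\eta\in\Omega^1(f\wedge f^\perp)$ with $d\eta=[\eta\wedge\eta]=0$ and $\mathcal{Q}^\eta(X,Y)=\mathrm{tr}(f\to f:\sigma\mapsto\eta(X)d_Y\sigma)$ non-zero. Then $d+m\eta$ is flat for $m\in\mathbb{R}$. For $m\ne0$ and a $(d+m\eta)$-parallel null rank 1 subbundle $\hat s$ nowhere orthogonal to $f$, the Legendre map $\hat f:=\hat s\oplus s_0$, $s_0:=f\cap\hat s^\perp$, is called an $m$-Darboux transform of $f$; the relation is symmetric ($f$ is then an $m$-Darboux transform of $\hat f$), and $(f,\hat f)$ is called an $m$-Darboux pair.
   Formalization: The claim fails where a curve of osculating complexes is lightlike, as a cyclide degenerates there; so the immersion condition in "Legendre map" for the two Dupin cyclides is asserted only on the open dense set where d_Y l_1 and d_X l_2 are non-lightlike; all else holds on all of Σ. *)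

theory Defs
  imports "HOL-Analysis.Analysis"
begin

subsection \<open>Smooth surfaces\<close>

text \<open>On an open set \<open>S\<close>, \<open>C_k_on k S f\<close> says that \<open>f\<close> is of class \<open>C\<^sup>k\<close>.\<close>

primrec C_k_on :: "nat \<Rightarrow> 'a::real_normed_vector set \<Rightarrow> ('a \<Rightarrow> 'b::real_normed_vector) \<Rightarrow> bool" where
  "C_k_on 0 S f \<longleftrightarrow> continuous_on S f"
| "C_k_on (Suc k) S f \<longleftrightarrow> (\<forall>x\<in>S. f differentiable (at x)) \<and>
     (\<forall>v. C_k_on k S (\<lambda>x. frechet_derivative f (at x) v))"

definition smooth_on :: "'a::real_normed_vector set \<Rightarrow> ('a \<Rightarrow> 'b::real_normed_vector) \<Rightarrow> bool" where
  "smooth_on S f \<longleftrightarrow> (\<forall>k. C_k_on k S f)"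

type_synonym 'a chart = "'a set \<times> ('a \<Rightarrow> real^2)"

abbreviation chart_inv :: "'a chart \<Rightarrow> real^2 \<Rightarrow> 'a" where
  "chart_inv c \<equiv> inv_into (fst c) (snd c)"

text \<open>The points of the surface are all points of the type \<open>'a\<close>.\<close>

definition smooth_surface :: "'a::{t2_space, second_countable_topology} chart set \<Rightarrow> bool" where
  "smooth_surface A \<longleftrightarrow>
     (\<Union>c\<in>A. fst c) = UNIV \<and>
     (\<forall>c\<in>A. open (fst c) \<and> open (snd c ` fst c) \<and>
        homeomorphism (fst c) (snd c ` fst c) (snd c) (chart_inv c)) \<and>
     (\<forall>c\<in>A. \<forall>c'\<in>A. smooth_on (snd c ` (fst c \<inter> fst c')) (snd c' \<circ> chart_inv c))"

definition smooth_map :: "'a chart set \<Rightarrow> 'a set \<Rightarrow> ('a \<Rightarrow> 'b::real_normed_vector) \<Rightarrow> bool" where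
  "smooth_map A W \<sigma> \<longleftrightarrow> (\<forall>c\<in>A. smooth_on (snd c ` (fst c \<inter> W)) (\<sigma> \<circ> chart_inv c))"

text \<open>The tangent space at \<open>x\<close> is identified with \<open>real^2\<close> by means of one chart around \<open>x\<close>, chosen
  once and for all (and varying discontinuously with \<open>x\<close>). Hence \<open>dif A (snd c) x\<close>
  converts a tangent vector at \<open>x\<close> to its coordinates in any other chart \<open>c\<close>, and smoothness of
  a vector field must be tested in those coordinates.\<close>

definition chart_at :: "'a chart set \<Rightarrow> 'a \<Rightarrow> 'a chart" where
  "chart_at A x = (SOME c. c \<in> A \<and> x \<in> fst c)"

definition dif :: "'a chart set \<Rightarrow> ('a \<Rightarrow> 'b::real_normed_vector) \<Rightarrow> 'a \<Rightarrow> real^2 \<Rightarrow> 'b" where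
  "dif A \<sigma> x v =
     frechet_derivative (\<sigma> \<circ> chart_inv (chart_at A x)) (at (snd (chart_at A x) x)) v"

definition smooth_vector_field :: "'a chart set \<Rightarrow> 'a set \<Rightarrow> ('a \<Rightarrow> real^2) \<Rightarrow> bool" where
  "smooth_vector_field A W X \<longleftrightarrow>
     (\<forall>c\<in>A. smooth_map A (fst c \<inter> W) (\<lambda>x. dif A (snd c) x (X x)))"

definition deriv_along ::
    "'a chart set \<Rightarrow> ('a \<Rightarrow> real^2) \<Rightarrow> ('a \<Rightarrow> 'b::real_normed_vector) \<Rightarrow> 'a \<Rightarrow> 'b" where
  "deriv_along A X \<sigma> = (\<lambda>x. dif A \<sigma> x (X x))"

text \<open>A rank 1 subbundle of the tangent bundle.\<close>

definition line_field :: "'a::topological_space chart set \<Rightarrow> ('a \<Rightarrow> (real^2) set) \<Rightarrow> bool" where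
  "line_field A T \<longleftrightarrow>
     (\<forall>x. subspace (T x) \<and> dim (T x) = 1 \<and>
        (\<exists>W X. open W \<and> x \<in> W \<and> smooth_vector_field A W X \<and> (\<forall>y\<in>W. T y = span {X y})))"

definition local_field ::
    "'a::topological_space chart set \<Rightarrow> 'a set \<Rightarrow> ('a \<Rightarrow> (real^2) set) \<Rightarrow> ('a \<Rightarrow> real^2) \<Rightarrow> bool" where
  "local_field A W T X \<longleftrightarrow> open W \<and> smooth_vector_field A W X \<and> (\<forall>y\<in>W. X y \<in> T y)"

definition leaf :: "'a::topological_space chart set \<Rightarrow> ('a \<Rightarrow> (real^2) set) \<Rightarrow> 'a \<Rightarrow> 'a set" where
  "leaf A T x = {\<gamma> 1 |\<gamma> :: real \<Rightarrow> 'a. path \<gamma> \<and> \<gamma> 0 = x \<and>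
     (\<forall>t\<in>{0..1}. \<exists>v\<in>T (\<gamma> t).
        ((snd (chart_at A (\<gamma> t)) \<circ> \<gamma>) has_vector_derivative v) (at t within {0..1}))}"

subsection \<open>The space \<open>R\<^sup>4\<^sup>,\<^sup>2\<close>\<close>

type_synonym r42 = "(real^4) \<times> (real^2)"

definition form :: "r42 \<Rightarrow> r42 \<Rightarrow> real" where
  "form a b = fst a \<bullet> fst b - snd a \<bullet> snd b"

definition perp :: "r42 set \<Rightarrow> r42 set" where
  "perp V = {b. \<forall>a\<in>V. form a b = 0}"

definition totally_isotropic :: "r42 set \<Rightarrow> bool" where
  "totally_isotropic V \<longleftrightarrow> (\<forall>a\<in>V. \<forall>b\<in>V. form a b = 0)"

definition has_signature :: "r42 set \<Rightarrow> nat \<Rightarrow> nat \<Rightarrow> bool" where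
  "has_signature V r s \<longleftrightarrow>
     (\<exists>P N. finite P \<and> card P = r \<and> finite N \<and> card N = s \<and> span (P \<union> N) = V \<and>
        (\<forall>a\<in>P. form a a = 1) \<and> (\<forall>a\<in>N. form a a = -1) \<and>
        (\<forall>a\<in>P \<union> N. \<forall>b\<in>P \<union> N. a \<noteq> b \<longrightarrow> form a b = 0))"

text \<open>Elements of \<open>\<wedge>\<^sup>2 R\<^sup>4\<^sup>,\<^sup>2\<close> are regarded as endomorphisms of \<open>R\<^sup>4\<^sup>,\<^sup>2\<close>.\<close>

definition wedge :: "r42 \<Rightarrow> r42 \<Rightarrow> r42 \<Rightarrow>\<^sub>L r42" where
  "wedge a b = Blinfun (\<lambda>c. form a c *\<^sub>R b - form b c *\<^sub>R a)"

definition wedge_space :: "r42 set \<Rightarrow> r42 set \<Rightarrow> (r42 \<Rightarrow>\<^sub>L r42) set" where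
  "wedge_space V U = span {wedge a b |a b. a \<in> V \<and> b \<in> U}"

text \<open>Projection to \<open>V\<close> along \<open>U\<close>, where \<open>R\<^sup>4\<^sup>,\<^sup>2\<close> is the direct sum of \<open>V\<close> and \<open>U\<close>.\<close>

definition proj_along :: "r42 set \<Rightarrow> r42 set \<Rightarrow> r42 \<Rightarrow> r42" where
  "proj_along V U w = (THE a. a \<in> V \<and> w - a \<in> U)"

text \<open>Trace of an endomorphism of the subspace \<open>V\<close>.\<close>

definition trace_on :: "r42 set \<Rightarrow> (r42 \<Rightarrow> r42) \<Rightarrow> real" where
  "trace_on V g =
     (let B = (SOME B. independent B \<and> span B = V) in \<Sum>b\<in>B. representation B (g b) b)"

subsection \<open>Subbundles of the trivial bundle\<close>

definition subbundle ::
    "'a::topological_space chart set \<Rightarrow> nat \<Rightarrow> ('a \<Rightarrow> r42 set) \<Rightarrow> bool" where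
  "subbundle A k V \<longleftrightarrow>
     (\<forall>x. subspace (V x) \<and> dim (V x) = k \<and>
        (\<exists>W \<sigma>. open W \<and> x \<in> W \<and> (\<forall>i<k. smooth_map A W (\<sigma> i)) \<and>
           (\<forall>y\<in>W. V y = span ((\<lambda>i. \<sigma> i y) ` {..<k}))))"

definition local_section ::
    "'a::topological_space chart set \<Rightarrow> 'a set \<Rightarrow> ('a \<Rightarrow> r42 set) \<Rightarrow> ('a \<Rightarrow> r42) \<Rightarrow> bool" where
  "local_section A W V \<sigma> \<longleftrightarrow> open W \<and> smooth_map A W \<sigma> \<and> (\<forall>y\<in>W. \<sigma> y \<in> V y)"

text \<open>The map from the surface to the Grassmannian given by \<open>V\<close> is immersive at \<open>x\<close>: its
  differential takes \<open>v\<close> to the map from \<open>V x\<close> to its quotient space induced by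
  differentiating sections along \<open>v\<close>.\<close>

definition immersive_at :: "'a::topological_space chart set \<Rightarrow> ('a \<Rightarrow> r42 set) \<Rightarrow> 'a \<Rightarrow> bool" where
  "immersive_at A V x \<longleftrightarrow>
     (\<forall>v. (\<forall>W \<sigma>. local_section A W V \<sigma> \<and> x \<in> W \<longrightarrow> dif A \<sigma> x v \<in> V x) \<longrightarrow> v = 0)"

definition constant_along ::
    "'a::topological_space chart set \<Rightarrow> ('a \<Rightarrow> (real^2) set) \<Rightarrow> ('a \<Rightarrow> r42 set) \<Rightarrow> bool" where
  "constant_along A T V \<longleftrightarrow> (\<forall>x. \<forall>y\<in>leaf A T x. V y = V x)"

subsection \<open>Legendre maps\<close>

text \<open>The immersion condition is imposed at the points of \<open>D\<close> only. Legendre maps are the case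
  \<open>D = UNIV\<close>.\<close>

definition legendre_map_on ::
    "'a::topological_space chart set \<Rightarrow> 'a set \<Rightarrow> ('a \<Rightarrow> r42 set) \<Rightarrow> bool" where
  "legendre_map_on A D f \<longleftrightarrow>
     subbundle A 2 f \<and> (\<forall>x. totally_isotropic (f x)) \<and>
     (\<forall>W \<sigma> x v. local_section A W f \<sigma> \<and> x \<in> W \<longrightarrow> dif A \<sigma> x v \<in> perp (f x)) \<and>
     (\<forall>x\<in>D. immersive_at A f x)"

abbreviation legendre_map :: "'a::topological_space chart set \<Rightarrow> ('a \<Rightarrow> r42 set) \<Rightarrow> bool" where
  "legendre_map A f \<equiv> legendre_map_on A UNIV f"

definition curvature_spheres :: "'a::topological_space chart set \<Rightarrow> ('a \<Rightarrow> r42 set) \<Rightarrow>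
    ('a \<Rightarrow> r42 set) \<Rightarrow> ('a \<Rightarrow> r42 set) \<Rightarrow> ('a \<Rightarrow> (real^2) set) \<Rightarrow> ('a \<Rightarrow> (real^2) set) \<Rightarrow> bool" where
  "curvature_spheres A f s1 s2 T1 T2 \<longleftrightarrow>
     subbundle A 1 s1 \<and> subbundle A 1 s2 \<and>
     (\<forall>x. s1 x \<subseteq> f x \<and> s2 x \<subseteq> f x \<and> s1 x \<inter> s2 x = {0}) \<and>
     line_field A T1 \<and> line_field A T2 \<and>
     (\<forall>W \<sigma> x v. local_section A W s1 \<sigma> \<and> x \<in> W \<and> v \<in> T1 x \<longrightarrow> dif A \<sigma> x v \<in> f x) \<and>
     (\<forall>W \<sigma> x v. local_section A W s2 \<sigma> \<and> x \<in> W \<and> v \<in> T2 x \<longrightarrow> dif A \<sigma> x v \<in> f x)"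

definition umbilic_free :: "'a::topological_space chart set \<Rightarrow> ('a \<Rightarrow> r42 set) \<Rightarrow> bool" where
  "umbilic_free A f \<longleftrightarrow> (\<exists>s1 s2 T1 T2. curvature_spheres A f s1 s2 T1 T2)"

definition regular :: "'a::topological_space chart set \<Rightarrow> ('a \<Rightarrow> r42 set) \<Rightarrow> bool" where
  "regular A f \<longleftrightarrow>
     (\<forall>s1 s2 T1 T2. curvature_spheres A f s1 s2 T1 T2 \<longrightarrow>
        (\<forall>x. immersive_at A s1 x \<and> immersive_at A s2 x))"

text \<open>Again, Dupin cyclides are the case \<open>D = UNIV\<close>.\<close>

definition dupin_cyclide_on ::
    "'a::topological_space chart set \<Rightarrow> 'a set \<Rightarrow> ('a \<Rightarrow> r42 set) \<Rightarrow> bool" where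
  "dupin_cyclide_on A D f \<longleftrightarrow>
     legendre_map_on A D f \<and>
     (\<exists>s1 s2 T1 T2. curvature_spheres A f s1 s2 T1 T2 \<and>
        constant_along A T1 s1 \<and> constant_along A T2 s2)"

subsection \<open>Osculating complexes and osculating bundles\<close>

text \<open>The span of \<open>\<sigma>\<close>, \<open>d\<^sub>X \<sigma>\<close>, \<open>d\<^sub>X d\<^sub>X \<sigma>\<close> at \<open>x\<close>, for \<open>\<sigma>\<close> a local section of the rank 1 bundle \<open>V\<close>
  normalised by \<open>P\<close> and \<open>X\<close> a nowhere-zero local section of \<open>T\<close>. As this span does not depend
  on \<open>\<sigma>\<close> and \<open>X\<close>, all choices are put together.\<close>

definition osc_span :: "'a::topological_space chart set \<Rightarrow> (r42 \<Rightarrow> bool) \<Rightarrow> ('a \<Rightarrow> r42 set) \<Rightarrow>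
    ('a \<Rightarrow> (real^2) set) \<Rightarrow> 'a \<Rightarrow> r42 set" where
  "osc_span A P V T x =
     span (\<Union>{{\<sigma> x, deriv_along A X \<sigma> x, deriv_along A X (deriv_along A X \<sigma>) x} |W \<sigma> X.
        x \<in> W \<and> local_section A W V \<sigma> \<and> (\<forall>y\<in>W. P (\<sigma> y)) \<and>
        local_field A W T X \<and> (\<forall>y\<in>W. X y \<noteq> 0)})"

text \<open>\<open>sphere_osc A s1 T2\<close> is \<open>S\<^sub>1\<close> and \<open>sphere_osc A s2 T1\<close> is \<open>S\<^sub>2\<close>.\<close>

definition sphere_osc :: "'a::topological_space chart set \<Rightarrow> ('a \<Rightarrow> r42 set) \<Rightarrow>
    ('a \<Rightarrow> (real^2) set) \<Rightarrow> 'a \<Rightarrow> r42 set" where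
  "sphere_osc A s T = osc_span A (\<lambda>a. a \<noteq> 0) s T"

text \<open>\<open>osculating_bundle A L1 T2\<close> is \<open>H\<^sub>1\<close> and \<open>osculating_bundle A L2 T1\<close> is \<open>H\<^sub>2\<close>.\<close>

definition osculating_bundle :: "'a::topological_space chart set \<Rightarrow> ('a \<Rightarrow> r42 set) \<Rightarrow>
    ('a \<Rightarrow> (real^2) set) \<Rightarrow> 'a \<Rightarrow> r42 set" where
  "osculating_bundle A L T = osc_span A (\<lambda>a. form a a = 1) L T"

text \<open>The direct sum \<open>D\<close> of the connections induced on two complementary bundles \<open>S\<close>, \<open>S'\<close>, and
  \<open>N = d - D\<close>.\<close>

definition induced_connection :: "'a chart set \<Rightarrow> ('a \<Rightarrow> r42 set) \<Rightarrow> ('a \<Rightarrow> r42 set) \<Rightarrow>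
    ('a \<Rightarrow> r42) \<Rightarrow> 'a \<Rightarrow> real^2 \<Rightarrow> r42" where
  "induced_connection A S S' \<sigma> x v =
     proj_along (S x) (S' x) (dif A (\<lambda>y. proj_along (S y) (S' y) (\<sigma> y)) x v) +
     proj_along (S' x) (S x) (dif A (\<lambda>y. proj_along (S' y) (S y) (\<sigma> y)) x v)"

definition normal_part :: "'a chart set \<Rightarrow> ('a \<Rightarrow> r42 set) \<Rightarrow> ('a \<Rightarrow> r42 set) \<Rightarrow>
    ('a \<Rightarrow> r42) \<Rightarrow> 'a \<Rightarrow> real^2 \<Rightarrow> r42" where
  "normal_part A S S' \<sigma> x v = dif A \<sigma> x v - induced_connection A S S' \<sigma> x v"

text \<open>\<open>L\<close> is the osculating complex contained in \<open>S\<close>.\<close>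

definition osculating_complex :: "'a::topological_space chart set \<Rightarrow> ('a \<Rightarrow> r42 set) \<Rightarrow>
    ('a \<Rightarrow> r42 set) \<Rightarrow> ('a \<Rightarrow> r42 set) \<Rightarrow> bool" where
  "osculating_complex A S S' L \<longleftrightarrow>
     subbundle A 1 L \<and>
     (\<forall>x. L x \<subseteq> S x \<and> (\<forall>a\<in>L x. a \<noteq> 0 \<longrightarrow> form a a > 0)) \<and>
     (\<forall>W \<sigma> x v. local_section A W L \<sigma> \<and> x \<in> W \<longrightarrow> normal_part A S S' \<sigma> x v = 0)"

text \<open>The points at which neither of the two curves of osculating complexes is lightlike: with
  \<open>l\<^sub>i\<close> a unit section of \<open>L\<^sub>i\<close>, both \<open>(d\<^sub>Y l\<^sub>1, d\<^sub>Y l\<^sub>1)\<close> and \<open>(d\<^sub>X l\<^sub>2, d\<^sub>X l\<^sub>2)\<close> are non-zero. The second condition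
  is covered because \<open>curvature_spheres\<close> is symmetric under exchange of the two families.\<close>

definition non_lightlike_set :: "'a::topological_space chart set \<Rightarrow> ('a \<Rightarrow> r42 set) \<Rightarrow> 'a set" where
  "non_lightlike_set A f = {x. \<forall>s1 s2 T1 T2 L1 W l1 v.
     curvature_spheres A f s1 s2 T1 T2 \<and>
     osculating_complex A (sphere_osc A s1 T2) (sphere_osc A s2 T1) L1 \<and>
     local_section A W L1 l1 \<and> x \<in> W \<and> (\<forall>y\<in>W. form (l1 y) (l1 y) = 1) \<and>
     v \<in> T2 x \<and> v \<noteq> 0 \<longrightarrow>
     form (dif A l1 x v) (dif A l1 x v) \<noteq> 0}"

subsection \<open>Joachimsthal surfaces in Euclidean space forms\<close>

definition euclidean_space_form :: "r42 \<Rightarrow> r42 \<Rightarrow> bool" where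
  "euclidean_space_form p q \<longleftrightarrow> form p p = -1 \<and> q \<noteq> 0 \<and> form q q = 0 \<and> form p q = 0"

definition space_form :: "r42 \<Rightarrow> r42 \<Rightarrow> r42 set" where
  "space_form p q = {y. form y y = 0 \<and> form y q = -1 \<and> form y p = 0}"

definition projects_to_joachimsthal ::
    "'a::topological_space chart set \<Rightarrow> r42 \<Rightarrow> r42 \<Rightarrow> ('a \<Rightarrow> r42 set) \<Rightarrow> bool" where
  "projects_to_joachimsthal A p q f \<longleftrightarrow>
     (\<forall>x. \<exists>!y. y \<in> f x \<inter> space_form p q) \<and>
     (\<exists>s1 s2 T1 T2 L1 L2 H1 H2.
        curvature_spheres A f s1 s2 T1 T2 \<and>
        osculating_complex A (sphere_osc A s1 T2) (sphere_osc A s2 T1) L1 \<and>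
        osculating_complex A (sphere_osc A s2 T1) (sphere_osc A s1 T2) L2 \<and>
        (\<forall>x. osculating_bundle A L1 T2 x = H1) \<and> (\<forall>x. osculating_bundle A L2 T1 x = H2) \<and>
        has_signature H1 2 1 \<and> has_signature H2 2 1 \<and> p \<in> H1 \<and> q \<in> H2)"

subsection \<open>Gauge potentials and Darboux transforms\<close>

definition smooth_one_form ::
    "'a::topological_space chart set \<Rightarrow> ('a \<Rightarrow> real^2 \<Rightarrow> 'b::real_normed_vector) \<Rightarrow> bool" where
  "smooth_one_form A \<eta> \<longleftrightarrow>
     (\<forall>x. linear (\<eta> x)) \<and>
     (\<forall>W X. open W \<and> smooth_vector_field A W X \<longrightarrow> smooth_map A W (\<lambda>x. \<eta> x (X x)))"

text \<open>The vector field with constant coordinates \<open>w\<close> in the chart \<open>c\<close>.\<close>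

definition coord_field :: "'a chart set \<Rightarrow> 'a chart \<Rightarrow> real^2 \<Rightarrow> 'a \<Rightarrow> real^2" where
  "coord_field A c w y = (THE v. dif A (snd c) y v = w)"

text \<open>\<open>d\<eta>(V,W) = V(\<eta>(W)) - W(\<eta>(V))\<close> for the commuting fields \<open>V\<close>, \<open>W\<close> with coordinates \<open>v\<close>, \<open>w\<close>.\<close>

definition ext_deriv :: "'a chart set \<Rightarrow> ('a \<Rightarrow> real^2 \<Rightarrow> 'b::real_normed_vector) \<Rightarrow>
    'a \<Rightarrow> real^2 \<Rightarrow> real^2 \<Rightarrow> 'b" where
  "ext_deriv A \<eta> x v w =
     dif A (\<lambda>y. \<eta> y (coord_field A (chart_at A x) w y)) x v -
     dif A (\<lambda>y. \<eta> y (coord_field A (chart_at A x) v y)) x w"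

text \<open>\<open>[\<eta>\<wedge>\<eta>](X,Y) = 2 [\<eta>(X),\<eta>(Y)]\<close>\<close>

definition bracket_wedge :: "('a \<Rightarrow> real^2 \<Rightarrow> r42 \<Rightarrow>\<^sub>L r42) \<Rightarrow> 'a \<Rightarrow> real^2 \<Rightarrow> real^2 \<Rightarrow> r42 \<Rightarrow>\<^sub>L r42" where
  "bracket_wedge \<eta> x v w = 2 *\<^sub>R ((\<eta> x v o\<^sub>L \<eta> x w) - (\<eta> x w o\<^sub>L \<eta> x v))"

text \<open>For \<open>\<eta>\<close> with values in \<open>f \<wedge> f\<^sup>\<bottom>\<close>, which annihilates \<open>f\<close>, the vector \<open>\<eta>(X) d\<^sub>Y \<sigma>\<close> at \<open>x\<close> only depends
  on \<open>\<sigma> x\<close>, so any local section through a given vector may be used.\<close>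

definition quadratic_differential :: "'a::topological_space chart set \<Rightarrow> ('a \<Rightarrow> r42 set) \<Rightarrow>
    ('a \<Rightarrow> real^2 \<Rightarrow> r42 \<Rightarrow>\<^sub>L r42) \<Rightarrow> 'a \<Rightarrow> real^2 \<Rightarrow> real^2 \<Rightarrow> real" where
  "quadratic_differential A f \<eta> x v w =
     trace_on (f x) (\<lambda>u. blinfun_apply (\<eta> x v)
       (dif A (SOME \<sigma>. \<exists>W. x \<in> W \<and> local_section A W f \<sigma> \<and> \<sigma> x = u) x w))"

definition gauge_potential :: "'a::topological_space chart set \<Rightarrow> ('a \<Rightarrow> r42 set) \<Rightarrow>
    ('a \<Rightarrow> real^2 \<Rightarrow> r42 \<Rightarrow>\<^sub>L r42) \<Rightarrow> bool" where
  "gauge_potential A f \<eta> \<longleftrightarrow>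
     smooth_one_form A \<eta> \<and> (\<forall>x v. \<eta> x v \<in> wedge_space (f x) (perp (f x))) \<and>
     (\<forall>x v w. ext_deriv A \<eta> x v w = 0) \<and>
     (\<forall>x v w. bracket_wedge \<eta> x v w = 0) \<and>
     (\<exists>x v w. quadratic_differential A f \<eta> x v w \<noteq> 0)"

definition parallel_subbundle :: "'a::topological_space chart set \<Rightarrow>
    ('a \<Rightarrow> real^2 \<Rightarrow> r42 \<Rightarrow>\<^sub>L r42) \<Rightarrow> real \<Rightarrow> ('a \<Rightarrow> r42 set) \<Rightarrow> bool" where
  "parallel_subbundle A \<eta> m s \<longleftrightarrow>
     (\<forall>W \<sigma> x v. local_section A W s \<sigma> \<and> x \<in> W \<longrightarrow>
        dif A \<sigma> x v + m *\<^sub>R blinfun_apply (\<eta> x v) (\<sigma> x) \<in> s x)"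

text \<open>\<open>g\<close> is a Darboux transform of \<open>f\<close>.\<close>

definition darboux_transform ::
    "'a::topological_space chart set \<Rightarrow> ('a \<Rightarrow> r42 set) \<Rightarrow> ('a \<Rightarrow> r42 set) \<Rightarrow> bool" where
  "darboux_transform A f g \<longleftrightarrow>
     (\<exists>\<eta> m s. gauge_potential A f \<eta> \<and> m \<noteq> 0 \<and>
        subbundle A 1 s \<and> (\<forall>x. totally_isotropic (s x)) \<and> parallel_subbundle A \<eta> m s \<and>
        (\<forall>x. \<not> s x \<subseteq> perp (f x)) \<and>
        (\<forall>x. g x = {a + b |a b. a \<in> s x \<and> b \<in> f x \<inter> perp (s x)}))"

end

theory Submission
  imports Defs
begin

text \<open>
  Let \<open>X\<close>, \<open>Y\<close> be fields along the two families of curvature lines \<open>T\<^sub>1\<close>, \<open>T\<^sub>2\<close>, let \<open>\<sigma>\<^sub>1\<close>, \<open>\<sigma>\<^sub>2\<close> span the curvature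
  spheres and let \<open>l\<^sub>1\<close>, \<open>l\<^sub>2\<close> be unit sections of the osculating complexes.

  The osculating bundles \<open>S\<^sub>1\<close>, \<open>S\<^sub>2\<close> of a regular Legendre map are orthogonal complements of each other
  (\<open>osculating_orthogonal\<close>, \<open>osculating_split\<close>), so that the defining property of the osculating complexes says that
  \<open>dl\<^sub>i\<close> stays in \<open>S\<^sub>i\<close>. It follows that \<open>f\<close> is orthogonal to \<open>l\<^sub>1\<close> and \<open>l\<^sub>2\<close> and that \<open>d\<^sub>X l\<^sub>1\<close> is a multiple of \<open>\<sigma>\<^sub>1\<close>.
  When \<open>H\<^sub>1\<close> is constant this multiple vanishes, since otherwise \<open>H\<^sub>1\<close>, of signature \<open>(2,1)\<close>, would contain the null plane
  \<open>f\<close> (\<open>dX_l1_zero\<close>). Hence \<open>l\<^sub>1\<close> is a curve in \<open>H\<^sub>1\<close> depending only on the position transversal to \<open>T\<^sub>1\<close>,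
  and \<open>l\<^sub>2\<close> likewise in \<open>H\<^sub>2\<close>. Neither \<open>d\<^sub>Y l\<^sub>1\<close> nor \<open>d\<^sub>X l\<^sub>2\<close> can be lightlike on an open set, which gives the
  density of the set of non-lightlike points; that this set may be computed from one choice of curvature data
  is the uniqueness of the curvature spheres and of the osculating complexes.

  The space orthogonal to \<open>l\<^sub>1\<close> in \<open>H\<^sub>1\<close> has signature \<open>(1,1)\<close> and so contains two null lines \<open>n\<^sub>1\<^sup>\<plusminus>\<close>, constant along \<open>T\<^sub>1\<close>;
  similarly there are \<open>n\<^sub>2\<^sup>\<plusminus>\<close> in \<open>H\<^sub>2\<close>. As \<open>f\<close> meets \<open>H\<^sub>1\<close> and \<open>H\<^sub>2\<close> only in 0 (\<open>f_inter_H1\<close>), it is the graph of an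
  anti-isometry between the two complements, and with suitable labels and scales \<open>f\<close> is spanned by
  \<open>n\<^sub>1\<^sup>+ + n\<^sub>2\<^sup>+\<close> and \<open>n\<^sub>1\<^sup>- + n\<^sub>2\<^sup>-\<close>. The labels could be exchanged by monodromy; the point sphere of the Euclidean space
  form and the timelike vector \<open>p\<close> single out one labelling on the whole surface (\<open>two_null_pairs\<close>).

  The planes spanned by \<open>n\<^sub>1\<^sup>+\<close>, \<open>n\<^sub>2\<^sup>+\<close> and by \<open>n\<^sub>1\<^sup>-\<close>, \<open>n\<^sub>2\<^sup>-\<close> are the two Dupin cyclides. For the first one,
  write \<open>\<kappa>\<^sub>i = (n\<^sub>i\<^sup>+, n\<^sub>i\<^sup>-)\<close>, so that \<open>\<kappa>\<^sub>2 = - \<kappa>\<^sub>1\<close>. The 1-form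
  \<open>\<eta> = (n\<^sub>1\<^sup>-, dl\<^sub>1) n\<^sub>1\<^sup>+ \<and> l\<^sub>1 / \<kappa>\<^sub>1 + (n\<^sub>2\<^sup>-, dl\<^sub>2) n\<^sub>2\<^sup>+ \<and> l\<^sub>2 / \<kappa>\<^sub>2\<close>
  is a gauge potential for it, each summand being closed because it lives on a curve, and commuting with the other because
  \<open>H\<^sub>1\<close> and \<open>H\<^sub>2\<close> are orthogonal. The line spanned by \<open>n\<^sub>1\<^sup>- + n\<^sub>2\<^sup>-\<close> is parallel for \<open>d + \<eta>\<close> by the Legendre condition on
  \<open>f\<close>, and the resulting Darboux transform is \<open>f\<close> (\<open>darboux\<close>). Exchanging the signs gives the second cyclide.
\<close>

section \<open>Calculus of smooth maps between normed spaces\<close>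

lemma frechet_derivative_eqI:
  "(f has_derivative f') (at x) \<Longrightarrow> frechet_derivative f (at x) = f'"
  by (metis frechet_derivative_at)

lemma frechet_derivative_cong_open:
  assumes "open S" "x \<in> S" "\<And>y. y \<in> S \<Longrightarrow> f y = g y" "f differentiable (at x)"
  shows "g differentiable (at x)" "frechet_derivative g (at x) = frechet_derivative f (at x)"
proof -
  have "(f has_derivative frechet_derivative f (at x)) (at x)"
    using assms(4) frechet_derivative_works by blast
  then have "(g has_derivative frechet_derivative f (at x)) (at x)"
    by (rule has_derivative_transform_within_open[OF _ assms(1,2)]) (use assms(3) in auto)
  then show "g differentiable (at x)" "frechet_derivative g (at x) = frechet_derivative f (at x)"
    using frechet_derivative_eqI differentiableI by blast+
qed

lemma C_k_on_cong:
  assumes "open S" "\<And>x. x \<in> S \<Longrightarrow> f x = g x"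
  shows "C_k_on k S f \<Longrightarrow> C_k_on k S g"
  using assms(2)
proof (induction k arbitrary: f g)
  case 0
  then show ?case by (auto cong: continuous_on_cong)
next
  case (Suc k)
  have fr: "x \<in> S \<Longrightarrow> g differentiable (at x)"
    "x \<in> S \<Longrightarrow> frechet_derivative f (at x) = frechet_derivative g (at x)" for x
    using frechet_derivative_cong_open[OF assms(1), of x f g] Suc.prems by auto
  show ?case using Suc.IH[of "\<lambda>x. frechet_derivative f (at x) v" "\<lambda>x. frechet_derivative g (at x) v" for v]
      Suc.prems fr by auto
qed

lemma C_k_on_subset: "C_k_on k S f \<Longrightarrow> T \<subseteq> S \<Longrightarrow> C_k_on k T f"
  by (induction k arbitrary: f) (auto intro: continuous_on_subset)

lemma C_k_on_SucD: "C_k_on (Suc k) S f \<Longrightarrow> C_k_on k S f"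
  by (induction k arbitrary: f)
    (auto intro!: continuous_at_imp_continuous_on differentiable_imp_continuous_within)

lemma C_k_on_const: "C_k_on k S (\<lambda>_. c)"
  by (induction k arbitrary: c) (auto simp: frechet_derivative_const)

lemma C_k_on_local:
  assumes "\<And>x. x \<in> S \<Longrightarrow> \<exists>U. open U \<and> x \<in> U \<and> C_k_on k U f"
  shows "C_k_on k S f"
  using assms
proof (induction k arbitrary: f)
  case 0
  show ?case unfolding C_k_on.simps
  proof (rule continuous_at_imp_continuous_on, safe)
    fix x assume "x \<in> S"
    then obtain U where "open U" "x \<in> U" "continuous_on U f" using 0[of x] by auto
    then show "isCont f x" by (simp add: continuous_on_eq_continuous_at)
  qed
next
  case (Suc k)
  have "f differentiable (at x)" if "x \<in> S" for x using Suc.prems[OF that] by auto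
  moreover have "C_k_on k S (\<lambda>x. frechet_derivative f (at x) v)" for v
  proof (rule Suc.IH)
    fix x assume "x \<in> S"
    then show "\<exists>U. open U \<and> x \<in> U \<and> C_k_on k U (\<lambda>x. frechet_derivative f (at x) v)"
      using Suc.prems[of x] by auto
  qed
  ultimately show ?case by auto
qed

lemma C_k_on_SucI:
  assumes "open S" "\<And>x. x \<in> S \<Longrightarrow> (f has_derivative f' x) (at x)"
    "\<And>v. C_k_on k S (\<lambda>x. f' x v)"
  shows "C_k_on (Suc k) S f"
proof -
  have "C_k_on k S (\<lambda>x. frechet_derivative f (at x) v)" for v
    by (rule C_k_on_cong[OF assms(1) _ assms(3)[of v]])
      (simp add: frechet_derivative_eqI[OF assms(2)])
  moreover have "f differentiable (at x)" if "x \<in> S" for x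
    using assms(2)[OF that] by (rule differentiableI)
  ultimately show ?thesis by simp
qed

lemma C_k_on_Suc_has_derivative:
  "C_k_on (Suc k) S f \<Longrightarrow> x \<in> S \<Longrightarrow> (f has_derivative frechet_derivative f (at x)) (at x)"
  by (simp add: frechet_derivative_works[symmetric])

lemma C_k_on_add:
  assumes "open S"
  shows "C_k_on k S f \<Longrightarrow> C_k_on k S g \<Longrightarrow> C_k_on k S (\<lambda>x. f x + g x)"
proof (induction k arbitrary: f g)
  case 0
  then show ?case by (auto intro: continuous_intros)
next
  case (Suc k)
  show ?case
    by (rule C_k_on_SucI[OF assms has_derivative_add[OF C_k_on_Suc_has_derivative[OF Suc.prems(1)]
          C_k_on_Suc_has_derivative[OF Suc.prems(2)]]])
      (use Suc in auto)
qed

lemma C_k_on_linear: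
  assumes "open S" "bounded_linear h"
  shows "C_k_on k S f \<Longrightarrow> C_k_on k S (\<lambda>x. h (f x))"
proof (induction k arbitrary: f)
  case 0
  then show ?case using assms(2) by (auto intro: bounded_linear.continuous_on)
next
  case (Suc k)
  show ?case
    by (rule C_k_on_SucI[OF assms(1) bounded_linear.has_derivative[OF assms(2)
          C_k_on_Suc_has_derivative[OF Suc.prems]]])
      (use Suc in auto)
qed

lemma C_k_on_sum:
  assumes "open S" "\<And>i. i \<in> I \<Longrightarrow> C_k_on k S (f i)"
  shows "C_k_on k S (\<lambda>x. \<Sum>i\<in>I. f i x)"
  using assms(2)
  by (induction I rule: infinite_finite_induct)
    (auto intro!: C_k_on_const C_k_on_add[OF assms(1)])

lemma C_k_on_bilinear:
  assumes "open S" "bounded_bilinear B"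
  shows "C_k_on k S f \<Longrightarrow> C_k_on k S g \<Longrightarrow> C_k_on k S (\<lambda>x. B (f x) (g x))"
proof (induction k arbitrary: f g)
  case 0
  then show ?case using bounded_bilinear.continuous_on[OF assms(2)] by auto
next
  case (Suc k)
  show ?case
    by (rule C_k_on_SucI[OF assms(1) bounded_bilinear.FDERIV[OF assms(2)
          C_k_on_Suc_has_derivative[OF Suc.prems(1)] C_k_on_Suc_has_derivative[OF Suc.prems(2)]]])
      (use Suc C_k_on_SucD[OF Suc.prems(1)] C_k_on_SucD[OF Suc.prems(2)]
       in \<open>auto intro!: C_k_on_add[OF assms(1)]\<close>)
qed

text \<open>A derivative applied to a vector that itself depends on the point.\<close>

lemma C_k_on_derivative_apply:
  fixes f :: "'a::euclidean_space \<Rightarrow> 'b::real_normed_vector"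
  assumes "open S" "C_k_on (Suc k) S f" "C_k_on k S \<xi>"
  shows "C_k_on k S (\<lambda>x. frechet_derivative f (at x) (\<xi> x))"
proof -
  have "C_k_on k S (\<lambda>x. \<Sum>i\<in>Basis. (\<xi> x \<bullet> i) *\<^sub>R frechet_derivative f (at x) i)"
    by (rule C_k_on_sum[OF assms(1)], rule C_k_on_bilinear[OF assms(1) bounded_bilinear_scaleR])
      (use C_k_on_linear[OF assms(1) bounded_linear_inner_left assms(3)] assms(2) in auto)
  then show ?thesis
  proof (rule C_k_on_cong[OF assms(1), rotated])
    fix x assume "x \<in> S"
    then have "linear (frechet_derivative f (at x))"
      using assms(2) by (auto intro: linear_frechet_derivative)
    then show "(\<Sum>i\<in>Basis. (\<xi> x \<bullet> i) *\<^sub>R frechet_derivative f (at x) i) =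
        frechet_derivative f (at x) (\<xi> x)"
      by (subst (3) euclidean_representation[symmetric]) (simp add: linear_sum linear_scale)
  qed
qed

lemma C_k_on_compose:
  fixes f :: "'b::euclidean_space \<Rightarrow> 'c::real_normed_vector"
  assumes "open S" "open T" "g ` S \<subseteq> T"
  shows "C_k_on k S g \<Longrightarrow> C_k_on k T f \<Longrightarrow> C_k_on k S (\<lambda>x. f (g x))"
proof (induction k arbitrary: f)
  case 0
  then show ?case
    using continuous_on_compose2[OF _ _ assms(3), of f] by simp
next
  case (Suc k)
  have hd: "((\<lambda>x. f (g x)) has_derivative
      (\<lambda>v. frechet_derivative f (at (g x)) (frechet_derivative g (at x) v))) (at x)" if "x \<in> S" for x
    using diff_chain_at[OF C_k_on_Suc_has_derivative[OF Suc.prems(1) that]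
        C_k_on_Suc_has_derivative[OF Suc.prems(2), of "g x"]] that assms(3)
    by (auto simp: o_def)
  show ?case
  proof (rule C_k_on_SucI[OF assms(1) hd])
    fix v
    have "C_k_on k S (\<lambda>x. \<Sum>i\<in>Basis. (frechet_derivative g (at x) v \<bullet> i) *\<^sub>R
        frechet_derivative f (at (g x)) i)"
    proof (rule C_k_on_sum[OF assms(1)], rule C_k_on_bilinear[OF assms(1) bounded_bilinear_scaleR])
      fix i :: 'b
      show "C_k_on k S (\<lambda>x. frechet_derivative g (at x) v \<bullet> i)"
        using Suc.prems(1) by (intro C_k_on_linear[OF assms(1) bounded_linear_inner_left]) simp
      show "C_k_on k S (\<lambda>x. frechet_derivative f (at (g x)) i)"
        using Suc.IH[of "\<lambda>y. frechet_derivative f (at y) i"] Suc.prems(2)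
          C_k_on_SucD[OF Suc.prems(1)] by auto
    qed
    then show "C_k_on k S (\<lambda>x. frechet_derivative f (at (g x)) (frechet_derivative g (at x) v))"
    proof (rule C_k_on_cong[OF assms(1), rotated])
      fix x assume "x \<in> S"
      then have "linear (frechet_derivative f (at (g x)))"
        using Suc.prems(2) assms(3) by (auto intro!: linear_frechet_derivative)
      then show "(\<Sum>i\<in>Basis. (frechet_derivative g (at x) v \<bullet> i) *\<^sub>R
          frechet_derivative f (at (g x)) i) =
          frechet_derivative f (at (g x)) (frechet_derivative g (at x) v)"
        by (subst (3) euclidean_representation[symmetric]) (simp add: linear_sum linear_scale)
    qed
  qed
qed

lemma C_k_on_inverse_real: "C_k_on k (- {0}) (inverse :: real \<Rightarrow> real)"
proof (induction k)
  case 0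
  then show ?case by (auto intro: continuous_intros)
next
  case (Suc k)
  have op: "open (- {0::real})" by auto
  show ?case
  proof (rule C_k_on_SucI[OF op, of _ "\<lambda>x v. - (inverse x * v * inverse x)"])
    show "(inverse has_derivative (\<lambda>v. - (inverse x * v * inverse x))) (at x)"
      if "x \<in> - {0}" for x :: real
      using has_derivative_inverse'[of x UNIV] that by simp
    show "C_k_on k (- {0}) (\<lambda>x::real. - (inverse x * v * inverse x))" for v
      by (intro C_k_on_linear[OF op bounded_linear_minus[OF bounded_linear_ident]]
          C_k_on_bilinear[OF op bounded_bilinear_mult] C_k_on_const Suc)
  qed
qed

lemma C_k_on_sqrt: "C_k_on k {0<..} sqrt"
proof (induction k)
  case 0
  then show ?case by (auto intro: continuous_intros)
next
  case (Suc k)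
  have op: "open {0::real<..}" by auto
  show ?case
  proof (rule C_k_on_SucI[OF op, of _ "\<lambda>x v. inverse (sqrt x) * (v / 2)"])
    show "(sqrt has_derivative (\<lambda>v. inverse (sqrt x) * (v / 2))) (at x)" if "x \<in> {0<..}" for x
      using DERIV_real_sqrt[of x] that
      by (auto simp: has_field_derivative_def field_simps elim!: back_subst[of "\<lambda>h. (sqrt has_derivative h) (at x)"])
    have "C_k_on k {0<..} (\<lambda>x. inverse (sqrt x))"
      by (rule C_k_on_compose[OF op, of "- {0}" sqrt k inverse])
        (auto intro!: Suc C_k_on_inverse_real)
    then show "C_k_on k {0<..} (\<lambda>x. inverse (sqrt x) * (v / 2))" for v
      by (intro C_k_on_bilinear[OF op bounded_bilinear_mult] C_k_on_const) auto
  qed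
qed

subsection \<open>Symmetry of second derivatives\<close>

text \<open>Twice the mean value theorem: the second difference of \<open>f\<close> over the parallelogram with edges
  \<open>h v\<close>, \<open>h w\<close> is \<open>h\<^sup>2\<close> times a value of the mixed second derivative nearby.\<close>

lemma second_difference_mean_value:
  fixes f :: "'a::real_normed_vector \<Rightarrow> real"
  assumes C: "C_k_on 2 (ball x r) f" and h: "0 < h" "h * (norm v + norm w) < r"
  shows "\<exists>z. dist z x \<le> h * (norm v + norm w) \<and>
    f (x + h *\<^sub>R v + h *\<^sub>R w) - f (x + h *\<^sub>R v) - f (x + h *\<^sub>R w) + f x =
    h * h * frechet_derivative (\<lambda>y. frechet_derivative f (at y) v) (at z) w"
proof -
  have inb: "dist (x + s *\<^sub>R v + t *\<^sub>R w) x \<le> h * (norm v + norm w)"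
    if "0 \<le> s" "s \<le> h" "0 \<le> t" "t \<le> h" for s t
  proof -
    have "norm (s *\<^sub>R v + t *\<^sub>R w) \<le> s * norm v + t * norm w"
      using norm_triangle_ineq[of "s *\<^sub>R v" "t *\<^sub>R w"] that by simp
    also have "\<dots> \<le> h * norm v + h * norm w"
      using that by (intro add_mono mult_right_mono) auto
    finally show ?thesis by (simp add: dist_norm algebra_simps)
  qed
  then have inb': "x + s *\<^sub>R v + t *\<^sub>R w \<in> ball x r"
    if "0 \<le> s" "s \<le> h" "0 \<le> t" "t \<le> h" for s t
    using that h(2) by (smt (verit) dist_commute mem_ball)
  have D1: "(f has_derivative frechet_derivative f (at y)) (at y)" if "y \<in> ball x r" for y
    using C that by (simp add: numeral_2_eq_2 frechet_derivative_works[symmetric])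
  have D2: "((\<lambda>y. frechet_derivative f (at y) v) has_derivative
      frechet_derivative (\<lambda>y. frechet_derivative f (at y) v) (at y)) (at y)" if "y \<in> ball x r" for y
    using C that by (simp add: numeral_2_eq_2 frechet_derivative_works[symmetric])
  define g where "g s = f (x + s *\<^sub>R v + h *\<^sub>R w) - f (x + s *\<^sub>R v + 0 *\<^sub>R w)" for s
  have path1: "((\<lambda>s. f (x + s *\<^sub>R v + t *\<^sub>R w)) has_field_derivative
      frechet_derivative f (at (x + s *\<^sub>R v + t *\<^sub>R w)) v) (at s)"
    if "0 \<le> s" "s \<le> h" "0 \<le> t" "t \<le> h" for s t
  proof -
    have l: "((\<lambda>s. x + s *\<^sub>R v + t *\<^sub>R w) has_derivative (\<lambda>u. u *\<^sub>R v)) (at s)"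
      by (auto intro!: derivative_eq_intros)
    have "((\<lambda>s. f (x + s *\<^sub>R v + t *\<^sub>R w)) has_derivative
      (\<lambda>u. frechet_derivative f (at (x + s *\<^sub>R v + t *\<^sub>R w)) (u *\<^sub>R v))) (at s)"
      using diff_chain_at[OF l D1[OF inb'[OF that]]] by (simp add: o_def)
    moreover have "linear (frechet_derivative f (at (x + s *\<^sub>R v + t *\<^sub>R w)))"
      using D1[OF inb'[OF that]] has_derivative_linear by blast
    ultimately show ?thesis
      by (simp add: has_field_derivative_def linear_scale mult_commute_abs)
  qed
  have "\<exists>s. 0 < s \<and> s < h \<and> g h - g 0 = (h - 0) *
      (frechet_derivative f (at (x + s *\<^sub>R v + h *\<^sub>R w)) v - frechet_derivative f (at (x + s *\<^sub>R v + 0 *\<^sub>R w)) v)"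
    unfolding g_def
    by (rule MVT2[OF h(1)]) (use h(1) in \<open>intro DERIV_diff path1; simp\<close>)
  then obtain s where s: "0 < s" "s < h" "g h - g 0 = h *
      (frechet_derivative f (at (x + s *\<^sub>R v + h *\<^sub>R w)) v - frechet_derivative f (at (x + s *\<^sub>R v + 0 *\<^sub>R w)) v)"
    by auto
  have "\<exists>t. 0 < t \<and> t < h \<and> frechet_derivative f (at (x + s *\<^sub>R v + h *\<^sub>R w)) v -
      frechet_derivative f (at (x + s *\<^sub>R v + 0 *\<^sub>R w)) v = (h - 0) *
      frechet_derivative (\<lambda>y. frechet_derivative f (at y) v) (at (x + s *\<^sub>R v + t *\<^sub>R w)) w"
  proof (rule MVT2[OF h(1)])
    fix t assume t: "0 \<le> t" "t \<le> h"
    have inn: "x + s *\<^sub>R v + t *\<^sub>R w \<in> ball x r" using inb'[of s t] s t by auto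
    have l: "((\<lambda>t. x + s *\<^sub>R v + t *\<^sub>R w) has_derivative (\<lambda>u. u *\<^sub>R w)) (at t)"
      by (auto intro!: derivative_eq_intros)
    have "((\<lambda>t. frechet_derivative f (at (x + s *\<^sub>R v + t *\<^sub>R w)) v) has_derivative
      (\<lambda>u. frechet_derivative (\<lambda>y. frechet_derivative f (at y) v) (at (x + s *\<^sub>R v + t *\<^sub>R w)) (u *\<^sub>R w))) (at t)"
      using diff_chain_at[OF l D2[OF inn]] by (simp add: o_def)
    moreover have "linear (frechet_derivative (\<lambda>y. frechet_derivative f (at y) v) (at (x + s *\<^sub>R v + t *\<^sub>R w)))"
      using D2[OF inn] has_derivative_linear by blast
    ultimately show "((\<lambda>t. frechet_derivative f (at (x + s *\<^sub>R v + t *\<^sub>R w)) v) has_field_derivative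
      frechet_derivative (\<lambda>y. frechet_derivative f (at y) v) (at (x + s *\<^sub>R v + t *\<^sub>R w)) w) (at t)"
      by (simp add: has_field_derivative_def linear_scale mult_commute_abs)
  qed
  then obtain t where t: "0 < t" "t < h" "frechet_derivative f (at (x + s *\<^sub>R v + h *\<^sub>R w)) v -
      frechet_derivative f (at (x + s *\<^sub>R v + 0 *\<^sub>R w)) v = h *
      frechet_derivative (\<lambda>y. frechet_derivative f (at y) v) (at (x + s *\<^sub>R v + t *\<^sub>R w)) w" by auto
  show ?thesis
    by (rule exI[of _ "x + s *\<^sub>R v + t *\<^sub>R w"]) (use inb[of s t] s t in \<open>simp add: g_def algebra_simps\<close>)
qed

lemma second_derivative_symmetric_real:
  fixes f :: "'a::real_normed_vector \<Rightarrow> real"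
  assumes C: "C_k_on 2 S f" and S: "open S" "x \<in> S"
  shows "frechet_derivative (\<lambda>y. frechet_derivative f (at y) v) (at x) w =
    frechet_derivative (\<lambda>y. frechet_derivative f (at y) w) (at x) v" (is "?P x = ?Q x")
proof (rule ccontr)
  assume ne: "?P x \<noteq> ?Q x"
  define e where "e = \<bar>?P x - ?Q x\<bar> / 2"
  have e: "e > 0" using ne by (simp add: e_def)
  have "isCont ?P x" "isCont ?Q x"
    using C S by (simp_all add: numeral_2_eq_2 continuous_on_eq_continuous_at)
  then obtain d1 d2 where d: "d1 > 0" "\<And>y. dist y x < d1 \<Longrightarrow> dist (?P y) (?P x) < e"
     "d2 > 0" "\<And>y. dist y x < d2 \<Longrightarrow> dist (?Q y) (?Q x) < e"
    using e unfolding continuous_at_eps_delta by metis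
  obtain r where r: "r > 0" "ball x r \<subseteq> S" using S open_contains_ball by blast
  define b where "b = min r (min d1 d2)"
  define N where "N = norm v + norm w + 1"
  have N: "N > 0" by (simp add: N_def add_nonneg_pos)
  have b: "b > 0" using r d by (simp add: b_def)
  define h where "h = b / N"
  have h: "h > 0" using b N by (simp add: h_def)
  have hb: "h * (norm v + norm w) < b"
  proof -
    have "h * (norm v + norm w) < h * N" using h by (simp add: N_def)
    then show ?thesis using N by (simp add: h_def)
  qed
  have C': "C_k_on 2 (ball x b) f" by (rule C_k_on_subset[OF C]) (use r in \<open>auto simp: b_def\<close>)
  obtain z1 where z1: "dist z1 x \<le> h * (norm v + norm w)"
    "f (x + h *\<^sub>R v + h *\<^sub>R w) - f (x + h *\<^sub>R v) - f (x + h *\<^sub>R w) + f x = h * h * ?P z1"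
    using second_difference_mean_value[OF C' h hb] by auto
  obtain z2 where z2: "dist z2 x \<le> h * (norm v + norm w)"
    "f (x + h *\<^sub>R w + h *\<^sub>R v) - f (x + h *\<^sub>R w) - f (x + h *\<^sub>R v) + f x = h * h * ?Q z2"
    using second_difference_mean_value[OF C' h, of w v] hb by (auto simp: add.commute)
  have eq: "x + h *\<^sub>R w + h *\<^sub>R v = x + h *\<^sub>R v + h *\<^sub>R w" by simp
  have "h * h * ?P z1 = h * h * ?Q z2" using z1(2) z2(2)[unfolded eq] by linarith
  then have "?P z1 = ?Q z2" using h by simp
  moreover have "dist (?P z1) (?P x) < e" "dist (?Q z2) (?Q x) < e"
    using d(2)[of z1] d(4)[of z2] z1(1) z2(1) hb by (auto simp: b_def)
  ultimately show False unfolding e_def dist_real_def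
    by (smt (verit) field_sum_of_halves)
qed

lemma second_derivative_symmetric:
  fixes f :: "'a::real_normed_vector \<Rightarrow> 'b::real_inner"
  assumes C: "C_k_on 2 S f" and S: "open S" "x \<in> S"
  shows "frechet_derivative (\<lambda>y. frechet_derivative f (at y) v) (at x) w =
    frechet_derivative (\<lambda>y. frechet_derivative f (at y) w) (at x) v"
proof -
  have *: "frechet_derivative (\<lambda>y. frechet_derivative (\<lambda>z. f z \<bullet> u) (at y) v) (at x) w =
      frechet_derivative (\<lambda>y. frechet_derivative f (at y) v) (at x) w \<bullet> u" for u v w
  proof -
    have 1: "frechet_derivative (\<lambda>z. f z \<bullet> u) (at y) v = frechet_derivative f (at y) v \<bullet> u"
      if "y \<in> S" for y
    proof -
      have "(f has_derivative frechet_derivative f (at y)) (at y)"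
        using C that by (simp add: numeral_2_eq_2 frechet_derivative_works[symmetric])
      from bounded_linear.has_derivative[OF bounded_linear_inner_left this, of u] show ?thesis
        by (simp add: frechet_derivative_eqI)
    qed
    have "((\<lambda>y. frechet_derivative f (at y) v) has_derivative
      frechet_derivative (\<lambda>y. frechet_derivative f (at y) v) (at x)) (at x)"
      using C S(2) by (simp add: numeral_2_eq_2 frechet_derivative_works[symmetric])
    note 2 = bounded_linear.has_derivative[OF bounded_linear_inner_left this, of u]
    have "((\<lambda>y. frechet_derivative (\<lambda>z. f z \<bullet> u) (at y) v) has_derivative
      (\<lambda>w. frechet_derivative (\<lambda>y. frechet_derivative f (at y) v) (at x) w \<bullet> u)) (at x)"
      by (rule has_derivative_transform_within_open[OF 2 S]) (use 1 in auto)
    then show ?thesis by (simp add: frechet_derivative_eqI)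
  qed
  have "frechet_derivative (\<lambda>y. frechet_derivative f (at y) v) (at x) w \<bullet> u =
    frechet_derivative (\<lambda>y. frechet_derivative f (at y) w) (at x) v \<bullet> u" for u
    using second_derivative_symmetric_real[OF C_k_on_linear[OF S(1) bounded_linear_inner_left C] S]
    by (simp add: *)
  then show ?thesis by (metis inner_commute vector_eq_rdot)
qed

section \<open>Differential calculus on a smooth surface\<close>

text \<open>The product rule for a derivative applied to a vector that depends on the point.\<close>

lemma derivative_apply_has_derivative:
  fixes F :: "'a::euclidean_space \<Rightarrow> 'b::real_normed_vector"
  assumes C: "C_k_on 2 S F" "C_k_on 1 S \<xi>" and S: "open S" "x \<in> S"
  shows "((\<lambda>z. frechet_derivative F (at z) (\<xi> z)) has_derivative
    (\<lambda>w. frechet_derivative (\<lambda>z. frechet_derivative F (at z) (\<xi> x)) (at x) w +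
         frechet_derivative F (at x) (frechet_derivative \<xi> (at x) w))) (at x)"
proof -
  let ?D = "\<lambda>z. frechet_derivative F (at z)"
  have lin: "linear (?D z)" if "z \<in> S" for z
    using C(1) that by (auto simp: numeral_2_eq_2 intro: linear_frechet_derivative)
  have rep: "?D z u = (\<Sum>i\<in>Basis. (u \<bullet> i) *\<^sub>R ?D z i)" if "z \<in> S" for z u
  proof -
    have "?D z u = ?D z (\<Sum>i\<in>Basis. (u \<bullet> i) *\<^sub>R i)" by (simp add: euclidean_representation)
    also have "\<dots> = (\<Sum>i\<in>Basis. (u \<bullet> i) *\<^sub>R ?D z i)"
      using lin[OF that] by (simp add: linear_sum linear_scale)
    finally show ?thesis .
  qed
  have d2: "((\<lambda>z. ?D z u) has_derivative frechet_derivative (\<lambda>z. ?D z u) (at x)) (at x)" for u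
    using C(1) S(2) by (simp add: numeral_2_eq_2 frechet_derivative_works[symmetric])
  have d\<xi>: "(\<xi> has_derivative frechet_derivative \<xi> (at x)) (at x)"
    using C(2) S(2) by (simp add: frechet_derivative_works[symmetric])
  have sum_d: "((\<lambda>z. \<Sum>i\<in>Basis. (u \<bullet> i) *\<^sub>R ?D z i) has_derivative
      (\<lambda>w. \<Sum>i\<in>Basis. (u \<bullet> i) *\<^sub>R frechet_derivative (\<lambda>z. ?D z i) (at x) w)) (at x)" for u
    by (intro has_derivative_sum has_derivative_scaleR_right d2)
  have "((\<lambda>z. ?D z u) has_derivative
      (\<lambda>w. \<Sum>i\<in>Basis. (u \<bullet> i) *\<^sub>R frechet_derivative (\<lambda>z. ?D z i) (at x) w)) (at x)" for u
    by (rule has_derivative_transform_within_open[OF sum_d S]) (rule rep[symmetric])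
  then have e2: "frechet_derivative (\<lambda>z. ?D z u) (at x) =
      (\<lambda>w. \<Sum>i\<in>Basis. (u \<bullet> i) *\<^sub>R frechet_derivative (\<lambda>z. ?D z i) (at x) w)" for u
    by (rule frechet_derivative_eqI)
  have "((\<lambda>z. \<Sum>i\<in>Basis. (\<xi> z \<bullet> i) *\<^sub>R ?D z i) has_derivative
      (\<lambda>w. \<Sum>i\<in>Basis. (\<xi> x \<bullet> i) *\<^sub>R frechet_derivative (\<lambda>z. ?D z i) (at x) w +
        (frechet_derivative \<xi> (at x) w \<bullet> i) *\<^sub>R ?D x i)) (at x)"
    by (intro has_derivative_sum has_derivative_scaleR d2 has_derivative_inner_left d\<xi>)
  also have "(\<lambda>w. \<Sum>i\<in>Basis. (\<xi> x \<bullet> i) *\<^sub>R frechet_derivative (\<lambda>z. ?D z i) (at x) w +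
        (frechet_derivative \<xi> (at x) w \<bullet> i) *\<^sub>R ?D x i) =
      (\<lambda>w. frechet_derivative (\<lambda>z. ?D z (\<xi> x)) (at x) w + ?D x (frechet_derivative \<xi> (at x) w))"
  proof (rule ext)
    fix w
    show "(\<Sum>i\<in>Basis. (\<xi> x \<bullet> i) *\<^sub>R frechet_derivative (\<lambda>z. ?D z i) (at x) w +
        (frechet_derivative \<xi> (at x) w \<bullet> i) *\<^sub>R ?D x i) =
      frechet_derivative (\<lambda>z. ?D z (\<xi> x)) (at x) w + ?D x (frechet_derivative \<xi> (at x) w)"
      using rep[OF S(2), of "frechet_derivative \<xi> (at x) w"] by (simp only: sum.distrib e2[of "\<xi> x"])
  qed
  finally show ?thesis
    by (rule has_derivative_transform_within_open[OF _ S]) (rule rep[symmetric])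
qed

subsection \<open>Smooth maps\<close>

locale surface =
  fixes A :: "'a::{t2_space, second_countable_topology} chart set"
  assumes smooth_surface: "smooth_surface A"
begin

lemma chart_at: "chart_at A x \<in> A" "x \<in> fst (chart_at A x)"
proof -
  have "\<exists>c. c \<in> A \<and> x \<in> fst c" using smooth_surface unfolding smooth_surface_def by blast
  from someI_ex[OF this] show "chart_at A x \<in> A" "x \<in> fst (chart_at A x)"
    unfolding chart_at_def by auto
qed

lemma chart_homeomorphism:
  assumes "c \<in> A"
  shows "open (fst c)" "open (snd c ` fst c)"
    "homeomorphism (fst c) (snd c ` fst c) (snd c) (chart_inv c)"
  using smooth_surface assms unfolding smooth_surface_def by blast+

lemma chart_inv_chart [simp]: "c \<in> A \<Longrightarrow> x \<in> fst c \<Longrightarrow> chart_inv c (snd c x) = x"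
  using chart_homeomorphism(3)[of c] unfolding homeomorphism_def by blast

lemma open_chart_image:
  assumes "c \<in> A" "open W"
  shows "open (snd c ` (fst c \<inter> W))"
proof -
  have "openin (top_of_set (snd c ` fst c)) (snd c ` (fst c \<inter> W))"
    by (rule homeomorphism_imp_open_map[OF chart_homeomorphism(3)[OF assms(1)]])
      (simp add: assms(2) openin_open_Int)
  then show ?thesis
    using chart_homeomorphism(2)[OF assms(1)] openin_open_eq by blast
qed

lemma chart_in_image: "c \<in> A \<Longrightarrow> x \<in> fst c \<Longrightarrow> x \<in> W \<Longrightarrow> snd c x \<in> snd c ` (fst c \<inter> W)"
  by blast

lemma smooth_map_chart: "c \<in> A \<Longrightarrow> smooth_map A (fst c) (snd c)"
  using smooth_surface unfolding smooth_surface_def smooth_map_def by blast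

lemma smooth_map_subset: "smooth_map A W \<sigma> \<Longrightarrow> W' \<subseteq> W \<Longrightarrow> smooth_map A W' \<sigma>"
  unfolding smooth_map_def smooth_on_def by (blast intro: C_k_on_subset)

lemma smooth_map_Ck:
  "smooth_map A W \<sigma> \<Longrightarrow> c \<in> A \<Longrightarrow> C_k_on k (snd c ` (fst c \<inter> W)) (\<sigma> \<circ> chart_inv c)"
  unfolding smooth_map_def smooth_on_def by blast

lemma smooth_mapI:
  "(\<And>c k. c \<in> A \<Longrightarrow> C_k_on k (snd c ` (fst c \<inter> W)) (\<lambda>z. \<sigma> (chart_inv c z))) \<Longrightarrow> smooth_map A W \<sigma>"
  unfolding smooth_map_def smooth_on_def o_def by blast

lemma smooth_map_Ck':
  "smooth_map A W \<sigma> \<Longrightarrow> c \<in> A \<Longrightarrow> C_k_on k (snd c ` (fst c \<inter> W)) (\<lambda>z. \<sigma> (chart_inv c z))"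
  using smooth_map_Ck unfolding o_def .

lemma smooth_map_local:
  assumes "\<And>x. x \<in> W \<Longrightarrow> \<exists>U. open U \<and> x \<in> U \<and> smooth_map A U \<sigma>"
  shows "smooth_map A W \<sigma>"
proof (rule smooth_mapI, rule C_k_on_local)
  fix c k z assume c: "c \<in> A" and "z \<in> snd c ` (fst c \<inter> W)"
  then obtain x where x: "x \<in> fst c" "x \<in> W" "z = snd c x" by auto
  obtain U where U: "open U" "x \<in> U" "smooth_map A U \<sigma>" using assms[OF x(2)] by auto
  then show "\<exists>U. open U \<and> z \<in> U \<and> C_k_on k U (\<lambda>z. \<sigma> (chart_inv c z))"
    using open_chart_image[OF c U(1)] smooth_map_Ck'[OF U(3) c] x by blast
qed

lemma smooth_map_cong:
  assumes "open W" "\<And>y. y \<in> W \<Longrightarrow> f y = g y" "smooth_map A W f"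
  shows "smooth_map A W g"
proof (rule smooth_mapI)
  fix c k assume c: "c \<in> A"
  show "C_k_on k (snd c ` (fst c \<inter> W)) (\<lambda>z. g (chart_inv c z))"
    by (rule C_k_on_cong[OF open_chart_image[OF c assms(1)] _ smooth_map_Ck'[OF assms(3) c]])
      (use c assms(2) in auto)
qed

lemma smooth_map_const [simp]: "smooth_map A W (\<lambda>_. c)"
  by (rule smooth_mapI) (rule C_k_on_const)

lemma smooth_map_linear:
  "open W \<Longrightarrow> bounded_linear h \<Longrightarrow> smooth_map A W f \<Longrightarrow> smooth_map A W (\<lambda>x. h (f x))"
  by (rule smooth_mapI, rule C_k_on_linear) (simp_all add: open_chart_image smooth_map_Ck')

lemma smooth_map_bilinear:
  "open W \<Longrightarrow> bounded_bilinear B \<Longrightarrow> smooth_map A W f \<Longrightarrow> smooth_map A W g \<Longrightarrow>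
    smooth_map A W (\<lambda>x. B (f x) (g x))"
  by (rule smooth_mapI, rule C_k_on_bilinear[of _ B]) (simp_all add: open_chart_image smooth_map_Ck')

lemma smooth_map_add:
  "open W \<Longrightarrow> smooth_map A W f \<Longrightarrow> smooth_map A W g \<Longrightarrow> smooth_map A W (\<lambda>x. f x + g x)"
  by (rule smooth_mapI, rule C_k_on_add) (simp_all add: open_chart_image smooth_map_Ck')

lemma smooth_map_compose:
  fixes F :: "'b::euclidean_space \<Rightarrow> 'c::real_normed_vector"
  assumes "open W" "open T" "\<And>x. x \<in> W \<Longrightarrow> f x \<in> T" "smooth_map A W f" "\<And>k. C_k_on k T F"
  shows "smooth_map A W (\<lambda>x. F (f x))"
proof (rule smooth_mapI)
  fix c k assume c: "c \<in> A"
  show "C_k_on k (snd c ` (fst c \<inter> W)) (\<lambda>z. F (f (chart_inv c z)))"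
    by (rule C_k_on_compose[OF open_chart_image[OF c assms(1)] assms(2) _
          smooth_map_Ck'[OF assms(4) c] assms(5)]) (use c assms(3) in auto)
qed

lemma smooth_map_inverse:
  "open W \<Longrightarrow> smooth_map A W f \<Longrightarrow> (\<And>x. x \<in> W \<Longrightarrow> f x \<noteq> (0::real)) \<Longrightarrow> smooth_map A W (\<lambda>x. inverse (f x))"
  by (rule smooth_map_compose[of W "- {0}"]) (auto intro: C_k_on_inverse_real)

lemma smooth_map_sqrt:
  "open W \<Longrightarrow> smooth_map A W f \<Longrightarrow> (\<And>x. x \<in> W \<Longrightarrow> f x > 0) \<Longrightarrow> smooth_map A W (\<lambda>x. sqrt (f x))"
  by (rule smooth_map_compose[of W "{0<..}"]) (auto intro: C_k_on_sqrt)

lemmas smooth_map_scaleR = smooth_map_bilinear[OF _ bounded_bilinear_scaleR]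
lemmas smooth_map_mult = smooth_map_bilinear[OF _ bounded_bilinear_mult]
lemmas smooth_map_inner = smooth_map_bilinear[OF _ bounded_bilinear_inner]

lemma smooth_map_uminus: "open W \<Longrightarrow> smooth_map A W f \<Longrightarrow> smooth_map A W (\<lambda>x. - f x)"
  by (rule smooth_map_linear[OF _ bounded_linear_minus[OF bounded_linear_ident]])

lemma smooth_map_diff:
  "open W \<Longrightarrow> smooth_map A W f \<Longrightarrow> smooth_map A W g \<Longrightarrow> smooth_map A W (\<lambda>x. f x - g x)"
  using smooth_map_add[OF _ _ smooth_map_uminus, of W f g] by simp

lemma smooth_map_divide:
  "open W \<Longrightarrow> smooth_map A W f \<Longrightarrow> smooth_map A W g \<Longrightarrow> (\<And>x. x \<in> W \<Longrightarrow> g x \<noteq> (0::real)) \<Longrightarrow>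
    smooth_map A W (\<lambda>x. f x / g x)"
  using smooth_map_mult[OF _ _ smooth_map_inverse, of W f g] by (simp add: divide_inverse)

subsection \<open>Differentials\<close>

lemma smooth_map_has_derivative:
  assumes "smooth_map A W \<sigma>" "x \<in> W" "c \<in> A" "x \<in> fst c"
  shows "((\<sigma> \<circ> chart_inv c) has_derivative frechet_derivative (\<sigma> \<circ> chart_inv c) (at (snd c x))) (at (snd c x))"
  by (rule C_k_on_Suc_has_derivative[OF smooth_map_Ck[OF assms(1,3), of "Suc 0"]])
    (use assms in blast)

lemma has_derivative_dif:
  assumes "smooth_map A W \<sigma>" "x \<in> W"
  shows "((\<sigma> \<circ> chart_inv (chart_at A x)) has_derivative dif A \<sigma> x) (at (snd (chart_at A x) x))"
  using smooth_map_has_derivative[OF assms chart_at] unfolding dif_def .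

lemma dif_eqI:
  "((\<lambda>z. \<sigma> (chart_inv (chart_at A x) z)) has_derivative D) (at (snd (chart_at A x) x)) \<Longrightarrow> dif A \<sigma> x = D"
  unfolding dif_def[abs_def] o_def by (rule ext) (simp add: frechet_derivative_eqI)

lemma linear_dif: "smooth_map A W \<sigma> \<Longrightarrow> x \<in> W \<Longrightarrow> linear (dif A \<sigma> x)"
  using has_derivative_dif has_derivative_linear by blast

lemma dif_add_vec: "smooth_map A W \<sigma> \<Longrightarrow> x \<in> W \<Longrightarrow> dif A \<sigma> x (v + w) = dif A \<sigma> x v + dif A \<sigma> x w"
  using linear_dif linear_add by blast

lemma dif_scale_vec: "smooth_map A W \<sigma> \<Longrightarrow> x \<in> W \<Longrightarrow> dif A \<sigma> x (a *\<^sub>R v) = a *\<^sub>R dif A \<sigma> x v"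
  using linear_dif linear_scale by blast

lemma dif_cong:
  assumes "open W" "x \<in> W" "smooth_map A W f" "\<And>y. y \<in> W \<Longrightarrow> f y = g y"
  shows "dif A f x = dif A g x"
proof -
  have "((\<lambda>z. g (chart_inv (chart_at A x) z)) has_derivative dif A f x) (at (snd (chart_at A x) x))"
    by (rule has_derivative_transform_within_open[OF has_derivative_dif[OF assms(3,2)]
          open_chart_image[OF chart_at(1) assms(1)] chart_in_image[OF chart_at assms(2)]])
      (use assms(4) chart_at in \<open>auto simp: chart_inv_chart[OF chart_at(1)]\<close>)
  then show ?thesis by (simp add: dif_eqI)
qed

lemma dif_const [simp]: "dif A (\<lambda>_. c) x v = 0"
  using dif_eqI[of "\<lambda>_. c", OF has_derivative_const] by simp

lemma dif_locally_const: "open W \<Longrightarrow> x \<in> W \<Longrightarrow> (\<And>y. y \<in> W \<Longrightarrow> f y = c) \<Longrightarrow> dif A f x v = 0"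
  using dif_cong[of W x "\<lambda>_. c" f] by (metis dif_const smooth_map_const)

lemma dif_linear:
  assumes "bounded_linear h" "smooth_map A W f" "x \<in> W"
  shows "dif A (\<lambda>y. h (f y)) x v = h (dif A f x v)"
  using dif_eqI[of "\<lambda>y. h (f y)", OF bounded_linear.has_derivative[OF assms(1)
      has_derivative_dif[OF assms(2,3), unfolded o_def]]] by simp

lemma dif_bilinear:
  assumes "bounded_bilinear B" "smooth_map A W f" "smooth_map A W g" "x \<in> W"
  shows "dif A (\<lambda>y. B (f y) (g y)) x v = B (f x) (dif A g x v) + B (dif A f x v) (g x)"
proof -
  have "dif A (\<lambda>y. B (f y) (g y)) x =
      (\<lambda>v. B (f (chart_inv (chart_at A x) (snd (chart_at A x) x))) (dif A g x v) +
           B (dif A f x v) (g (chart_inv (chart_at A x) (snd (chart_at A x) x))))"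
    by (rule dif_eqI, rule bounded_bilinear.FDERIV[OF assms(1)
      has_derivative_dif[OF assms(2,4), unfolded o_def] has_derivative_dif[OF assms(3,4), unfolded o_def]])
  then show ?thesis by (simp add: chart_at)
qed

lemma dif_add:
  assumes "smooth_map A W f" "smooth_map A W g" "x \<in> W"
  shows "dif A (\<lambda>y. f y + g y) x v = dif A f x v + dif A g x v"
  using dif_eqI[of "\<lambda>y. f y + g y", OF has_derivative_add[OF
      has_derivative_dif[OF assms(1,3), unfolded o_def] has_derivative_dif[OF assms(2,3), unfolded o_def]]]
  by simp

lemma dif_diff:
  assumes "smooth_map A W f" "smooth_map A W g" "x \<in> W"
  shows "dif A (\<lambda>y. f y - g y) x v = dif A f x v - dif A g x v"
  using dif_eqI[of "\<lambda>y. f y - g y", OF has_derivative_diff[OF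
      has_derivative_dif[OF assms(1,3), unfolded o_def] has_derivative_dif[OF assms(2,3), unfolded o_def]]]
  by simp

lemmas dif_scaleR = dif_bilinear[OF bounded_bilinear_scaleR]

lemma smooth_map_continuous:
  assumes "open W" "smooth_map A W \<sigma>"
  shows "continuous_on W \<sigma>"
proof (rule continuous_at_imp_continuous_on, safe)
  fix x assume x: "x \<in> W"
  define c where "c = chart_at A x"
  have c: "c \<in> A" "x \<in> fst c" using chart_at c_def by auto
  have "continuous_on (snd c ` (fst c \<inter> W)) (\<sigma> \<circ> chart_inv c)"
    using smooth_map_Ck[OF assms(2) c(1), of 0] by simp
  moreover have "continuous_on (fst c \<inter> W) (snd c)"
    by (rule continuous_on_subset[OF homeomorphism_cont1[OF chart_homeomorphism(3)[OF c(1)]]]) simp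
  ultimately have "continuous_on (fst c \<inter> W) (\<lambda>y. (\<sigma> \<circ> chart_inv c) (snd c y))"
    by (rule continuous_on_compose2) simp
  then have "continuous_on (fst c \<inter> W) \<sigma>"
    by (rule continuous_on_eq) (use c in auto)
  then show "isCont \<sigma> x"
    using continuous_on_eq_continuous_at[of "fst c \<inter> W"] chart_homeomorphism(1)[OF c(1)] assms(1) c x by auto
qed

text \<open>The differential computed in an arbitrary chart.\<close>

lemma dif_in_chart:
  assumes "smooth_map A W \<sigma>" "open W" "x \<in> W" "c \<in> A" "x \<in> fst c"
  shows "dif A \<sigma> x v = frechet_derivative (\<sigma> \<circ> chart_inv c) (at (snd c x)) (dif A (snd c) x v)"
proof -
  define d where "d = chart_at A x"
  have d: "d \<in> A" "x \<in> fst d" using chart_at d_def by auto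
  have op: "open (fst c \<inter> W)" using chart_homeomorphism(1)[OF assms(4)] assms(2) by (rule open_Int)
  have 1: "((snd c \<circ> chart_inv d) has_derivative dif A (snd c) x) (at (snd d x))"
    using has_derivative_dif[OF smooth_map_chart[OF assms(4)] assms(5)] by (simp add: d_def)
  have 2: "((\<sigma> \<circ> chart_inv c) has_derivative frechet_derivative (\<sigma> \<circ> chart_inv c) (at (snd c x)))
      (at ((snd c \<circ> chart_inv d) (snd d x)))"
    using smooth_map_has_derivative[OF assms(1,3,4,5)] d by simp
  have "((\<lambda>z. \<sigma> (chart_inv d z)) has_derivative
      frechet_derivative (\<sigma> \<circ> chart_inv c) (at (snd c x)) \<circ> dif A (snd c) x) (at (snd d x))"
    by (rule has_derivative_transform_within_open[OF diff_chain_at[OF 1 2]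
          open_chart_image[OF d(1) op]]) (use d assms in auto)
  then show ?thesis using dif_eqI[of \<sigma> x] by (simp add: d_def)
qed

lemma dif_own_chart [simp]: "dif A (snd (chart_at A x)) x v = v"
proof -
  define d where "d = chart_at A x"
  have d: "d \<in> A" "x \<in> fst d" using chart_at d_def by auto
  have "((\<lambda>z. snd d (chart_inv d z)) has_derivative id) (at (snd d x))"
    by (rule has_derivative_transform_within_open[of id _ _ UNIV "snd d ` fst d"])
      (use chart_homeomorphism[OF d(1)] d in \<open>auto simp: has_derivative_id\<close>)
  then show ?thesis using dif_eqI[of "snd d" x] by (simp add: d_def)
qed

lemma dif_chart_bij:
  assumes "c \<in> A" "x \<in> fst c"
  shows "bij (dif A (snd c) x)"
proof -
  have lin: "linear (dif A (snd c) x)" using linear_dif smooth_map_chart assms by blast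
  have "inj (dif A (snd c) x)"
  proof (rule injI)
    fix u v assume "dif A (snd c) x u = dif A (snd c) x v"
    then have "dif A (snd (chart_at A x)) x u = dif A (snd (chart_at A x)) x v"
      using dif_in_chart[OF smooth_map_chart chart_homeomorphism(1) _ assms] chart_at by metis
    then show "u = v" by simp
  qed
  then show ?thesis using linear_injective_imp_surjective[OF lin] by (simp add: bij_def)
qed

lemma smooth_vector_field_subset:
  "smooth_vector_field A W X \<Longrightarrow> W' \<subseteq> W \<Longrightarrow> smooth_vector_field A W' X"
  unfolding smooth_vector_field_def by (meson Int_mono order_refl smooth_map_subset)

lemma smooth_map_deriv_along:
  assumes W: "open W" and X: "smooth_vector_field A W X" and s: "smooth_map A W \<sigma>"
  shows "smooth_map A W (deriv_along A X \<sigma>)"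
proof (rule smooth_mapI)
  fix c k assume c: "c \<in> A"
  let ?S = "snd c ` (fst c \<inter> W)"
  have "smooth_map A (fst c \<inter> W) (\<lambda>x. dif A (snd c) x (X x))"
    using X c unfolding smooth_vector_field_def by blast
  from smooth_map_Ck'[OF this c, of k]
  have "C_k_on k ?S (\<lambda>z. dif A (snd c) (chart_inv c z) (X (chart_inv c z)))"
    by (simp add: Int_assoc[symmetric])
  from C_k_on_derivative_apply[OF open_chart_image[OF c W] smooth_map_Ck[OF s c] this]
  show "C_k_on k ?S (\<lambda>z. deriv_along A X \<sigma> (chart_inv c z))"
  proof (rule C_k_on_cong[OF open_chart_image[OF c W], rotated])
    fix z assume "z \<in> ?S"
    then obtain x where x: "x \<in> fst c" "x \<in> W" "z = snd c x" by auto
    show "frechet_derivative (\<sigma> \<circ> chart_inv c) (at z) (dif A (snd c) (chart_inv c z) (X (chart_inv c z))) =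
      deriv_along A X \<sigma> (chart_inv c z)"
      using x c dif_in_chart[OF s W x(2) c x(1)] by (simp add: deriv_along_def)
  qed
qed

text \<open>The difference of the two iterated derivatives is the derivative along the Lie bracket.\<close>

lemma deriv_along_commutator:
  fixes \<sigma> :: "'a \<Rightarrow> 'b::real_inner"
  assumes W: "open W" "x \<in> W" and X: "smooth_vector_field A W X" and Y: "smooth_vector_field A W Y"
    and s: "smooth_map A W \<sigma>"
  shows "\<exists>v. deriv_along A X (deriv_along A Y \<sigma>) x = deriv_along A Y (deriv_along A X \<sigma>) x + dif A \<sigma> x v"
proof -
  define c where "c = chart_at A x"
  have c: "c \<in> A" "x \<in> fst c" using chart_at c_def by auto
  let ?S = "snd c ` (fst c \<inter> W)"
  let ?F = "\<sigma> \<circ> chart_inv c"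
  have S: "open ?S" "snd c x \<in> ?S" using open_chart_image[OF c(1) W(1)] c W by auto
  define \<xi> where "\<xi> X z = dif A (snd c) (chart_inv c z) (X (chart_inv c z))" for X :: "'a \<Rightarrow> real^2" and z
  have *: "dif A (deriv_along A X \<sigma>) x v =
      frechet_derivative (\<lambda>z. frechet_derivative ?F (at z) (X x)) (at (snd c x)) v +
      frechet_derivative ?F (at (snd c x)) (frechet_derivative (\<xi> X) (at (snd c x)) v)"
    if X: "smooth_vector_field A W X" for X v
  proof -
    have "smooth_map A (fst c \<inter> W) (\<lambda>x. dif A (snd c) x (X x))"
      using X c unfolding smooth_vector_field_def by blast
    from smooth_map_Ck'[OF this c(1), of 1]
    have C1: "C_k_on 1 ?S (\<xi> X)"
      unfolding \<xi>_def[abs_def] by (simp only: Int_assoc[symmetric] Int_absorb)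
    have \<xi>x: "\<xi> X (snd c x) = X x" using c by (simp add: \<xi>_def) (simp add: c_def)
    note hd = derivative_apply_has_derivative[OF smooth_map_Ck[OF s c(1)] C1 S, unfolded \<xi>x]
    have "((\<lambda>z. deriv_along A X \<sigma> (chart_inv c z)) has_derivative
      (\<lambda>v. frechet_derivative (\<lambda>z. frechet_derivative ?F (at z) (X x)) (at (snd c x)) v +
      frechet_derivative ?F (at (snd c x)) (frechet_derivative (\<xi> X) (at (snd c x)) v))) (at (snd c x))"
    proof (rule has_derivative_transform_within_open[OF hd S])
      fix z assume "z \<in> ?S"
      then obtain x where x: "x \<in> fst c" "x \<in> W" "z = snd c x" by auto
      show "frechet_derivative ?F (at z) (\<xi> X z) = deriv_along A X \<sigma> (chart_inv c z)"
        using x c dif_in_chart[OF s W(1) x(2) c(1) x(1)] by (simp add: deriv_along_def \<xi>_def)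
    qed
    then show ?thesis using dif_eqI[of "deriv_along A X \<sigma>" x] by (simp add: c_def)
  qed
  have lin: "linear (frechet_derivative ?F (at (snd c x)))"
    using smooth_map_has_derivative[OF s W(2) c] has_derivative_linear by blast
  have sym: "frechet_derivative (\<lambda>z. frechet_derivative ?F (at z) (X x)) (at (snd c x)) (Y x) =
    frechet_derivative (\<lambda>z. frechet_derivative ?F (at z) (Y x)) (at (snd c x)) (X x)"
    by (rule second_derivative_symmetric[OF smooth_map_Ck[OF s c(1)] S])
  have dx: "dif A \<sigma> x v = frechet_derivative ?F (at (snd c x)) v" for v
    unfolding dif_def c_def ..
  show ?thesis
    by (rule exI[of _ "frechet_derivative (\<xi> Y) (at (snd c x)) (X x) - frechet_derivative (\<xi> X) (at (snd c x)) (Y x)"])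
      (simp add: deriv_along_def[of A X "deriv_along A Y \<sigma>"] deriv_along_def[of A Y "deriv_along A X \<sigma>"]
        *[OF X] *[OF Y] sym dx linear_diff[OF lin])
qed

subsection \<open>Coordinate fields\<close>

lemma dif_coord_field:
  assumes "c \<in> A" "y \<in> fst c"
  shows "dif A (snd c) y (coord_field A c w y) = w"
  unfolding coord_field_def
  by (rule theI') (use dif_chart_bij[OF assms] in \<open>auto simp: bij_iff\<close>)

lemma dif_coord_field_in_chart:
  assumes "smooth_map A W \<sigma>" "open W" "y \<in> W" "c \<in> A" "y \<in> fst c"
  shows "dif A \<sigma> y (coord_field A c w y) = frechet_derivative (\<sigma> \<circ> chart_inv c) (at (snd c y)) w"
  using dif_in_chart[OF assms] dif_coord_field[OF assms(4,5)] by simp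

lemma coord_field_own [simp]: "coord_field A (chart_at A x) w x = w"
  using dif_coord_field[OF chart_at] by simp

lemma smooth_map_frechet:
  assumes c: "c \<in> A" and F: "\<And>k. C_k_on k (snd c ` (fst c \<inter> W)) F" and W: "open W"
  shows "smooth_map A (fst c \<inter> W) (\<lambda>y. F (snd c y))"
proof (rule smooth_map_compose[OF _ open_chart_image[OF c W]])
  show "open (fst c \<inter> W)" using chart_homeomorphism(1)[OF c] W by auto
  show "smooth_map A (fst c \<inter> W) (snd c)" using smooth_map_subset[OF smooth_map_chart[OF c]] by auto
qed (use F in auto)

lemma smooth_vector_field_coord_field:
  assumes c: "c \<in> A"
  shows "smooth_vector_field A (fst c) (coord_field A c w)"
  unfolding smooth_vector_field_def
proof
  fix d assume d: "d \<in> A"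
  have op: "open (fst c \<inter> fst d)" using chart_homeomorphism(1)[OF c] chart_homeomorphism(1)[OF d] by (rule open_Int)
  have F: "C_k_on k (snd c ` (fst c \<inter> fst d)) (\<lambda>z. frechet_derivative (snd d \<circ> chart_inv c) (at z) w)" for k
    using smooth_map_Ck[OF smooth_map_chart[OF d] c, of "Suc k"] by simp
  have "smooth_map A (fst c \<inter> fst d) (\<lambda>y. frechet_derivative (snd d \<circ> chart_inv c) (at (snd c y)) w)"
    by (rule smooth_map_frechet[OF c F]) (use chart_homeomorphism(1) d in auto)
  then show "smooth_map A (fst d \<inter> fst c) (\<lambda>x. dif A (snd d) x (coord_field A c w x))"
    unfolding Int_commute[of "fst d"]
    by (rule smooth_map_cong[OF op, rotated])
      (use dif_coord_field_in_chart[OF smooth_map_chart[OF d] chart_homeomorphism(1)[OF d] _ c] in auto)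
qed

text \<open>Second derivatives along two coordinate fields of the distinguished chart at \<open>x\<close>.\<close>

lemma coord_fields_commute:
  fixes \<sigma> :: "'a \<Rightarrow> 'b::real_inner"
  assumes s: "smooth_map A W \<sigma>" and W: "open W" "x \<in> W"
  defines "c \<equiv> chart_at A x"
  shows "dif A (\<lambda>y. dif A \<sigma> y (coord_field A c w y)) x v = dif A (\<lambda>y. dif A \<sigma> y (coord_field A c v y)) x w"
proof -
  have c: "c \<in> A" "x \<in> fst c" using chart_at c_def by auto
  let ?S = "snd c ` (fst c \<inter> W)"
  have S: "open ?S" "snd c x \<in> ?S" using open_chart_image[OF c(1) W(1)] c W by auto
  have *: "dif A (\<lambda>y. dif A \<sigma> y (coord_field A c w y)) x v =
     frechet_derivative (\<lambda>z. frechet_derivative (\<sigma> \<circ> chart_inv c) (at z) w) (at (snd c x)) v" for v w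
  proof -
    have "C_k_on 1 ?S (\<lambda>z. frechet_derivative (\<sigma> \<circ> chart_inv c) (at z) w)"
      using smooth_map_Ck[OF s c(1), of "Suc 1"] by simp
    then have hd: "((\<lambda>z. frechet_derivative (\<sigma> \<circ> chart_inv c) (at z) w) has_derivative
        frechet_derivative (\<lambda>z. frechet_derivative (\<sigma> \<circ> chart_inv c) (at z) w) (at (snd c x))) (at (snd c x))"
      using S(2) unfolding One_nat_def by (rule C_k_on_Suc_has_derivative)
    have "((\<lambda>z. dif A \<sigma> (chart_inv c z) (coord_field A c w (chart_inv c z))) has_derivative
        frechet_derivative (\<lambda>z. frechet_derivative (\<sigma> \<circ> chart_inv c) (at z) w) (at (snd c x))) (at (snd c x))"
      by (rule has_derivative_transform_within_open[OF hd S])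
        (use c dif_coord_field_in_chart[OF s W(1) _ c(1)] in auto)
    then show ?thesis using dif_eqI[of "\<lambda>y. dif A \<sigma> y (coord_field A c w y)" x] by (simp add: c_def)
  qed
  show ?thesis unfolding * by (rule second_derivative_symmetric[OF smooth_map_Ck[OF s c(1)] S])
qed

subsection \<open>Curves\<close>

lemma dif_along_curve:
  assumes g: "path \<gamma>" "t \<in> {0..1}"
    and v: "((snd (chart_at A (\<gamma> t)) \<circ> \<gamma>) has_vector_derivative v) (at t within {0..1})"
    and s: "smooth_map A W \<sigma>" "\<gamma> t \<in> W"
  shows "((\<lambda>t. \<sigma> (\<gamma> t)) has_vector_derivative dif A \<sigma> (\<gamma> t) v) (at t within {0..1})"
proof -
  define c where "c = chart_at A (\<gamma> t)"
  have c: "c \<in> A" "\<gamma> t \<in> fst c" using chart_at c_def by auto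
  have 1: "((\<lambda>t. (\<sigma> \<circ> chart_inv c) ((snd c \<circ> \<gamma>) t)) has_derivative (\<lambda>h. dif A \<sigma> (\<gamma> t) (h *\<^sub>R v))) (at t within {0..1})"
    using has_derivative_compose[OF v[unfolded has_vector_derivative_def], of "\<sigma> \<circ> chart_inv c" "dif A \<sigma> (\<gamma> t)"]
      has_derivative_dif[OF s] by (simp add: c_def)
  have "continuous (at t within {0..1}) \<gamma>"
    using g by (simp add: path_def continuous_on_eq_continuous_within)
  then have "eventually (\<lambda>u. \<gamma> u \<in> fst c) (at t within {0..1})"
    unfolding continuous_within using chart_homeomorphism(1)[OF c(1)] c(2) by (rule topological_tendstoD)
  then have "eventually (\<lambda>u. (\<sigma> \<circ> chart_inv c) ((snd c \<circ> \<gamma>) u) = \<sigma> (\<gamma> u)) (at t within {0..1})"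
    by eventually_elim (use c in auto)
  from has_derivative_transform_eventually[OF 1 this]
  show ?thesis using c g unfolding has_vector_derivative_def
    by (simp add: dif_scale_vec[OF s])
qed

end

section \<open>Linear algebra of the form of signature (4,2)\<close>

lemma bounded_bilinear_form: "bounded_bilinear form"
proof
  have "norm (form a b) \<le> norm a * norm b * 2" for a b
  proof -
    have "\<bar>fst a \<bullet> fst b\<bar> \<le> norm a * norm b"
      by (rule order_trans[OF Cauchy_Schwarz_ineq2 mult_mono]) (simp_all, (metis norm_fst_le prod.collapse)+)
    moreover have "\<bar>snd a \<bullet> snd b\<bar> \<le> norm a * norm b"
      by (rule order_trans[OF Cauchy_Schwarz_ineq2 mult_mono]) (simp_all, (metis norm_snd_le prod.collapse)+)
    ultimately show ?thesis unfolding form_def real_norm_def by linarith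
  qed
  then show "\<exists>K. \<forall>a b. norm (form a b) \<le> norm a * norm b * K" by blast
qed (simp_all add: form_def inner_add_left inner_add_right algebra_simps)

interpretation form: bounded_bilinear form by (rule bounded_bilinear_form)

lemmas form_simps = form.add_left form.add_right form.diff_left form.diff_right
  form.scaleR_left form.scaleR_right form.minus_left form.minus_right
  form.zero_left form.zero_right

lemma form_commute: "form a b = form b a"
  by (simp add: form_def inner_commute)

lemma form_span_zero:
  assumes "a \<in> span S" "\<And>s. s \<in> S \<Longrightarrow> form s b = 0"
  shows "form a b = 0"
  using assms(1)
proof (induction rule: span_induct)
  case base
  show ?case by (simp add: subspace_def form_simps)
qed (use assms(2) in auto)

lemma form_span_zero': "a \<in> span S \<Longrightarrow> (\<And>s. s \<in> S \<Longrightarrow> form b s = 0) \<Longrightarrow> form b a = 0"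
  using form_span_zero[of a S b] by (simp add: form_commute)

lemma notin_span_orthogonal: "(\<And>s. s \<in> S \<Longrightarrow> form s a = 0) \<Longrightarrow> form a a \<noteq> 0 \<Longrightarrow> a \<notin> span S"
  using form_span_zero by blast

lemma span_insertE:
  assumes "w \<in> span (insert a S)"
  obtains k u where "w = k *\<^sub>R a + u" "u \<in> span S"
proof -
  obtain k where "w - k *\<^sub>R a \<in> span S" using assms unfolding span_insert by blast
  then show ?thesis using that[of k "w - k *\<^sub>R a"] by simp
qed

lemma span_singletonE:
  assumes "w \<in> span {a :: 'v::real_vector}"
  obtains \<alpha> where "w = \<alpha> *\<^sub>R a"
  using assms unfolding span_singleton by blast

lemma span_pairE:
  assumes "w \<in> span {a, b :: 'v::real_vector}"
  obtains \<alpha> \<beta> where "w = \<alpha> *\<^sub>R a + \<beta> *\<^sub>R b"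
proof -
  obtain \<alpha> u where u: "w = \<alpha> *\<^sub>R a + u" "u \<in> span {b}" using span_insertE[OF assms] .
  obtain \<beta> where "u = \<beta> *\<^sub>R b" using span_singletonE[OF u(2)] .
  with u that show ?thesis by blast
qed

lemma span_tripleE:
  assumes "w \<in> span {a, b, c :: 'v::real_vector}"
  obtains \<alpha> \<beta> \<gamma> where "w = \<alpha> *\<^sub>R a + \<beta> *\<^sub>R b + \<gamma> *\<^sub>R c"
proof -
  obtain \<alpha> u where u: "w = \<alpha> *\<^sub>R a + u" "u \<in> span {b, c}" using span_insertE[OF assms] .
  obtain \<beta> \<gamma> where "u = \<beta> *\<^sub>R b + \<gamma> *\<^sub>R c" using span_pairE[OF u(2)] .
  with u that show ?thesis by (metis add.assoc)
qed

lemma span_pairI: "\<alpha> *\<^sub>R a + \<beta> *\<^sub>R b \<in> span {a, b}"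
  by (intro span_add span_scale span_base) auto

subsection \<open>Orthogonal complements\<close>

lemma subspace_perp: "subspace (perp V)"
  by (auto simp: subspace_def perp_def form_simps)

lemma perp_dim:
  assumes "subspace V"
  shows "dim (perp V) + dim V = 6"
proof -
  define J :: "r42 \<Rightarrow> r42" where "J a = (fst a, - snd a)" for a
  have J: "linear J" by (auto simp: J_def linear_iff)
  have inj: "inj J" by (auto simp: J_def inj_on_def prod_eq_iff)
  have "perp V = {y \<in> UNIV. \<forall>a\<in>J ` V. orthogonal a y}"
    by (auto simp: perp_def form_def J_def orthogonal_def inner_prod_def)
  moreover have "subspace (J ` V)" using J assms by (rule linear_subspace_image)
  ultimately have "dim (perp V) + dim (J ` V) = DIM(r42)"
    using dim_subspace_orthogonal_to_vectors[of "J ` V" UNIV] by auto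
  moreover have "dim (J ` V) = dim V"
    by (rule dim_image_eq[OF J]) (use inj in \<open>auto simp: inj_on_def\<close>)
  ultimately show ?thesis by simp
qed

lemma perp_perp:
  assumes "subspace V"
  shows "perp (perp V) = V"
proof -
  have "V = perp (perp V)"
  proof (rule subspace_dim_equal[OF assms subspace_perp])
    show "V \<subseteq> perp (perp V)" by (auto simp: perp_def form_commute)
    show "dim V \<ge> dim (perp (perp V))"
      using perp_dim[OF assms] perp_dim[OF subspace_perp, of V] by linarith
  qed
  then show ?thesis by simp
qed

text \<open>The quotient of \<open>perp f\<close> by a null plane \<open>f\<close> is positive definite, as \<open>f\<close> exhausts the
  negative directions.\<close>

lemma null_plane_positive:
  assumes f: "subspace f" "totally_isotropic f" "dim f = 2" and w: "w \<in> perp f" "w \<notin> f"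
  shows "form w w > 0"
proof (rule ccontr)
  assume neg: "\<not> form w w > 0"
  have sf: "span f = f" using f(1) by (simp add: span_eq_iff)
  have "\<not> inj_on snd (span (insert w f))"
  proof
    assume "inj_on snd (span (insert w f))"
    from dim_image_eq[OF linear_snd this] have "dim (snd ` insert w f) = 3"
      using f w sf by (simp add: dim_insert)
    moreover have "dim (snd ` insert w f) \<le> 2" using dim_subset_UNIV[of "snd ` insert w f"] by simp
    ultimately show False by simp
  qed
  then obtain z where z: "z \<in> span (insert w f)" "snd z = 0" "z \<noteq> 0"
    using linear_inj_on_iff_eq_0[OF linear_snd subspace_span] by metis
  obtain k u where zu: "z = k *\<^sub>R w + u" "u \<in> f" using span_insertE[OF z(1)] sf by metis
  have "form w u = 0" using w zu by (auto simp: perp_def form_commute)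
  moreover have "form u u = 0" using f zu by (auto simp: totally_isotropic_def)
  ultimately have "form z z = k * k * form w w" by (simp add: zu form_simps form_commute)
  then have "form z z \<le> 0" using neg by (simp add: mult_nonneg_nonpos)
  then have "fst z = 0" using z(2) inner_gt_zero_iff[of "fst z"] by (simp add: form_def not_less[symmetric])
  then show False using z by (simp add: prod_eq_iff)
qed

text \<open>As this quotient has dimension 2, two orthogonal vectors of it form a basis.\<close>

lemma null_plane_orthogonal:
  assumes f: "subspace f" "totally_isotropic f" "dim f = 2"
    and a: "a \<in> perp f" "a \<notin> f" and b: "b \<in> perp f" "b \<notin> f" and ab: "form a b = 0"
    and w: "w \<in> perp f" "form w a = 0"
  obtains c u where "w = c *\<^sub>R b + u" "u \<in> f"
proof -
  have bb: "form b b > 0" using null_plane_positive[OF f b] .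
  have sf: "span f = f" using f(1) by (simp add: span_eq_iff)
  have pf: "subspace (perp f)" by (rule subspace_perp)
  have "a \<notin> span (insert b f)"
  proof
    assume "a \<in> span (insert b f)"
    then obtain k u where u: "a = k *\<^sub>R b + u" "u \<in> f" using span_insertE sf by metis
    have "form u b = 0" using b u by (auto simp: perp_def)
    then have "k * form b b = 0" using ab u by (simp add: form_simps)
    then show False using bb u a by simp
  qed
  then have "dim (span (insert a (insert b f))) = 4" using f b by (simp add: dim_insert sf)
  moreover have sub: "span (insert a (insert b f)) \<subseteq> perp f"
    using a b f pf by (intro span_minimal) (auto simp: totally_isotropic_def perp_def)
  ultimately have eq: "span (insert a (insert b f)) = perp f"
    using perp_dim[OF f(1)] f(3) by (intro subspace_dim_equal subspace_perp subspace_span) auto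
  define u where "u = w - (form w b / form b b) *\<^sub>R b"
  have "u \<in> perp f" unfolding u_def using w b pf by (simp add: subspace_diff subspace_scale)
  then have "u \<in> perp (insert a (insert b f))"
    using w ab bb by (auto simp: perp_def u_def form_simps form_commute)
  then have "u \<in> perp (perp f)" unfolding eq[symmetric] by (auto simp: perp_def intro: form_span_zero)
  then have "u \<in> f" using perp_perp[OF f(1)] by simp
  then show ?thesis using that[of "form w b / form b b" u] by (simp add: u_def)
qed

subsection \<open>Lorentzian 3-spaces\<close>

lemma signature_basis:
  assumes "has_signature H 2 1"
  obtains a b t where "form a a = 1" "form b b = 1" "form t t = -1" "form a b = 0" "form a t = 0"
    "form b t = 0" "H = span {a, b, t}"
proof -
  from assms obtain P N where PN: "finite P" "card P = 2" "finite N" "card N = 1" "span (P \<union> N) = H"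
    "\<forall>a\<in>P. form a a = 1" "\<forall>a\<in>N. form a a = -1"
    "\<forall>a\<in>P \<union> N. \<forall>b\<in>P \<union> N. a \<noteq> b \<longrightarrow> form a b = 0" unfolding has_signature_def by metis
  obtain a b where P: "P = {a, b}" "a \<noteq> b" using PN(2) by (auto simp: card_2_iff)
  obtain t where N: "N = {t}" using PN(4) card_1_singletonE by blast
  have "t \<noteq> a" "t \<noteq> b" using PN P N by auto
  moreover have "P \<union> N = {a, b, t}" using P N by auto
  ultimately show ?thesis using PN P N by (intro that[of a b t]) auto
qed

lemma lorentz_subspace: "has_signature H 2 1 \<Longrightarrow> subspace H"
  by (metis signature_basis subspace_span)

lemma lorentz_coordinates:
  assumes "has_signature H 2 1"
  obtains a b t where "a \<in> H" "b \<in> H" "t \<in> H" "form t t = -1"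
    "\<And>v w. v \<in> H \<Longrightarrow> w \<in> H \<Longrightarrow> form v w = form v a * form w a + form v b * form w b - form v t * form w t"
    "\<And>w. w \<in> H \<Longrightarrow> form w a = 0 \<Longrightarrow> form w b = 0 \<Longrightarrow> form w t = 0 \<Longrightarrow> w = 0"
    "dim H = 3"
proof -
  from signature_basis[OF assms] obtain a b t where B: "form a a = 1" "form b b = 1" "form t t = -1"
    "form a b = 0" "form a t = 0" "form b t = 0" "H = span {a, b, t}" by metis
  have B': "form b a = 0" "form t a = 0" "form t b = 0" using B by (simp_all add: form_commute)
  have e: "w = form w a *\<^sub>R a + form w b *\<^sub>R b - form w t *\<^sub>R t" if w: "w \<in> H" for w
  proof -
    obtain \<alpha> \<beta> \<gamma> where "w = \<alpha> *\<^sub>R a + \<beta> *\<^sub>R b + \<gamma> *\<^sub>R t"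
      using w unfolding B(7) by (rule span_tripleE)
    then show ?thesis using B B' by (simp add: form_simps)
  qed
  have "a \<notin> span {b, t}" "b \<notin> span {t}" "t \<notin> span {}"
    using B B' by (intro notin_span_orthogonal; auto)+
  then have "dim {a, b, t} = 3" by (simp add: dim_insert)
  then have d: "dim H = 3" using B(7) by simp
  have "form v w = form v a * form w a + form v b * form w b - form v t * form w t"
    if "v \<in> H" "w \<in> H" for v w
  proof -
    have "form v w = form (form v a *\<^sub>R a + form v b *\<^sub>R b - form v t *\<^sub>R t) w" using e[OF that(1)] by simp
    then show ?thesis by (simp add: form_simps form_commute[of a w] form_commute[of b w] form_commute[of t w])
  qed
  moreover have "w = 0" if "w \<in> H" "form w a = 0" "form w b = 0" "form w t = 0" for w
    using e[OF that(1)] unfolding that(2-4) by simp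
  moreover have "a \<in> H" "b \<in> H" "t \<in> H" unfolding B(7) by (simp_all add: span_base)
  ultimately show ?thesis using B(3) d that[of a b t] by blast
qed

lemma lorentz_dim: "has_signature H 2 1 \<Longrightarrow> dim H = 3"
  by (erule lorentz_coordinates)

lemma lorentz_nondegenerate:
  assumes H: "has_signature H 2 1" and "w \<in> H" "\<And>a. a \<in> H \<Longrightarrow> form w a = 0"
  shows "w = 0"
  using lorentz_coordinates[OF H] assms(2,3) by metis

lemma lorentz_timelike:
  assumes "has_signature H 2 1"
  obtains t where "t \<in> H" "form t t = -1"
  using lorentz_coordinates[OF assms] by metis

lemma lorentz_timelike_orthogonal:
  assumes H: "has_signature H 2 1" and u: "u \<in> H" "form u u < 0" and w: "w \<in> H" "form u w = 0" "w \<noteq> 0"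
  shows "form w w > 0"
proof (rule ccontr)
  assume neg: "\<not> form w w > 0"
  obtain a b t where c: "\<And>v w. v \<in> H \<Longrightarrow> w \<in> H \<Longrightarrow>
      form v w = form v a * form w a + form v b * form w b - form v t * form w t"
    "\<And>w. w \<in> H \<Longrightarrow> form w a = 0 \<Longrightarrow> form w b = 0 \<Longrightarrow> form w t = 0 \<Longrightarrow> w = 0"
    using lorentz_coordinates[OF H] by metis
  define u1 u2 u0 w1 w2 w0 where d: "u1 = form u a" "u2 = form u b" "u0 = form u t"
     "w1 = form w a" "w2 = form w b" "w0 = form w t"
  have uu: "u1\<^sup>2 + u2\<^sup>2 < u0\<^sup>2" using c(1)[OF u(1) u(1)] u(2) by (simp add: d power2_eq_square)
  have ww: "w1\<^sup>2 + w2\<^sup>2 \<le> w0\<^sup>2" using c(1)[OF w(1) w(1)] neg by (simp add: d power2_eq_square)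
  have uw: "u1 * w1 + u2 * w2 = u0 * w0" using c(1)[OF u(1) w(1)] w(2) by (simp add: d)
  have cs: "(u1 * w1 + u2 * w2)\<^sup>2 \<le> (u1\<^sup>2 + u2\<^sup>2) * (w1\<^sup>2 + w2\<^sup>2)"
  proof -
    have "(u1\<^sup>2 + u2\<^sup>2) * (w1\<^sup>2 + w2\<^sup>2) - (u1 * w1 + u2 * w2)\<^sup>2 = (u1 * w2 - u2 * w1)\<^sup>2"
      by (simp add: power2_eq_square algebra_simps)
    then show ?thesis by (smt (verit) zero_le_power2)
  qed
  have "u0\<^sup>2 * w0\<^sup>2 \<le> (u1\<^sup>2 + u2\<^sup>2) * (w1\<^sup>2 + w2\<^sup>2)" using cs uw by (simp add: power_mult_distrib)
  also have "\<dots> \<le> (u1\<^sup>2 + u2\<^sup>2) * w0\<^sup>2" using ww by (intro mult_left_mono) auto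
  finally have "(u0\<^sup>2 - (u1\<^sup>2 + u2\<^sup>2)) * w0\<^sup>2 \<le> 0" by (simp add: algebra_simps)
  then have w0: "w0 = 0" using uu by (simp add: mult_le_0_iff)
  then have "w1\<^sup>2 + w2\<^sup>2 = 0" using ww by (smt (verit) zero_le_power2 zero_power2)
  then have "w1 = 0" "w2 = 0" by (simp_all add: sum_power2_eq_zero_iff)
  then show False using w0 c(2)[OF w(1)] w(3) by (simp add: d)
qed

lemma lorentz_null_timelike:
  assumes "has_signature H 2 1" "u \<in> H" "form u u < 0" "w \<in> H" "w \<noteq> 0" "form w w = 0"
  shows "form w u \<noteq> 0"
  using lorentz_timelike_orthogonal[OF assms(1-4)] assms(5,6) by (auto simp: form_commute)

lemma lorentz_null_null:
  assumes H: "has_signature H 2 1" and u: "u \<in> H" "form u u = 0" "u \<noteq> 0"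
    and w: "w \<in> H" "form w w = 0" "form u w = 0"
  obtains c where "w = c *\<^sub>R u"
proof -
  obtain t where t: "t \<in> H" "form t t = -1" using lorentz_timelike[OF H] .
  have ut: "form u t \<noteq> 0" using lorentz_null_timelike[OF H t(1) _ u(1) u(3) u(2)] t by simp
  define z where "z = w - (form w t / form u t) *\<^sub>R u"
  have "z \<in> H" unfolding z_def using u w lorentz_subspace[OF H] by (simp add: subspace_diff subspace_scale)
  moreover have "form t z = 0" using ut by (simp add: z_def form_simps form_commute[of t])
  moreover have "form z z = 0" using u w by (simp add: z_def form_simps form_commute[of w u])
  ultimately have "z = 0" using lorentz_timelike_orthogonal[OF H t(1), of z] t by force
  then show ?thesis using that by (simp add: z_def)
qed

lemma orthogonal_triple_span:
  assumes H: "subspace H" "dim H = 3" and m: "a \<in> H" "b \<in> H" "c \<in> H"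
    and o: "form a b = 0" "form a c = 0" "form b c = 0"
    and n: "form a a \<noteq> 0" "form b b \<noteq> 0" "form c c \<noteq> 0"
  shows "span {a, b, c} = H"
proof (rule subspace_dim_equal[OF subspace_span H(1)])
  show "span {a, b, c} \<subseteq> H" using m H by (intro span_minimal) auto
  have "a \<notin> span {b, c}" "b \<notin> span {c}" "c \<notin> span {}"
    using o n by (intro notin_span_orthogonal; auto simp: form_commute)+
  then show "dim H \<le> dim (span {a, b, c})" using H by (simp add: dim_insert)
qed

lemma lorentz_spacelike_pair:
  assumes H: "has_signature H 2 1" and m: "a \<in> H" "b \<in> H" "form a b = 0" "form a a = 1" "form b b = 1"
    and z: "z \<in> H" "form a z = 0" "form b z = 0" "z \<noteq> 0"
  shows "form z z < 0"
proof -
  note subs = lorentz_subspace[OF H]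
  obtain t where t: "t \<in> H" "form t t = -1" using lorentz_timelike[OF H] .
  define t' where "t' = t - form t a *\<^sub>R a - form t b *\<^sub>R b"
  have t'H: "t' \<in> H" unfolding t'_def using subs m t by (simp add: subspace_diff subspace_scale)
  have o: "form a t' = 0" "form b t' = 0"
    using m by (simp_all add: t'_def form_simps form_commute[of a t] form_commute[of b t] form_commute[of b a])
  have "form t' t' = form t t' "
    using o by (subst (1) t'_def) (simp add: form_simps)
  also have "\<dots> = -1 - (form t a)\<^sup>2 - (form t b)\<^sup>2"
    using t by (simp add: t'_def form_simps power2_eq_square)
  finally have neg: "form t' t' < 0" by (smt (verit) zero_le_power2)
  have "span {a, b, t'} = H"
    by (rule orthogonal_triple_span) (use subs H m o neg t'H in \<open>auto simp: lorentz_dim\<close>)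
  then obtain \<alpha> \<beta> \<gamma> where zz: "z = \<alpha> *\<^sub>R a + \<beta> *\<^sub>R b + \<gamma> *\<^sub>R t'" using z(1) span_tripleE by blast
  have "\<alpha> = 0" "\<beta> = 0" using z(2,3) m o by (simp_all add: zz form_simps form_commute[of b a])
  then have "z = \<gamma> *\<^sub>R t'" "\<gamma> \<noteq> 0" using zz z(4) by auto
  moreover from this have "\<gamma> * \<gamma> > 0" using not_real_square_gt_zero by blast
  ultimately show ?thesis using neg mult_pos_neg[of "\<gamma> * \<gamma>" "form t' t'"]
    by (simp add: form_simps mult.assoc)
qed

text \<open>Orthogonal projection onto a Lorentzian 3-space.\<close>

lemma lorentz_projection:
  assumes H: "has_signature H 2 1" "has_signature H' 2 1" and o: "\<And>a b. a \<in> H \<Longrightarrow> b \<in> H' \<Longrightarrow> form a b = 0"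
  obtains \<pi> where "bounded_linear \<pi>" "\<And>w. \<pi> w \<in> H" "\<And>w. w - \<pi> w \<in> H'"
proof -
  from signature_basis[OF H(1)] obtain a b t where B: "form a a = 1" "form b b = 1" "form t t = -1"
    "form a b = 0" "form a t = 0" "form b t = 0" "H = span {a, b, t}" by metis
  have B': "form b a = 0" "form t a = 0" "form t b = 0" using B by (simp_all add: form_commute)
  define \<pi> where "\<pi> w = form w a *\<^sub>R a + form w b *\<^sub>R b - form w t *\<^sub>R t" for w
  have subs: "subspace H" "subspace H'" using lorentz_subspace H by auto
  have abt: "a \<in> H" "b \<in> H" "t \<in> H" using B(7) by (auto intro: span_base)
  have "H' = perp H"
  proof (rule subspace_dim_equal[OF subs(2) subspace_perp])
    show "H' \<subseteq> perp H" using o by (auto simp: perp_def)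
    show "dim (perp H) \<le> dim H'" using perp_dim[OF subs(1)] lorentz_dim H by simp
  qed
  moreover have "w - \<pi> w \<in> perp H" for w
  proof -
    have "form z (w - \<pi> w) = 0" if "z \<in> {a, b, t}" for z
      using that by (elim insertE emptyE) (simp_all add: \<pi>_def form_simps B B' form_commute[of _ w])
    then show ?thesis unfolding perp_def B(7) using form_span_zero[of _ "{a, b, t}" "w - \<pi> w"] by blast
  qed
  moreover have "\<pi> w \<in> H" for w
    unfolding \<pi>_def using subs(1) abt by (intro subspace_diff subspace_add subspace_scale)
  moreover have "bounded_linear \<pi>" unfolding \<pi>_def[abs_def]
    by (intro bounded_linear_sub bounded_linear_add bounded_linear_scaleR_left
        bounded_linear_compose[OF bounded_linear_scaleR_left form.bounded_linear_left])
  ultimately show ?thesis using that by blast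
qed

subsection \<open>Osculating 3-spaces of null curves\<close>

text \<open>The Gram matrix of a null vector and its first two derivatives is anti-triangular.\<close>

lemma osculating_triple:
  assumes g: "form a a = 0" "form a b = 0" "form b b \<noteq> 0" "form a c = - form b b"
  shows "dim (span {a, b, c}) = 3"
    "w \<in> span {a, b, c} \<Longrightarrow> form a w = 0 \<Longrightarrow> form b w = 0 \<Longrightarrow> form c w = 0 \<Longrightarrow> w = 0"
proof -
  have "c \<notin> span {b, a}" using form_span_zero'[of c "{b, a}" a] g by fastforce
  moreover have "b \<notin> span {a}" using form_span_zero[of b "{a}" b] g by fastforce
  moreover have "a \<noteq> 0" using g by (auto simp: form.zero_left)
  ultimately have "dim {c, b, a} = 3" by (simp add: dim_insert)
  moreover have "{c, b, a} = {a, b, c}" by auto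
  ultimately show "dim (span {a, b, c}) = 3" by simp
  assume w: "w \<in> span {a, b, c}" "form a w = 0" "form b w = 0" "form c w = 0"
  obtain \<alpha> \<beta> \<gamma> where ww: "w = \<alpha> *\<^sub>R a + \<beta> *\<^sub>R b + \<gamma> *\<^sub>R c" using w(1) by (rule span_tripleE)
  have "\<gamma> = 0" using w(2) g by (simp add: ww form_simps)
  then have "\<beta> = 0" using w(3) g by (simp add: ww form_simps form_commute[of b a])
  then have "\<alpha> = 0" using w(4) g \<open>\<gamma> = 0\<close> by (simp add: ww form_simps form_commute[of c a])
  then show "w = 0" using ww \<open>\<beta> = 0\<close> \<open>\<gamma> = 0\<close> by simp
qed

text \<open>Two orthogonal subspaces that contain such triples are spanned by them and complementary. The osculating
  bundles, being spans over all choices of sections and fields, are therefore spanned by any single choice.\<close>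

lemma osculating_triples_split:
  assumes V: "subspace V" "subspace V'" "\<And>v v'. v \<in> V \<Longrightarrow> v' \<in> V' \<Longrightarrow> form v v' = 0"
    and abc: "{a, b, c} \<subseteq> V" "form a a = 0" "form a b = 0" "form b b \<noteq> 0" "form a c = - form b b"
    and abc': "{a', b', c'} \<subseteq> V'" "form a' a' = 0" "form a' b' = 0" "form b' b' \<noteq> 0" "form a' c' = - form b' b'"
  shows "V = span {a, b, c}" "V = perp V'" "V \<inter> V' = {0}" "\<exists>v\<in>V. w - v \<in> V'"
proof -
  note d = osculating_triple(1)[OF abc(2-5)] osculating_triple(1)[OF abc'(2-5)]
  have 1: "span {a, b, c} \<subseteq> V" "span {a', b', c'} \<subseteq> V'" using abc(1) abc'(1) V(1,2) by (simp_all add: span_minimal)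
  have 2: "V \<subseteq> perp V'" using V(3) by (auto simp: perp_def form_commute)
  have 3: "dim V' \<ge> 3" using dim_subset[OF 1(2)] d by simp
  have 4: "dim (perp V') \<le> 3" using perp_dim[OF V(2)] 3 by simp
  have 5: "dim V \<ge> 3" using dim_subset[OF 1(1)] d by simp
  show 6: "V = span {a, b, c}"
    using subspace_dim_equal[OF subspace_span V(1) 1(1)] d dim_subset[OF 2] 4 by simp
  show "V = perp V'" using subspace_dim_equal[OF V(1) subspace_perp 2] 4 5 by simp
  show 7: "V \<inter> V' = {0}"
  proof -
    have "v = 0" if "v \<in> V" "v \<in> V'" for v
      using osculating_triple(2)[OF abc(2-5), of v] that V(3) abc(1) 6 by auto
    then show ?thesis using V subspace_0 by blast
  qed
  have "dim {x + y |x y. x \<in> V \<and> y \<in> V'} = 6"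
    using dim_sums_Int[OF V(1,2)] 7 3 5 perp_dim[OF V(1)] perp_dim[OF V(2)] dim_subset[OF 2]
    by simp
  then have "span {x + y |x y. x \<in> V \<and> y \<in> V'} = UNIV"
    by (subst dim_eq_full[symmetric]) simp
  then have "{x + y |x y. x \<in> V \<and> y \<in> V'} = UNIV"
    using span_eq_iff[THEN iffD2, OF subspace_sums[OF V(1,2)]] by argo
  then obtain x y where "w = x + y" "x \<in> V" "y \<in> V'" by blast
  then show "\<exists>v\<in>V. w - v \<in> V'" by (intro bexI[of _ x]) simp_all
qed

lemma proj_along_eqI:
  assumes "subspace V" "subspace U" "V \<inter> U = {0}" "a \<in> V" "w - a \<in> U"
  shows "proj_along V U w = a"
  unfolding proj_along_def
proof (rule the_equality)
  fix b assume b: "b \<in> V \<and> w - b \<in> U"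
  have "b - a \<in> V" using assms b by (simp add: subspace_diff)
  moreover have "b - a \<in> U" using subspace_diff[OF assms(2,5), of "w - b"] b by simp
  ultimately have "b - a \<in> V \<inter> U" by (rule IntI)
  then show "b = a" unfolding assms(3) by simp
qed (use assms in auto)

subsection \<open>Wedge products and traces\<close>

lemma bounded_linear_wedge: "bounded_linear (\<lambda>c. form a c *\<^sub>R b - form b c *\<^sub>R a)"
  by (intro bounded_linear_sub bounded_linear_compose[OF bounded_linear_scaleR_left form.bounded_linear_right])

lemma wedge_apply: "blinfun_apply (wedge a b) c = form a c *\<^sub>R b - form b c *\<^sub>R a"
  unfolding wedge_def by (simp add: bounded_linear_Blinfun_apply bounded_linear_wedge)

lemma bounded_bilinear_wedge: "bounded_bilinear wedge"
proof
  show "wedge (a + a') b = wedge a b + wedge a' b" "wedge b (a + a') = wedge b a + wedge b a'" for a a' b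
    by (rule blinfun_eqI; simp add: wedge_apply blinfun.add_left form_simps algebra_simps)+
  show "wedge (r *\<^sub>R a) b = r *\<^sub>R wedge a b" "wedge a (r *\<^sub>R b) = r *\<^sub>R wedge a b" for a b r
    by (rule blinfun_eqI; simp add: wedge_apply blinfun.scaleR_left form_simps algebra_simps)+
  obtain K where K: "K \<ge> 0" "\<And>a b. norm (form a b) \<le> norm a * norm b * K"
    using form.nonneg_bounded by blast
  have "norm (wedge a b) \<le> norm a * norm b * (2 * K)" for a b
  proof (rule norm_blinfun_bound)
    fix c
    have "norm (form a c *\<^sub>R b - form b c *\<^sub>R a) \<le> norm (form a c) * norm b + norm (form b c) * norm a"
      using norm_triangle_ineq4[of "form a c *\<^sub>R b" "form b c *\<^sub>R a"] by simp
    also have "\<dots> \<le> (norm a * norm c * K) * norm b + (norm b * norm c * K) * norm a"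
      by (intro add_mono mult_right_mono K) auto
    finally show "norm (blinfun_apply (wedge a b) c) \<le> norm a * norm b * (2 * K) * norm c"
      by (simp add: wedge_apply algebra_simps)
  qed (use K in auto)
  then show "\<exists>K. \<forall>a b. norm (wedge a b) \<le> norm a * norm b * K" by blast
qed

interpretation wedge: bounded_bilinear wedge by (rule bounded_bilinear_wedge)

lemma trace_on_diagonal:
  assumes ind: "u \<noteq> v" "independent {u, v}" and V: "V = span {u, v}"
    and g: "\<And>\<alpha> \<beta>. g (\<alpha> *\<^sub>R u + \<beta> *\<^sub>R v) = (a * \<alpha>) *\<^sub>R u + (d * \<beta>) *\<^sub>R v"
  shows "trace_on V g = a + d"
proof -
  define B where "B = (SOME B. independent B \<and> span B = V)"
  have "\<exists>B. independent B \<and> span B = V" using assms by blast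
  from someI_ex[OF this] have B: "independent B" "span B = V" unfolding B_def by auto
  have fB: "finite B" using B(1) independent_imp_finite by blast
  let ?c = "representation {u, v}" and ?r = "representation B"
  have uv: "u \<in> span B" "v \<in> span B" using B V by (auto intro: span_base)
  have coord: "w = ?c w u *\<^sub>R u + ?c w v *\<^sub>R v" if "w \<in> V" for w
    using sum_representation_eq[OF ind(2), of w "{u, v}"] that V ind(1) by simp
  have "?r (g b) b = a * (?c b u * ?r u b) + d * (?c b v * ?r v b)" if "b \<in> B" for b
  proof -
    have "b \<in> V" using B that by (auto intro: span_base)
    then have "g b = (a * ?c b u) *\<^sub>R u + (d * ?c b v) *\<^sub>R v" using coord g by metis
    then show ?thesis
      using uv by (simp add: representation_add[OF B(1)] representation_scale[OF B(1)] span_scale)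
  qed
  then have "(\<Sum>b\<in>B. ?r (g b) b) = a * (\<Sum>b\<in>B. ?c b u * ?r u b) + d * (\<Sum>b\<in>B. ?c b v * ?r v b)"
    by (simp add: sum.distrib sum_distrib_left)
  moreover have "(\<Sum>b\<in>B. ?c b w * ?r w b) = 1" if "w \<in> {u, v}" for w
  proof -
    have wB: "w \<in> span B" using uv that by auto
    have bV: "b \<in> span {u, v}" if "b \<in> B" for b using B(2) V span_base[OF that] by simp
    have "(\<Sum>b\<in>B. ?r w b *\<^sub>R b) = w"
      by (rule sum_representation_eq[OF B(1) wB fB order_refl])
    then have "?c w w = ?c (\<Sum>b\<in>B. ?r w b *\<^sub>R b) w" by simp
    also have "\<dots> = (\<Sum>b\<in>B. ?r w b * ?c b w)"
      using bV by (subst representation_sum[OF ind(2)])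
        (simp_all add: representation_scale[OF ind(2)] span_scale)
    finally have "?c w w = (\<Sum>b\<in>B. ?c b w * ?r w b)" by (simp add: mult.commute)
    then show ?thesis using representation_basis[OF ind(2) that] by simp
  qed
  ultimately show ?thesis unfolding trace_on_def Let_def B_def[symmetric] by simp
qed

section \<open>Curvature spheres and osculating complexes\<close>

subsection \<open>Sections of bundles of rank 1 and 2\<close>

context surface
begin

lemmas smooth_map_form = smooth_map_bilinear[OF _ bounded_bilinear_form]
lemmas dif_form = dif_bilinear[OF bounded_bilinear_form]

lemma form_const_dif:
  assumes W: "open W" "x \<in> W" and ab: "smooth_map A W a" "smooth_map A W b"
    and c: "\<And>y. y \<in> W \<Longrightarrow> form (a y) (b y) = c"
  shows "form (a x) (dif A b x v) + form (dif A a x v) (b x) = 0"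
  using dif_form[OF ab W(2), of v] dif_locally_const[OF W c, where v = v] by simp

lemma form_square_dif:
  assumes W: "open W" "x \<in> W" and a: "smooth_map A W a" and c: "\<And>y. y \<in> W \<Longrightarrow> form (a y) (a y) = c"
  shows "form (a x) (dif A a x v) = 0"
  using form_const_dif[OF W a a c, where v = v] by (simp add: form_commute)

lemma rank1_coefficient:
  fixes \<sigma> :: "'a \<Rightarrow> 'b::euclidean_space"
  assumes W: "open W" and s: "smooth_map A W \<sigma>" "smooth_map A W \<tau>"
    and nz: "\<And>y. y \<in> W \<Longrightarrow> \<sigma> y \<noteq> 0" and sp: "\<And>y. y \<in> W \<Longrightarrow> \<tau> y \<in> span {\<sigma> y}"
  obtains \<kappa> where "smooth_map A W \<kappa>" "\<And>y. y \<in> W \<Longrightarrow> \<tau> y = \<kappa> y *\<^sub>R \<sigma> y"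
proof
  show "smooth_map A W (\<lambda>y. (\<tau> y \<bullet> \<sigma> y) / (\<sigma> y \<bullet> \<sigma> y))"
    by (intro smooth_map_divide smooth_map_inner W s) (use nz in auto)
  show "\<tau> y = ((\<tau> y \<bullet> \<sigma> y) / (\<sigma> y \<bullet> \<sigma> y)) *\<^sub>R \<sigma> y" if "y \<in> W" for y
    using sp[OF that] nz[OF that] by (auto elim!: span_singletonE)
qed

lemma gram_det_nonzero:
  fixes a b :: "'b::real_inner"
  assumes "b \<noteq> 0" "a \<notin> span {b}"
  shows "(a \<bullet> a) * (b \<bullet> b) - (a \<bullet> b) * (a \<bullet> b) \<noteq> 0"
proof -
  define c where "c = a - ((a \<bullet> b) / (b \<bullet> b)) *\<^sub>R b"
  have "c \<noteq> 0"
  proof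
    assume "c = 0"
    then have "a = ((a \<bullet> b) / (b \<bullet> b)) *\<^sub>R b" by (simp add: c_def)
    then show False using assms(2) span_scale[OF span_base, of b "{b}"] by (metis singletonI)
  qed
  then have "(b \<bullet> b) * (c \<bullet> c) \<noteq> 0" using assms by simp
  also have "(b \<bullet> b) * (c \<bullet> c) = (a \<bullet> a) * (b \<bullet> b) - (a \<bullet> b) * (a \<bullet> b)"
    using assms by (simp add: c_def inner_diff_left inner_diff_right inner_commute[of b a] field_simps power2_eq_square)
  finally show ?thesis .
qed

lemma rank2_coefficients:
  fixes \<sigma> :: "'a \<Rightarrow> 'b::euclidean_space"
  assumes W: "open W" and s: "smooth_map A W \<sigma>" "smooth_map A W \<tau>" "smooth_map A W \<zeta>"
    and nz: "\<And>y. y \<in> W \<Longrightarrow> \<tau> y \<noteq> 0" "\<And>y. y \<in> W \<Longrightarrow> \<sigma> y \<notin> span {\<tau> y}"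
    and sp: "\<And>y. y \<in> W \<Longrightarrow> \<zeta> y \<in> span {\<sigma> y, \<tau> y}"
  obtains \<kappa> \<mu> where "smooth_map A W \<kappa>" "smooth_map A W \<mu>"
    "\<And>y. y \<in> W \<Longrightarrow> \<zeta> y = \<kappa> y *\<^sub>R \<sigma> y + \<mu> y *\<^sub>R \<tau> y"
proof
  let ?G = "\<lambda>y. (\<sigma> y \<bullet> \<sigma> y) * (\<tau> y \<bullet> \<tau> y) - (\<sigma> y \<bullet> \<tau> y) * (\<sigma> y \<bullet> \<tau> y)"
  let ?l = "\<lambda>y. ((\<zeta> y \<bullet> \<sigma> y) * (\<tau> y \<bullet> \<tau> y) - (\<zeta> y \<bullet> \<tau> y) * (\<sigma> y \<bullet> \<tau> y)) / ?G y"
  let ?m = "\<lambda>y. ((\<zeta> y \<bullet> \<tau> y) * (\<sigma> y \<bullet> \<sigma> y) - (\<zeta> y \<bullet> \<sigma> y) * (\<sigma> y \<bullet> \<tau> y)) / ?G y"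
  have G: "?G y \<noteq> 0" if "y \<in> W" for y using gram_det_nonzero[OF nz(1,2)[OF that]] .
  show "smooth_map A W ?l" "smooth_map A W ?m"
    by (intro smooth_map_divide smooth_map_diff smooth_map_mult smooth_map_inner W s G; assumption)+
  show "\<zeta> y = ?l y *\<^sub>R \<sigma> y + ?m y *\<^sub>R \<tau> y" if y: "y \<in> W" for y
  proof -
    obtain a b where ab: "\<zeta> y = a *\<^sub>R \<sigma> y + b *\<^sub>R \<tau> y" using span_pairE[OF sp[OF y]] .
    have "(\<zeta> y \<bullet> \<sigma> y) * (\<tau> y \<bullet> \<tau> y) - (\<zeta> y \<bullet> \<tau> y) * (\<sigma> y \<bullet> \<tau> y) = a * ?G y"
      "(\<zeta> y \<bullet> \<tau> y) * (\<sigma> y \<bullet> \<sigma> y) - (\<zeta> y \<bullet> \<sigma> y) * (\<sigma> y \<bullet> \<tau> y) = b * ?G y"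
      by (simp_all add: ab inner_add_left inner_commute[of "\<tau> y" "\<sigma> y"] algebra_simps)
    then show ?thesis using G[OF y] ab by simp
  qed
qed

lemma dif_combination:
  assumes "smooth_map A W \<kappa>" "smooth_map A W \<mu>" "smooth_map A W \<sigma>" "smooth_map A W \<tau>" "open W" "x \<in> W"
    and eq: "\<And>y. y \<in> W \<Longrightarrow> \<zeta> y = \<kappa> y *\<^sub>R \<sigma> y + \<mu> y *\<^sub>R \<tau> y"
  shows "dif A \<zeta> x v = \<kappa> x *\<^sub>R dif A \<sigma> x v + dif A \<kappa> x v *\<^sub>R \<sigma> x + \<mu> x *\<^sub>R dif A \<tau> x v + dif A \<mu> x v *\<^sub>R \<tau> x"
proof -
  have s: "smooth_map A W (\<lambda>y. \<kappa> y *\<^sub>R \<sigma> y)" "smooth_map A W (\<lambda>y. \<mu> y *\<^sub>R \<tau> y)"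
    by (intro smooth_map_scaleR assms)+
  have "dif A \<zeta> x v = dif A (\<lambda>y. \<kappa> y *\<^sub>R \<sigma> y + \<mu> y *\<^sub>R \<tau> y) x v"
    using dif_cong[OF assms(5,6) smooth_map_add[OF assms(5) s], of \<zeta>] eq by simp
  then show ?thesis
    by (simp add: dif_add[OF s assms(6)] dif_scaleR[OF assms(1,3,6)] dif_scaleR[OF assms(2,4,6)])
qed

lemma rank1_bundle_span:
  assumes "subbundle A 1 s" "a \<in> s x" "a \<noteq> 0"
  shows "s x = span {a}"
proof -
  have s: "subspace (s x)" "dim (s x) = 1" using assms(1) unfolding subbundle_def by auto
  have "span {a} = s x"
    by (rule subspace_dim_equal[OF subspace_span s(1)])
      (use s assms in \<open>simp_all add: span_minimal\<close>)
  then show ?thesis by simp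
qed

lemma line_field_span:
  assumes "line_field A T" "a \<in> T x" "a \<noteq> 0"
  shows "T x = span {a}"
proof -
  have s: "subspace (T x)" "dim (T x) = 1" using assms(1) unfolding line_field_def by auto
  have "span {a} = T x"
    by (rule subspace_dim_equal[OF subspace_span s(1)])
      (use s assms in \<open>simp_all add: span_minimal\<close>)
  then show ?thesis by simp
qed

lemma rank1_bundle_section:
  assumes "subbundle A 1 s"
  obtains W \<sigma> where "open W" "x \<in> W" "smooth_map A W \<sigma>" "\<And>y. y \<in> W \<Longrightarrow> \<sigma> y \<in> s y \<and> \<sigma> y \<noteq> 0"
proof -
  obtain W \<sigma> where W: "open W" "x \<in> W" "\<forall>i<1. smooth_map A W (\<sigma> i)"
    "\<forall>y\<in>W. s y = span ((\<lambda>i. \<sigma> i y) ` {..<(1::nat)})"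
    using assms unfolding subbundle_def by metis
  have "\<sigma> 0 y \<in> s y \<and> \<sigma> 0 y \<noteq> 0" if y: "y \<in> W" for y
  proof -
    have "s y = span {\<sigma> 0 y}" using W(4) y by (simp add: lessThan_Suc)
    moreover have "dim (s y) = 1" using assms unfolding subbundle_def by auto
    ultimately show ?thesis by (auto simp: span_base)
  qed
  then show ?thesis using that[of W "\<sigma> 0"] W by auto
qed

lemma line_field_section:
  assumes "line_field A T"
  obtains W X where "open W" "x \<in> W" "smooth_vector_field A W X" "\<And>y. y \<in> W \<Longrightarrow> X y \<in> T y \<and> X y \<noteq> 0"
proof -
  obtain W X where W: "open W" "x \<in> W" "smooth_vector_field A W X" "\<forall>y\<in>W. T y = span {X y}"
    using assms unfolding line_field_def by metis
  have "X y \<in> T y \<and> X y \<noteq> 0" if y: "y \<in> W" for y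
  proof -
    have "dim (T y) = 1" using assms unfolding line_field_def by auto
    then show ?thesis using W(4) y by (auto simp: span_base)
  qed
  then show ?thesis using that[of W X] W by auto
qed

end

subsection \<open>Adapted frames\<close>

locale legendre_surface = surface A
  for A :: "'a::{t2_space, second_countable_topology} chart set" +
  fixes f :: "'a \<Rightarrow> r42 set"
  assumes legendre: "legendre_map A f" and regular: "regular A f"
begin

lemma null_plane: "subspace (f x)" "totally_isotropic (f x)" "dim (f x) = 2"
  using legendre unfolding legendre_map_on_def subbundle_def by auto

lemma form_null: "a \<in> f x \<Longrightarrow> b \<in> f x \<Longrightarrow> form a b = 0"
  using null_plane(2) unfolding totally_isotropic_def by blast

lemma dif_section_perp:
  "open W \<Longrightarrow> smooth_map A W \<zeta> \<Longrightarrow> (\<And>y. y \<in> W \<Longrightarrow> \<zeta> y \<in> f y) \<Longrightarrow> x \<in> W \<Longrightarrow> dif A \<zeta> x v \<in> perp (f x)"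
  using legendre unfolding legendre_map_on_def local_section_def by blast

lemma form_dif_section:
  "open W \<Longrightarrow> smooth_map A W \<zeta> \<Longrightarrow> (\<And>y. y \<in> W \<Longrightarrow> \<zeta> y \<in> f y) \<Longrightarrow> x \<in> W \<Longrightarrow> a \<in> f x \<Longrightarrow>
    form a (dif A \<zeta> x v) = 0"
  using dif_section_perp[of W \<zeta> x v] unfolding perp_def by blast

end

text \<open>Nowhere-zero local sections of the curvature spheres and of the curvature directions.\<close>

locale curvature_frame = legendre_surface A f
  for A :: "'a::{t2_space, second_countable_topology} chart set" and f +
  fixes s1 s2 T1 T2 and W :: "'a set" and \<sigma>1 \<sigma>2 X Y
  assumes spheres: "curvature_spheres A f s1 s2 T1 T2"
    and W: "open W" and smooth: "smooth_map A W \<sigma>1" "smooth_map A W \<sigma>2"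
      "smooth_vector_field A W X" "smooth_vector_field A W Y"
    and sections: "\<And>y. y \<in> W \<Longrightarrow> \<sigma>1 y \<in> s1 y \<and> \<sigma>1 y \<noteq> 0" "\<And>y. y \<in> W \<Longrightarrow> \<sigma>2 y \<in> s2 y \<and> \<sigma>2 y \<noteq> 0"
      "\<And>y. y \<in> W \<Longrightarrow> X y \<in> T1 y \<and> X y \<noteq> 0" "\<And>y. y \<in> W \<Longrightarrow> Y y \<in> T2 y \<and> Y y \<noteq> 0"

lemma curvature_spheres_swap:
  "curvature_spheres A f s1 s2 T1 T2 \<Longrightarrow> curvature_spheres A f s2 s1 T2 T1"
  unfolding curvature_spheres_def by (auto simp: Int_commute)

context curvature_frame
begin

lemma frame_swap: "curvature_frame A f s2 s1 T2 T1 W \<sigma>2 \<sigma>1 Y X"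
  by unfold_locales (use curvature_spheres_swap[OF spheres] W smooth sections in auto)

lemma frame_restrict:
  assumes "open W'" "W' \<subseteq> W"
  shows "curvature_frame A f s1 s2 T1 T2 W' \<sigma>1 \<sigma>2 X Y"
  by unfold_locales
    (use spheres assms smooth_map_subset[OF smooth(1) assms(2)] smooth_map_subset[OF smooth(2) assms(2)]
      smooth_vector_field_subset[OF smooth(3) assms(2)] smooth_vector_field_subset[OF smooth(4) assms(2)]
      sections in auto)

lemma rank1: "subbundle A 1 s1" "subbundle A 1 s2" "line_field A T1" "line_field A T2"
  "s1 x \<subseteq> f x" "s2 x \<subseteq> f x" "s1 x \<inter> s2 x = {0}"
  using spheres unfolding curvature_spheres_def by auto

lemma spans:
  assumes "x \<in> W"
  shows "s1 x = span {\<sigma>1 x}" "s2 x = span {\<sigma>2 x}" "T1 x = span {X x}" "T2 x = span {Y x}"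
  by (rule rank1_bundle_span[OF rank1(1)] rank1_bundle_span[OF rank1(2)] line_field_span[OF rank1(3)]
    line_field_span[OF rank1(4)]; use sections[OF assms] in blast)+

lemma section_mem: "x \<in> W \<Longrightarrow> \<sigma>1 x \<in> f x" "x \<in> W \<Longrightarrow> \<sigma>2 x \<in> f x"
  using sections rank1(5,6) by blast+

lemma independent_sections: "x \<in> W \<Longrightarrow> \<sigma>1 x \<notin> span {\<sigma>2 x}" "x \<in> W \<Longrightarrow> \<sigma>2 x \<notin> span {\<sigma>1 x}"
  using sections rank1(7)[of x] spans[of x] by blast+

lemma f_span: assumes x: "x \<in> W" shows "f x = span {\<sigma>1 x, \<sigma>2 x}"
proof -
  have "span {\<sigma>1 x, \<sigma>2 x} = f x"
  proof (rule subspace_dim_equal[OF subspace_span null_plane(1)])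
    show "span {\<sigma>1 x, \<sigma>2 x} \<subseteq> f x" using section_mem[OF x] null_plane(1) by (simp add: span_minimal)
    show "dim (f x) \<le> dim (span {\<sigma>1 x, \<sigma>2 x})"
      using independent_sections(1)[OF x] sections(2)[OF x] by (simp add: null_plane dim_insert)
  qed
  then show ?thesis by simp
qed

lemma dif_curvature: "x \<in> W \<Longrightarrow> v \<in> T1 x \<Longrightarrow> dif A \<sigma>1 x v \<in> f x" "x \<in> W \<Longrightarrow> v \<in> T2 x \<Longrightarrow> dif A \<sigma>2 x v \<in> f x"
proof -
  have "local_section A W s1 \<sigma>1" "local_section A W s2 \<sigma>2"
    using W smooth sections unfolding local_section_def by blast+
  then show "x \<in> W \<Longrightarrow> v \<in> T1 x \<Longrightarrow> dif A \<sigma>1 x v \<in> f x" "x \<in> W \<Longrightarrow> v \<in> T2 x \<Longrightarrow> dif A \<sigma>2 x v \<in> f x"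
    using spheres unfolding curvature_spheres_def by blast+
qed

text \<open>\<open>\<xi> = d\<^sub>X \<sigma>\<^sub>1\<close> and \<open>\<xi>' = d\<^sub>Y \<sigma>\<^sub>2\<close> are sections of \<open>f\<close>, while \<open>a\<^sub>1 = d\<^sub>Y \<sigma>\<^sub>1\<close> and \<open>b\<^sub>1 = d\<^sub>X \<sigma>\<^sub>2\<close> are
  transversal to it; \<open>a\<^sub>2\<close> and \<open>b\<^sub>2\<close> are the second derivatives.\<close>

abbreviation "\<xi> \<equiv> deriv_along A X \<sigma>1"
abbreviation "\<xi>' \<equiv> deriv_along A Y \<sigma>2"
abbreviation "a1 \<equiv> deriv_along A Y \<sigma>1"
abbreviation "a2 \<equiv> deriv_along A Y a1"
abbreviation "b1 \<equiv> deriv_along A X \<sigma>2"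
abbreviation "b2 \<equiv> deriv_along A X b1"

lemma smooth_derivs: "smooth_map A W \<xi>" "smooth_map A W \<xi>'" "smooth_map A W a1" "smooth_map A W a2"
  "smooth_map A W b1" "smooth_map A W b2"
  by (intro smooth_map_deriv_along W smooth)+

lemma \<xi>_mem: "x \<in> W \<Longrightarrow> \<xi> x \<in> f x" and \<xi>'_mem: "x \<in> W \<Longrightarrow> \<xi>' x \<in> f x"
  using dif_curvature sections unfolding deriv_along_def by blast+

lemma perp_derivs: "x \<in> W \<Longrightarrow> a1 x \<in> perp (f x)" "x \<in> W \<Longrightarrow> b1 x \<in> perp (f x)"
  unfolding deriv_along_def using dif_section_perp[OF W] smooth section_mem by blast+

lemma dif_section_span:
  assumes \<zeta>: "open W'" "smooth_map A W' \<zeta>" "\<And>y. y \<in> W' \<Longrightarrow> \<zeta> y \<in> f y" and x: "x \<in> W" "x \<in> W'"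
  obtains \<kappa> \<mu> u where "\<zeta> x = \<kappa> *\<^sub>R \<sigma>1 x + \<mu> *\<^sub>R \<sigma>2 x"
    "\<And>v. dif A \<zeta> x v - (\<kappa> *\<^sub>R dif A \<sigma>1 x v + \<mu> *\<^sub>R dif A \<sigma>2 x v) \<in> f x"
proof -
  have op: "open (W \<inter> W')" using W \<zeta>(1) by auto
  have sm: "smooth_map A (W \<inter> W') \<sigma>1" "smooth_map A (W \<inter> W') \<sigma>2" "smooth_map A (W \<inter> W') \<zeta>"
    using smooth_map_subset smooth \<zeta>(2) by blast+
  obtain \<kappa> \<mu> where lm: "smooth_map A (W \<inter> W') \<kappa>" "smooth_map A (W \<inter> W') \<mu>"
    "\<And>y. y \<in> W \<inter> W' \<Longrightarrow> \<zeta> y = \<kappa> y *\<^sub>R \<sigma>1 y + \<mu> y *\<^sub>R \<sigma>2 y"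
  proof (rule rank2_coefficients[OF op sm])
    fix y assume "y \<in> W \<inter> W'"
    then show "\<sigma>2 y \<noteq> 0" "\<sigma>1 y \<notin> span {\<sigma>2 y}" "\<zeta> y \<in> span {\<sigma>1 y, \<sigma>2 y}"
      using sections(2)[of y] independent_sections(1)[of y] f_span[of y] \<zeta>(3)[of y] by auto
  qed blast
  have "dif A \<zeta> x v - (\<kappa> x *\<^sub>R dif A \<sigma>1 x v + \<mu> x *\<^sub>R dif A \<sigma>2 x v) =
      dif A \<kappa> x v *\<^sub>R \<sigma>1 x + dif A \<mu> x v *\<^sub>R \<sigma>2 x" for v
    using dif_combination[OF lm(1,2) sm(1,2) op _ lm(3), of x v] x by (simp add: algebra_simps)
  then have "dif A \<zeta> x v - (\<kappa> x *\<^sub>R dif A \<sigma>1 x v + \<mu> x *\<^sub>R dif A \<sigma>2 x v) \<in> f x" for v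
    unfolding f_span[OF x(1)] by (simp add: span_pairI)
  then show ?thesis using that lm(3)[of x] x by blast
qed

lemma dif_not_both:
  assumes x: "x \<in> W" and d: "dif A \<sigma>1 x v \<in> f x" "dif A \<sigma>2 x v \<in> f x"
  shows "v = 0"
proof -
  have "dif A \<zeta> x v \<in> f x" if ls: "local_section A W' f \<zeta>" "x \<in> W'" for W' \<zeta>
  proof -
    obtain \<kappa> \<mu> where "dif A \<zeta> x v - (\<kappa> *\<^sub>R dif A \<sigma>1 x v + \<mu> *\<^sub>R dif A \<sigma>2 x v) \<in> f x"
      by (rule dif_section_span[of W' \<zeta> x]) (use ls x in \<open>auto simp: local_section_def\<close>)
    moreover have "\<kappa> *\<^sub>R dif A \<sigma>1 x v + \<mu> *\<^sub>R dif A \<sigma>2 x v \<in> f x"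
      using d null_plane(1) by (simp add: subspace_add subspace_scale)
    ultimately show ?thesis using subspace_add[OF null_plane(1)] by fastforce
  qed
  moreover have "immersive_at A f x" using legendre unfolding legendre_map_on_def by blast
  ultimately show ?thesis unfolding immersive_at_def by blast
qed

lemma a1_notin: "x \<in> W \<Longrightarrow> a1 x \<notin> f x"
  using dif_not_both[of x "Y x"] dif_curvature(2)[of x "Y x"] sections(4)[of x] unfolding deriv_along_def by blast

lemma b1_notin: "x \<in> W \<Longrightarrow> b1 x \<notin> f x"
  using dif_not_both[of x "X x"] dif_curvature(1)[of x "X x"] sections(3)[of x] unfolding deriv_along_def by blast

lemma a1_spacelike: "x \<in> W \<Longrightarrow> form (a1 x) (a1 x) > 0"
  using null_plane_positive[OF null_plane] perp_derivs a1_notin by blast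

lemma b1_spacelike: "x \<in> W \<Longrightarrow> form (b1 x) (b1 x) > 0"
  using null_plane_positive[OF null_plane] perp_derivs b1_notin by blast

lemma direction_span:
  assumes x: "x \<in> W"
  obtains a b where "v = a *\<^sub>R X x + b *\<^sub>R Y x"
proof -
  have nX: "X x \<notin> span {Y x}"
  proof
    assume "X x \<in> span {Y x}"
    then have "X x \<in> T2 x" using spans(4)[OF x] by simp
    then show False using b1_notin[OF x] dif_curvature(2)[OF x] unfolding deriv_along_def by blast
  qed
  have "dim (span {X x, Y x}) = 2" using nX sections(4)[OF x] by (simp add: dim_insert)
  then have "span {X x, Y x} = UNIV" by (simp add: dim_eq_full[symmetric])
  then show ?thesis using that span_pairE[of v "X x" "Y x"] by blast
qed

lemma dif_direction:
  assumes "smooth_map A W \<phi>" "x \<in> W"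
  obtains a b where "v = a *\<^sub>R X x + b *\<^sub>R Y x"
    "dif A \<phi> x v = a *\<^sub>R deriv_along A X \<phi> x + b *\<^sub>R deriv_along A Y \<phi> x"
  using direction_span[OF assms(2), of v]
  by (metis (no_types, lifting) dif_add_vec[OF assms] dif_scale_vec[OF assms] deriv_along_def)

text \<open>Regularity: \<open>s\<^sub>1\<close> is not stationary along \<open>T\<^sub>1\<close>.\<close>

lemma \<xi>_coefficients:
  assumes x: "x \<in> W"
  obtains \<alpha> \<beta> where "\<xi> x = \<alpha> *\<^sub>R \<sigma>1 x + \<beta> *\<^sub>R \<sigma>2 x" "\<beta> \<noteq> 0"
proof -
  obtain \<alpha> \<beta> where ab: "\<xi> x = \<alpha> *\<^sub>R \<sigma>1 x + \<beta> *\<^sub>R \<sigma>2 x" using span_pairE \<xi>_mem[OF x] f_span[OF x] by metis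
  have "\<beta> \<noteq> 0"
  proof
    assume "\<beta> = 0"
    then have s: "dif A \<sigma>1 x (X x) \<in> span {\<sigma>1 x}" using ab by (simp add: deriv_along_def span_scale span_base)
    have "dif A \<tau> x (X x) \<in> s1 x" if ls: "local_section A W' s1 \<tau>" "x \<in> W'" for W' \<tau>
    proof -
      have op: "open (W \<inter> W')" using W ls by (auto simp: local_section_def)
      have sm: "smooth_map A (W \<inter> W') \<sigma>1" "smooth_map A (W \<inter> W') \<tau>"
        using smooth_map_subset smooth ls unfolding local_section_def by blast+
      obtain \<kappa> where l: "smooth_map A (W \<inter> W') \<kappa>" "\<And>y. y \<in> W \<inter> W' \<Longrightarrow> \<tau> y = \<kappa> y *\<^sub>R \<sigma>1 y"
        by (rule rank1_coefficient[OF op sm])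
          (use sections spans ls in \<open>auto simp: local_section_def\<close>)
      have "dif A \<tau> x (X x) = dif A (\<lambda>y. \<kappa> y *\<^sub>R \<sigma>1 y) x (X x)"
        using dif_cong[OF op _ smooth_map_scaleR[OF op l(1) sm(1)], of x \<tau>] l(2) x ls by simp
      also have "\<dots> = \<kappa> x *\<^sub>R dif A \<sigma>1 x (X x) + dif A \<kappa> x (X x) *\<^sub>R \<sigma>1 x"
        using dif_scaleR[OF l(1) sm(1)] x ls by simp
      finally show ?thesis unfolding spans(1)[OF x] using s by (simp add: span_add span_scale span_base)
    qed
    moreover have "immersive_at A s1 x" using regular spheres unfolding regular_def by blast
    ultimately have "X x = 0" unfolding immersive_at_def by blast
    then show False using sections(3)[OF x] by simp
  qed
  then show ?thesis using that ab by blast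
qed

subsection \<open>Orthogonality of the osculating 3-spaces\<close>

lemma form_deriv:
  assumes ab: "smooth_map A W a" "smooth_map A W b" and c: "\<And>y. y \<in> W \<Longrightarrow> form (a y) (b y) = 0" and x: "x \<in> W"
  shows "form (a x) (deriv_along A Z b x) = - form (deriv_along A Z a x) (b x)"
  using form_const_dif[OF W x ab c, where v = "Z x"] unfolding deriv_along_def by simp

text \<open>Derivatives along \<open>X\<close> of sections of \<open>f\<close> do not see \<open>a\<^sub>1\<close>: commute \<open>X\<close> and \<open>Y\<close>.\<close>

lemma deriv_section_a1:
  assumes \<zeta>: "smooth_map A W \<zeta>" "\<And>y. y \<in> W \<Longrightarrow> \<zeta> y \<in> f y" and x: "x \<in> W"
  shows "form (deriv_along A X \<zeta> x) (a1 x) = 0"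
proof -
  obtain v where v: "deriv_along A X a1 x = deriv_along A Y \<xi> x + dif A \<sigma>1 x v"
    using deriv_along_commutator[OF W x smooth(3,4,1)] by blast
  have "form (\<zeta> y) (a1 y) = 0" if "y \<in> W" for y
    using perp_derivs(1)[OF that] \<zeta>(2)[OF that] unfolding perp_def by blast
  from form_deriv[OF \<zeta>(1) smooth_derivs(3) this x, of X]
  have "form (\<zeta> x) (deriv_along A X a1 x) = - form (deriv_along A X \<zeta> x) (a1 x)" .
  moreover have "form (\<zeta> x) (deriv_along A Y \<xi> x) = 0"
    unfolding deriv_along_def[of A Y \<xi>]
    by (rule form_dif_section[OF W smooth_derivs(1) \<xi>_mem x]) (use \<zeta> x in auto)
  moreover have "form (\<zeta> x) (dif A \<sigma>1 x v) = 0"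
    by (rule form_dif_section[OF W smooth(1) section_mem(1) x]) (use \<zeta> x in auto)
  ultimately show ?thesis by (simp add: v form_simps)
qed

lemma deriv_section_b1:
  assumes \<zeta>: "smooth_map A W \<zeta>" "\<And>y. y \<in> W \<Longrightarrow> \<zeta> y \<in> f y" and x: "x \<in> W"
  shows "form (deriv_along A Y \<zeta> x) (b1 x) = 0"
  using curvature_frame.deriv_section_a1[OF frame_swap \<zeta> x] .

lemma form_f_derivs:
  assumes x: "x \<in> W" and u: "u \<in> f x"
  shows "form u (a1 x) = 0" "form u (b1 x) = 0" "form (a1 x) u = 0" "form (b1 x) u = 0"
  using perp_derivs[OF x] u unfolding perp_def by (auto simp: form_commute)

lemma form_a1_b1: "x \<in> W \<Longrightarrow> form (a1 x) (b1 x) = 0"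
  using deriv_section_b1[OF smooth(1) section_mem(1)] by simp

lemma form_\<sigma>1_b2: "x \<in> W \<Longrightarrow> form (\<sigma>1 x) (b2 x) = 0"
  using form_deriv[OF smooth(1) smooth_derivs(5), of x X] form_f_derivs \<xi>_mem section_mem by simp

lemma form_a1_b2:
  assumes x: "x \<in> W"
  shows "form (a1 x) (b2 x) = 0"
proof -
  obtain v where v: "deriv_along A X a1 x = deriv_along A Y \<xi> x + dif A \<sigma>1 x v"
    using deriv_along_commutator[OF W x smooth(3,4,1)] by blast
  obtain a b where "dif A \<sigma>1 x v = a *\<^sub>R \<xi> x + b *\<^sub>R a1 x" using dif_direction[OF smooth(1) x] by metis
  then have "form (deriv_along A X a1 x) (b1 x) = 0"
    using deriv_section_b1[OF smooth_derivs(1) \<xi>_mem x] form_f_derivs(2)[OF x \<xi>_mem[OF x]] form_a1_b1[OF x]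
    by (simp add: v form_simps)
  then show ?thesis using form_deriv[OF smooth_derivs(3,5) form_a1_b1 x, of X] by simp
qed

lemma form_a2_b1: "x \<in> W \<Longrightarrow> form (a2 x) (b1 x) = 0"
  using curvature_frame.form_a1_b2[OF frame_swap] by (simp add: form_commute)

lemma form_a1_Yb1: "x \<in> W \<Longrightarrow> form (a1 x) (deriv_along A Y b1 x) = 0"
  using form_deriv[OF smooth_derivs(3,5) form_a1_b1, of x Y] form_a2_b1 by simp

text \<open>Modulo \<open>f\<close>, \<open>d\<^sub>Y \<xi>\<close> is a multiple of \<open>a\<^sub>1\<close>, to which \<open>d\<^sub>X \<xi>'\<close> is orthogonal.\<close>

lemma form_Y\<xi>_X\<xi>':
  assumes x: "x \<in> W"
  shows "form (deriv_along A Y \<xi> x) (deriv_along A X \<xi>' x) = 0"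
proof -
  have p: "deriv_along A Y \<xi> x \<in> perp (f x)" "deriv_along A X \<xi>' x \<in> perp (f x)"
    unfolding deriv_along_def[of A Y \<xi>] deriv_along_def[of A X \<xi>']
    by (rule dif_section_perp[OF W smooth_derivs(1) \<xi>_mem x] dif_section_perp[OF W smooth_derivs(2) \<xi>'_mem x]; assumption)+
  have ba: "form (b1 x) (a1 x) = 0" using form_a1_b1[OF x] by (simp add: form_commute)
  obtain c u where cu: "deriv_along A Y \<xi> x = c *\<^sub>R a1 x + u" "u \<in> f x"
    using null_plane_orthogonal[OF null_plane perp_derivs(2)[OF x] b1_notin[OF x] perp_derivs(1)[OF x]
        a1_notin[OF x] ba p(1) deriv_section_b1[OF smooth_derivs(1) \<xi>_mem x]] by blast
  have "form u (deriv_along A X \<xi>' x) = 0" using p(2) cu(2) unfolding perp_def by blast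
  then show ?thesis
    using deriv_section_a1[OF smooth_derivs(2) \<xi>'_mem x] by (simp add: cu form_simps form_commute)
qed

lemma form_Xa1_Yb1:
  assumes x: "x \<in> W"
  shows "form (deriv_along A X a1 x) (deriv_along A Y b1 x) = 0"
proof -
  obtain v where v: "deriv_along A X a1 x = deriv_along A Y \<xi> x + dif A \<sigma>1 x v"
    using deriv_along_commutator[OF W x smooth(3,4,1)] by blast
  obtain a b where ab: "dif A \<sigma>1 x v = a *\<^sub>R \<xi> x + b *\<^sub>R a1 x" using dif_direction[OF smooth(1) x] by metis
  obtain v' where v': "deriv_along A Y b1 x = deriv_along A X \<xi>' x + dif A \<sigma>2 x v'"
    using deriv_along_commutator[OF W x smooth(4,3,2)] by blast
  obtain a' b' where ab': "dif A \<sigma>2 x v' = a' *\<^sub>R b1 x + b' *\<^sub>R \<xi>' x" using dif_direction[OF smooth(2) x] by metis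
  have 1: "form (deriv_along A Y \<xi> x) (b1 x) = 0" by (rule deriv_section_b1[OF smooth_derivs(1) \<xi>_mem x])
  have 2: "form (deriv_along A Y \<xi> x) (\<xi>' x) = 0"
    using form_dif_section[OF W smooth_derivs(1) \<xi>_mem x \<xi>'_mem[OF x], of "Y x"]
    by (simp add: deriv_along_def[of A Y \<xi>] form_commute)
  have "form (deriv_along A Y \<xi> x) (deriv_along A Y b1 x) = 0"
    using 1 2 form_Y\<xi>_X\<xi>'[OF x] by (simp add: v' ab' form_simps)
  moreover have "form (\<xi> x) (deriv_along A Y b1 x) = 0"
    using form_deriv[OF smooth_derivs(1,5) form_f_derivs(2)[OF _ \<xi>_mem] x, of Y] 1 by simp
  ultimately show ?thesis using form_a1_Yb1[OF x] by (simp add: v ab form_simps)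
qed

text \<open>Differentiating \<open>(a\<^sub>1, b\<^sub>2) = 0\<close> along \<open>Y\<close> leaves \<open>(a\<^sub>1, d\<^sub>Y d\<^sub>X b\<^sub>1)\<close>, which is found by commuting \<open>X\<close> and \<open>Y\<close> and
  differentiating \<open>(a\<^sub>1, d\<^sub>Y b\<^sub>1) = 0\<close> along \<open>X\<close>.\<close>

lemma form_a2_b2:
  assumes x: "x \<in> W"
  shows "form (a2 x) (b2 x) = 0"
proof -
  obtain v where v: "deriv_along A Y b2 x = deriv_along A X (deriv_along A Y b1) x + dif A b1 x v"
    using deriv_along_commutator[OF W x smooth(4,3) smooth_derivs(5)] by blast
  obtain a b where ab: "dif A b1 x v = a *\<^sub>R b2 x + b *\<^sub>R deriv_along A Y b1 x"
    using dif_direction[OF smooth_derivs(5) x] by metis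
  have sY: "smooth_map A W (deriv_along A Y b1)" by (intro smooth_map_deriv_along W smooth smooth_derivs)
  have "form (a1 x) (deriv_along A X (deriv_along A Y b1) x) = 0"
    using form_deriv[OF smooth_derivs(3) sY form_a1_Yb1 x, of X] form_Xa1_Yb1[OF x] by simp
  then have "form (a1 x) (deriv_along A Y b2 x) = 0"
    using form_a1_b2[OF x] form_a1_Yb1[OF x] by (simp add: v ab form_simps)
  then show ?thesis using form_deriv[OF smooth_derivs(3,6) form_a1_b2 x, of Y] by simp
qed

lemma osculating_orthogonal:
  assumes x: "x \<in> W" and v: "v \<in> {\<sigma>1 x, a1 x, a2 x}" and w: "w \<in> {\<sigma>2 x, b1 x, b2 x}"
  shows "form v w = 0"
proof -
  interpret sw: curvature_frame A f s2 s1 T2 T1 W \<sigma>2 \<sigma>1 Y X by (rule frame_swap)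
  have "form (a2 x) (\<sigma>2 x) = 0" using sw.form_\<sigma>1_b2[OF x] by (simp add: form_commute)
  then show ?thesis
    using v w form_\<sigma>1_b2[OF x] form_a1_b2[OF x] form_a2_b1[OF x] form_a2_b2[OF x] form_a1_b1[OF x]
      form_f_derivs[OF x section_mem(1)[OF x]] form_f_derivs[OF x section_mem(2)[OF x]]
      form_null[OF section_mem(1)[OF x] section_mem(2)[OF x]] by blast
qed

lemma gram: 
  assumes x: "x \<in> W"
  shows "form (\<sigma>1 x) (\<sigma>1 x) = 0" "form (\<sigma>1 x) (a1 x) = 0" "form (a1 x) (a1 x) \<noteq> 0"
    "form (\<sigma>1 x) (a2 x) = - form (a1 x) (a1 x)"
  using form_null section_mem(1)[OF x] form_f_derivs(1)[OF x section_mem(1)[OF x]] a1_spacelike[OF x]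
    form_deriv[OF smooth(1) smooth_derivs(3) form_f_derivs(1)[OF _ section_mem(1)] x, of Y] by auto

end

lemma span_scale_cancel:
  assumes "c *\<^sub>R a \<in> span S" "c \<noteq> 0"
  shows "a \<in> span S"
  using span_scale[OF assms(1), of "inverse c"] assms(2) by simp

lemma osc_span_generator:
  assumes "x \<in> W" "local_section A W V \<sigma>" "\<And>y. y \<in> W \<Longrightarrow> P (\<sigma> y)" "local_field A W T X" "\<And>y. y \<in> W \<Longrightarrow> X y \<noteq> 0"
  shows "{\<sigma> x, deriv_along A X \<sigma> x, deriv_along A X (deriv_along A X \<sigma>) x} \<subseteq> osc_span A P V T x"
  unfolding osc_span_def by (rule order_trans[OF _ span_superset], rule Union_upper) (use assms in blast)

lemma osc_span_orthogonal:
  assumes "a \<in> osc_span A P V T x"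
    "\<And>W \<sigma> X z. x \<in> W \<Longrightarrow> local_section A W V \<sigma> \<Longrightarrow> (\<And>y. y \<in> W \<Longrightarrow> P (\<sigma> y)) \<Longrightarrow> local_field A W T X \<Longrightarrow>
      (\<And>y. y \<in> W \<Longrightarrow> X y \<noteq> 0) \<Longrightarrow>
      z \<in> {\<sigma> x, deriv_along A X \<sigma> x, deriv_along A X (deriv_along A X \<sigma>) x} \<Longrightarrow> form z b = 0"
  shows "form a b = 0"
  using assms(1) unfolding osc_span_def by (rule form_span_zero) (use assms(2) in blast)

context legendre_surface
begin

lemma curvature_frameI:
  assumes "curvature_spheres A f s1 s2 T1 T2"
    "local_section A W1 s1 \<sigma>1" "\<And>y. y \<in> W1 \<Longrightarrow> \<sigma>1 y \<noteq> 0" "local_field A W1 T2 Y" "\<And>y. y \<in> W1 \<Longrightarrow> Y y \<noteq> 0"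
    "local_section A W2 s2 \<sigma>2" "\<And>y. y \<in> W2 \<Longrightarrow> \<sigma>2 y \<noteq> 0" "local_field A W2 T1 X" "\<And>y. y \<in> W2 \<Longrightarrow> X y \<noteq> 0"
  shows "curvature_frame A f s1 s2 T1 T2 (W1 \<inter> W2) \<sigma>1 \<sigma>2 X Y"
proof
  show "smooth_map A (W1 \<inter> W2) \<sigma>1" "smooth_map A (W1 \<inter> W2) \<sigma>2"
    using assms(2,6) smooth_map_subset unfolding local_section_def by blast+
  show "smooth_vector_field A (W1 \<inter> W2) X" "smooth_vector_field A (W1 \<inter> W2) Y"
    using assms(4,8) smooth_vector_field_subset unfolding local_field_def by blast+
qed (use assms in \<open>auto simp: local_section_def local_field_def\<close>)

lemma curvature_frame_exists:
  assumes cs: "curvature_spheres A f s1 s2 T1 T2"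
  obtains W \<sigma>1 \<sigma>2 X Y where "x \<in> W" "curvature_frame A f s1 s2 T1 T2 W \<sigma>1 \<sigma>2 X Y"
proof -
  have r: "subbundle A 1 s1" "subbundle A 1 s2" "line_field A T1" "line_field A T2"
    using cs unfolding curvature_spheres_def by auto
  obtain Wa \<sigma>1 where a: "open Wa" "x \<in> Wa" "smooth_map A Wa \<sigma>1" "\<And>y. y \<in> Wa \<Longrightarrow> \<sigma>1 y \<in> s1 y \<and> \<sigma>1 y \<noteq> 0"
    using rank1_bundle_section[OF r(1)] by metis
  obtain Wb \<sigma>2 where b: "open Wb" "x \<in> Wb" "smooth_map A Wb \<sigma>2" "\<And>y. y \<in> Wb \<Longrightarrow> \<sigma>2 y \<in> s2 y \<and> \<sigma>2 y \<noteq> 0"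
    using rank1_bundle_section[OF r(2)] by metis
  obtain Wc X where c: "open Wc" "x \<in> Wc" "smooth_vector_field A Wc X" "\<And>y. y \<in> Wc \<Longrightarrow> X y \<in> T1 y \<and> X y \<noteq> 0"
    using line_field_section[OF r(3)] by metis
  obtain Wd Y where d: "open Wd" "x \<in> Wd" "smooth_vector_field A Wd Y" "\<And>y. y \<in> Wd \<Longrightarrow> Y y \<in> T2 y \<and> Y y \<noteq> 0"
    using line_field_section[OF r(4)] by metis
  define W where "W = Wa \<inter> Wb \<inter> Wc \<inter> Wd"
  have sub: "W \<subseteq> Wa" "W \<subseteq> Wb" "W \<subseteq> Wc" "W \<subseteq> Wd" by (auto simp: W_def)
  have "curvature_frame A f s1 s2 T1 T2 W \<sigma>1 \<sigma>2 X Y"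
  proof
    show "open W" unfolding W_def using a b c d by (intro open_Int)
  qed (use cs sub smooth_map_subset[OF a(3) sub(1)] smooth_map_subset[OF b(3) sub(2)] a(4) b(4) c(4) d(4)
    smooth_vector_field_subset[OF c(3) sub(3)] smooth_vector_field_subset[OF d(3) sub(4)] in blast)+
  moreover have "x \<in> W" using a b c d by (simp add: W_def)
  ultimately show ?thesis using that by blast
qed

lemma sphere_osc_orthogonal:
  assumes cs: "curvature_spheres A f s1 s2 T1 T2"
    and v: "v \<in> sphere_osc A s1 T2 x" and w: "w \<in> sphere_osc A s2 T1 x"
  shows "form v w = 0"
  using v unfolding sphere_osc_def
proof (rule osc_span_orthogonal)
  fix W1 \<sigma>1 Y v
  assume 1: "x \<in> W1" "local_section A W1 s1 \<sigma>1" "\<And>y. y \<in> W1 \<Longrightarrow> \<sigma>1 y \<noteq> 0" "local_field A W1 T2 Y"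
    "\<And>y. y \<in> W1 \<Longrightarrow> Y y \<noteq> 0" and v: "v \<in> {\<sigma>1 x, deriv_along A Y \<sigma>1 x, deriv_along A Y (deriv_along A Y \<sigma>1) x}"
  have "form w v = 0" using w unfolding sphere_osc_def
  proof (rule osc_span_orthogonal)
    fix W2 \<sigma>2 X w
    assume 2: "x \<in> W2" "local_section A W2 s2 \<sigma>2" "\<And>y. y \<in> W2 \<Longrightarrow> \<sigma>2 y \<noteq> 0" "local_field A W2 T1 X"
      "\<And>y. y \<in> W2 \<Longrightarrow> X y \<noteq> 0" and w: "w \<in> {\<sigma>2 x, deriv_along A X \<sigma>2 x, deriv_along A X (deriv_along A X \<sigma>2) x}"
    interpret curvature_frame A f s1 s2 T1 T2 "W1 \<inter> W2" \<sigma>1 \<sigma>2 X Y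
      by (rule curvature_frameI) (fact cs 1 2)+
    show "form w v = 0" using osculating_orthogonal[OF _ v w] 1 2 by (simp add: form_commute)
  qed
  then show "form v w = 0" by (simp add: form_commute)
qed

end

context curvature_frame
begin

abbreviation "S1 \<equiv> sphere_osc A s1 T2"
abbreviation "S2 \<equiv> sphere_osc A s2 T1"

lemma osculating_mem: assumes x: "x \<in> W" shows "{\<sigma>1 x, a1 x, a2 x} \<subseteq> S1 x" "{\<sigma>2 x, b1 x, b2 x} \<subseteq> S2 x"
  unfolding sphere_osc_def
  by (rule osc_span_generator[OF x]; use W smooth sections in \<open>simp add: local_section_def local_field_def\<close>)+

text \<open>The two osculating bundles are complementary.\<close>

lemma osculating_split:
  assumes x: "x \<in> W"
  shows "S1 x = span {\<sigma>1 x, a1 x, a2 x}" "S1 x \<inter> S2 x = {0}" "\<exists>v\<in>S1 x. w - v \<in> S2 x"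
    "subspace (S1 x)" "subspace (S2 x)"
proof -
  interpret sw: curvature_frame A f s2 s1 T2 T1 W \<sigma>2 \<sigma>1 Y X by (rule frame_swap)
  show s: "subspace (S1 x)" "subspace (S2 x)" unfolding sphere_osc_def osc_span_def by auto
  have o: "form v v' = 0" if "v \<in> S1 x" "v' \<in> S2 x" for v v'
    by (rule sphere_osc_orthogonal[OF spheres that])
  note spl = osculating_triples_split[OF s o osculating_mem(1)[OF x] gram[OF x]
      osculating_mem(2)[OF x] sw.gram[OF x]]
  show "S1 x = span {\<sigma>1 x, a1 x, a2 x}" "S1 x \<inter> S2 x = {0}" "\<exists>v\<in>S1 x. w - v \<in> S2 x"
    using spl by blast+
qed

end

subsection \<open>Osculating complexes\<close>

text \<open>An adapted frame together with a unit section \<open>l\<close> of the osculating complex \<open>L\<close> contained in \<open>S\<^sub>1\<close>.\<close>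

locale osculating_frame = curvature_frame +
  fixes L and l :: "_ \<Rightarrow> r42"
  assumes complex: "osculating_complex A S1 S2 L"
    and unit_section: "local_section A W L l" "\<And>y. y \<in> W \<Longrightarrow> form (l y) (l y) = 1"
begin

lemma smooth_l: "smooth_map A W l" and l_mem: "x \<in> W \<Longrightarrow> l x \<in> S1 x"
  using unit_section(1) complex unfolding local_section_def osculating_complex_def by blast+

lemma dif_l_mem:
  assumes x: "x \<in> W"
  shows "dif A l x v \<in> S1 x"
proof -
  note spl = osculating_split
  have p1: "proj_along (S1 y) (S2 y) (l y) = l y" if "y \<in> W" for y
    by (rule proj_along_eqI[OF spl(4,5,2)[OF that] l_mem[OF that]]) (simp add: subspace_0 spl(5)[OF that])
  have p2: "proj_along (S2 y) (S1 y) (l y) = 0" if "y \<in> W" for y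
    by (rule proj_along_eqI[OF spl(5,4)[OF that] _ subspace_0[OF spl(5)[OF that]]])
      (use spl(2)[OF that] l_mem[OF that] in \<open>auto simp: Int_commute\<close>)
  have p3: "proj_along (S2 x) (S1 x) 0 = 0"
    by (rule proj_along_eqI[OF spl(5,4)[OF x] _ subspace_0[OF spl(5)[OF x]]])
      (use spl(2)[OF x] subspace_0[OF spl(4)[OF x]] in \<open>auto simp: Int_commute\<close>)
  have d1: "dif A (\<lambda>y. proj_along (S1 y) (S2 y) (l y)) x = dif A l x"
    using dif_cong[OF W x smooth_l, of "\<lambda>y. proj_along (S1 y) (S2 y) (l y)"] p1 by simp
  have d2: "dif A (\<lambda>y. proj_along (S2 y) (S1 y) (l y)) x v = 0"
    by (rule dif_locally_const[OF W x p2])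
  have "normal_part A S1 S2 l x v = 0"
    using complex unit_section x unfolding osculating_complex_def by blast
  then have eq: "dif A l x v = proj_along (S1 x) (S2 x) (dif A l x v)"
    by (simp add: normal_part_def induced_connection_def d1 d2 p3)
  obtain u where u: "u \<in> S1 x" "dif A l x v - u \<in> S2 x" using spl(3)[OF x] by blast
  have "proj_along (S1 x) (S2 x) (dif A l x v) = u"
    by (rule proj_along_eqI[OF spl(4,5,2)[OF x] u])
  then show ?thesis using eq u by simp
qed

lemma l_\<sigma>2: "x \<in> W \<Longrightarrow> form (l x) (\<sigma>2 x) = 0"
  using sphere_osc_orthogonal[OF spheres l_mem] osculating_mem(2) by blast

text \<open>As \<open>l\<close> and \<open>dl\<close> are orthogonal to \<open>\<sigma>\<^sub>2\<close>, \<open>l\<close> is orthogonal to \<open>d\<^sub>Y \<sigma>\<^sub>2\<close>, which by regularity involves \<open>\<sigma>\<^sub>1\<close>.\<close>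

lemma l_\<sigma>1:
  assumes x: "x \<in> W"
  shows "form (l x) (\<sigma>1 x) = 0"
proof -
  interpret sw: curvature_frame A f s2 s1 T2 T1 W \<sigma>2 \<sigma>1 Y X by (rule frame_swap)
  have "form (deriv_along A Y l x) (\<sigma>2 x) = 0"
    using sphere_osc_orthogonal[OF spheres dif_l_mem[OF x]] osculating_mem(2)[OF x] unfolding deriv_along_def by blast
  then have "form (l x) (\<xi>' x) = 0" using form_deriv[OF smooth_l smooth(2) l_\<sigma>2 x, of Y] by simp
  moreover obtain \<delta> \<gamma> where "\<xi>' x = \<delta> *\<^sub>R \<sigma>2 x + \<gamma> *\<^sub>R \<sigma>1 x" "\<gamma> \<noteq> 0" using sw.\<xi>_coefficients[OF x] .
  ultimately show ?thesis using l_\<sigma>2[OF x] by (simp add: form_simps)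
qed

lemma l_perp_f: "x \<in> W \<Longrightarrow> u \<in> f x \<Longrightarrow> form (l x) u = 0"
  using form_span_zero'[of u "{\<sigma>1 x, \<sigma>2 x}" "l x"] l_\<sigma>1 l_\<sigma>2 unfolding f_span by blast

text \<open>Vectors of \<open>S\<^sub>1\<close> orthogonal to \<open>\<sigma>\<^sub>1\<close> are combinations of \<open>a\<^sub>1\<close> and \<open>\<sigma>\<^sub>1\<close>.\<close>

lemma S1_perp_\<sigma>1:
  assumes x: "x \<in> W" and w: "w \<in> S1 x" "form w (\<sigma>1 x) = 0"
  obtains p q where "w = p *\<^sub>R a1 x + q *\<^sub>R \<sigma>1 x"
proof -
  obtain q p r where e: "w = q *\<^sub>R \<sigma>1 x + p *\<^sub>R a1 x + r *\<^sub>R a2 x"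
    using w(1) unfolding osculating_split(1)[OF x] by (rule span_tripleE)
  then have "r = 0" using w(2) gram[OF x] by (simp add: form_simps form_commute[of "a1 x" "\<sigma>1 x"] form_commute[of "a2 x" "\<sigma>1 x"])
  then show ?thesis using that[of p q] e by simp
qed

lemma l_coefficients:
  assumes x: "x \<in> W"
  obtains p q where "l x = p *\<^sub>R a1 x + q *\<^sub>R \<sigma>1 x" "p * p * form (a1 x) (a1 x) = 1" "p \<noteq> 0"
proof -
  obtain p q where e: "l x = p *\<^sub>R a1 x + q *\<^sub>R \<sigma>1 x" using S1_perp_\<sigma>1[OF x l_mem[OF x] l_\<sigma>1[OF x]] .
  have "p * p * form (a1 x) (a1 x) = 1"
    using unit_section(2)[OF x] gram[OF x] by (simp add: e form_simps form_commute[of "a1 x" "\<sigma>1 x"])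
  moreover from this have "p \<noteq> 0" by auto
  ultimately show ?thesis using that[OF e] by blast
qed

lemma \<sigma>1_dY_l: 
  assumes x: "x \<in> W"
  shows "form (\<sigma>1 x) (deriv_along A Y l x) \<noteq> 0"
proof -
  obtain p q where pq: "l x = p *\<^sub>R a1 x + q *\<^sub>R \<sigma>1 x" "p \<noteq> 0" using l_coefficients[OF x] by metis
  have "form (a1 x) (l x) \<noteq> 0" using pq gram[OF x] by (simp add: form_simps form_commute[of "a1 x" "\<sigma>1 x"])
  moreover have "form (\<sigma>1 y) (l y) = 0" if "y \<in> W" for y using l_\<sigma>1[OF that] by (simp add: form_commute)
  ultimately show ?thesis using form_deriv[OF smooth(1) smooth_l _ x, of Y] by simp
qed

lemma \<sigma>2_dY_l:
  assumes x: "x \<in> W"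
  shows "form (\<sigma>2 x) (dif A l x v) = 0"
  using sphere_osc_orthogonal[OF spheres dif_l_mem[OF x]] osculating_mem(2)[OF x] by (simp add: form_commute)

lemma dX_l:
  assumes x: "x \<in> W"
  obtains \<nu> where "deriv_along A X l x = \<nu> *\<^sub>R \<sigma>1 x"
proof -
  obtain p q where pq: "l x = p *\<^sub>R a1 x + q *\<^sub>R \<sigma>1 x" "p \<noteq> 0" using l_coefficients[OF x] by metis
  have "form (deriv_along A X l x) (\<sigma>1 x) = 0"
    using form_deriv[OF smooth_l smooth(1) l_\<sigma>1 x, of X] l_perp_f[OF x \<xi>_mem[OF x]] by simp
  then obtain p' q' where pq': "deriv_along A X l x = p' *\<^sub>R a1 x + q' *\<^sub>R \<sigma>1 x"
    using S1_perp_\<sigma>1[OF x dif_l_mem[OF x]] unfolding deriv_along_def by metis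
  have "form (l x) (deriv_along A X l x) = 0"
    using form_square_dif[OF W x smooth_l unit_section(2)] unfolding deriv_along_def by simp
  then have "p' = 0" using pq gram[OF x] by (simp add: pq(1) pq' form_simps form_commute[of "a1 x" "\<sigma>1 x"])
  then show ?thesis by (intro that[of q']) (simp add: pq')
qed

end

text \<open>The osculating complex is determined by \<open>\<sigma>\<^sub>1\<close>, \<open>X\<close>, \<open>Y\<close>: two candidates differ by a section of \<open>s\<^sub>1\<close>,
  whose derivative along \<open>X\<close> would have a non-zero component along \<open>\<sigma>\<^sub>2\<close>.\<close>

lemma osculating_complex_unique:
  assumes 1: "osculating_frame A f s1 s2 T1 T2 W \<sigma>1 \<sigma>2 X Y L l"
    and 2: "osculating_frame A f s1' s2' T1' T2' W \<sigma>1 \<sigma>2 X Y L' l'"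
    and x: "x \<in> W"
  obtains \<epsilon> where "\<epsilon> * \<epsilon> = 1" "l' x = \<epsilon> *\<^sub>R l x" "\<And>v. dif A l' x v = \<epsilon> *\<^sub>R dif A l x v"
proof -
  interpret P: osculating_frame A f s1 s2 T1 T2 W \<sigma>1 \<sigma>2 X Y L l by fact
  interpret Q: osculating_frame A f s1' s2' T1' T2' W \<sigma>1 \<sigma>2 X Y L' l' by fact
  note W = P.W
  define \<epsilon> where "\<epsilon> y = form (l y) (l' y)" for y
  have s\<epsilon>: "smooth_map A W \<epsilon>" unfolding \<epsilon>_def[abs_def]
    by (intro P.smooth_map_form W P.smooth_l Q.smooth_l)
  have ex: "\<epsilon> y * \<epsilon> y = 1 \<and> (\<exists>c. l' y = \<epsilon> y *\<^sub>R l y + c *\<^sub>R \<sigma>1 y)" if y: "y \<in> W" for y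
  proof -
    obtain p q where pq: "l y = p *\<^sub>R P.a1 y + q *\<^sub>R \<sigma>1 y" "p * p * form (P.a1 y) (P.a1 y) = 1" "p \<noteq> 0"
      using P.l_coefficients[OF y] .
    obtain p' q' where pq': "l' y = p' *\<^sub>R P.a1 y + q' *\<^sub>R \<sigma>1 y" "p' * p' * form (P.a1 y) (P.a1 y) = 1"
      using Q.l_coefficients[OF y] by metis
    have e: "\<epsilon> y = p * p' * form (P.a1 y) (P.a1 y)"
      using P.gram[OF y] by (simp add: \<epsilon>_def pq(1) pq'(1) form_simps form_commute[of "P.a1 y" "\<sigma>1 y"])
    have "\<epsilon> y * p = p'" using pq(2) by (simp add: e algebra_simps)
    moreover have "\<epsilon> y * \<epsilon> y = (p * p * form (P.a1 y) (P.a1 y)) * (p' * p' * form (P.a1 y) (P.a1 y))"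
      by (simp add: e)
    then have "\<epsilon> y * \<epsilon> y = 1" by (simp only: pq(2) pq'(2) mult_1)
    ultimately show ?thesis
      by (intro conjI exI[of _ "q' - \<epsilon> y * q"]) (simp_all add: pq(1) pq'(1) scaleR_add_right scaleR_diff_left)
  qed
  have d\<epsilon>: "dif A \<epsilon> y u = 0" if y: "y \<in> W" for y u
  proof -
    have "\<epsilon> y * dif A \<epsilon> y u + dif A \<epsilon> y u * \<epsilon> y = 0"
      using P.dif_bilinear[OF bounded_bilinear_mult s\<epsilon> s\<epsilon> y] P.dif_locally_const[OF W y, of "\<lambda>y. \<epsilon> y * \<epsilon> y" 1] ex
      by simp
    then show ?thesis using ex[OF y] by auto
  qed
  have se: "smooth_map A W (\<lambda>y. \<epsilon> y *\<^sub>R l y)" by (intro P.smooth_map_scaleR W s\<epsilon> P.smooth_l)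
  have de: "dif A (\<lambda>y. \<epsilon> y *\<^sub>R l y) y u = \<epsilon> y *\<^sub>R dif A l y u" if y: "y \<in> W" for y u
    using P.dif_scaleR[OF s\<epsilon> P.smooth_l y] d\<epsilon>[OF y] by simp
  define \<phi> where "\<phi> y = l' y - \<epsilon> y *\<^sub>R l y" for y
  have s\<phi>: "smooth_map A W \<phi>" unfolding \<phi>_def[abs_def] by (intro P.smooth_map_diff W Q.smooth_l se)
  have "\<phi> y \<in> span {\<sigma>1 y}" if "y \<in> W" for y
    using ex[OF that] by (auto simp: \<phi>_def span_scale span_base)
  then obtain c where c: "smooth_map A W c" "\<And>y. y \<in> W \<Longrightarrow> \<phi> y = c y *\<^sub>R \<sigma>1 y"
    using P.rank1_coefficient[OF W P.smooth(1) s\<phi>] P.sections(1) by metis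
  have "\<phi> y = 0" if y: "y \<in> W" for y
  proof -
    obtain \<nu> \<nu>' where \<nu>: "deriv_along A X l y = \<nu> *\<^sub>R \<sigma>1 y" "deriv_along A X l' y = \<nu>' *\<^sub>R \<sigma>1 y"
      using P.dX_l[OF y] Q.dX_l[OF y] by metis
    obtain \<alpha> \<beta> where \<alpha>\<beta>: "P.\<xi> y = \<alpha> *\<^sub>R \<sigma>1 y + \<beta> *\<^sub>R \<sigma>2 y" "\<beta> \<noteq> 0" using P.\<xi>_coefficients[OF y] .
    have "dif A \<phi> y (X y) = (\<nu>' - \<epsilon> y * \<nu>) *\<^sub>R \<sigma>1 y"
      unfolding \<phi>_def[abs_def] using P.dif_diff[OF Q.smooth_l se y, of "X y"] de[OF y, of "X y"] \<nu>
      by (simp add: deriv_along_def algebra_simps)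
    moreover have "dif A \<phi> y (X y) = c y *\<^sub>R P.\<xi> y + dif A c y (X y) *\<^sub>R \<sigma>1 y"
      using P.dif_cong[OF W y s\<phi> c(2)] P.dif_scaleR[OF c(1) P.smooth(1) y] by (simp add: deriv_along_def)
    ultimately have "(c y * \<beta>) *\<^sub>R \<sigma>2 y = (\<nu>' - \<epsilon> y * \<nu> - dif A c y (X y) - c y * \<alpha>) *\<^sub>R \<sigma>1 y"
      by (simp add: \<alpha>\<beta>(1) algebra_simps)
    then have "(c y * \<beta>) *\<^sub>R \<sigma>2 y \<in> span {\<sigma>1 y}" by (simp add: span_scale span_base)
    then have "c y * \<beta> = 0" using P.independent_sections(2)[OF y] by (auto dest: span_scale_cancel)
    then show ?thesis using \<alpha>\<beta>(2) c(2)[OF y] by simp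
  qed
  then have eq: "l' y = \<epsilon> y *\<^sub>R l y" if "y \<in> W" for y using that by (simp add: \<phi>_def)
  have "dif A l' x v = \<epsilon> x *\<^sub>R dif A l x v" for v
    using P.dif_cong[OF W x Q.smooth_l eq] de[OF x] by simp
  then show ?thesis using that[of "\<epsilon> x"] ex[OF x] eq[OF x] by simp
qed

subsection \<open>Uniqueness of the curvature spheres\<close>

context curvature_frame
begin

text \<open>A section of \<open>f\<close> with a derivative in \<open>f\<close> at \<open>x\<close> is a curvature sphere there, differentiated along the
  matching direction.\<close>

lemma principal_section:
  assumes \<zeta>: "open W'" "smooth_map A W' \<zeta>" "\<And>y. y \<in> W' \<Longrightarrow> \<zeta> y \<in> f y" and x: "x \<in> W" "x \<in> W'"
    and nz: "\<zeta> x \<noteq> 0" "v \<noteq> 0" and d: "dif A \<zeta> x v \<in> f x"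
  shows "\<zeta> x \<in> s1 x \<and> v \<in> T1 x \<or> \<zeta> x \<in> s2 x \<and> v \<in> T2 x"
proof -
  obtain \<kappa> \<mu> where \<kappa>: "\<zeta> x = \<kappa> *\<^sub>R \<sigma>1 x + \<mu> *\<^sub>R \<sigma>2 x"
    "dif A \<zeta> x v - (\<kappa> *\<^sub>R dif A \<sigma>1 x v + \<mu> *\<^sub>R dif A \<sigma>2 x v) \<in> f x"
    using dif_section_span[OF \<zeta> x] by metis
  obtain a b where v: "v = a *\<^sub>R X x + b *\<^sub>R Y x" using direction_span[OF x(1)] .
  let ?u = "dif A \<zeta> x v - (\<kappa> *\<^sub>R dif A \<sigma>1 x v + \<mu> *\<^sub>R dif A \<sigma>2 x v)"
  let ?w = "\<kappa> *\<^sub>R dif A \<sigma>1 x v + \<mu> *\<^sub>R dif A \<sigma>2 x v"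
  have weq: "dif A \<zeta> x v - ?u = ?w" by simp
  have wf: "?w \<in> f x" using subspace_diff[OF null_plane(1) d \<kappa>(2)] unfolding weq .
  have d1: "dif A \<sigma>1 x v = a *\<^sub>R \<xi> x + b *\<^sub>R a1 x" "dif A \<sigma>2 x v = a *\<^sub>R b1 x + b *\<^sub>R \<xi>' x"
    by (simp_all add: v dif_add_vec[OF smooth(1) x(1)] dif_scale_vec[OF smooth(1) x(1)]
        dif_add_vec[OF smooth(2) x(1)] dif_scale_vec[OF smooth(2) x(1)] deriv_along_def)
  note F = form_f_derivs[OF x(1)]
  note F' = F[OF \<xi>_mem[OF x(1)]] F[OF \<xi>'_mem[OF x(1)]] F[OF wf] form_a1_b1[OF x(1)]
  have "form ?w (a1 x) = 0" "form ?w (b1 x) = 0" using F' by blast+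
  then have "\<kappa> * b = 0" "\<mu> * a = 0"
    using F' a1_spacelike[OF x(1)] b1_spacelike[OF x(1)]
    by (auto simp: d1 form_simps form_commute[of "b1 x" "a1 x"])
  then have "b = 0 \<and> \<mu> = 0 \<or> a = 0 \<and> \<kappa> = 0" using nz \<kappa>(1) v by auto
  then show ?thesis using \<kappa>(1) v spans[OF x(1)] by (auto simp: span_scale span_base)
qed

end

context legendre_surface
begin

lemma curvature_spheres_unique:
  assumes cs: "curvature_spheres A f s1 s2 T1 T2" and cs': "curvature_spheres A f s1' s2' T1' T2'"
  shows "s1' x = s1 x \<and> s2' x = s2 x \<and> T1' x = T1 x \<and> T2' x = T2 x \<or>
    s1' x = s2 x \<and> s2' x = s1 x \<and> T1' x = T2 x \<and> T2' x = T1 x"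
proof -
  obtain W \<sigma>1 \<sigma>2 X Y where x: "x \<in> W" and cf: "curvature_frame A f s1 s2 T1 T2 W \<sigma>1 \<sigma>2 X Y"
    using curvature_frame_exists[OF cs] .
  interpret P: curvature_frame A f s1 s2 T1 T2 W \<sigma>1 \<sigma>2 X Y by fact
  obtain W' \<sigma>1' \<sigma>2' X' Y' where x': "x \<in> W'" and cf': "curvature_frame A f s1' s2' T1' T2' W' \<sigma>1' \<sigma>2' X' Y'"
    using curvature_frame_exists[OF cs'] .
  interpret Q: curvature_frame A f s1' s2' T1' T2' W' \<sigma>1' \<sigma>2' X' Y' by fact
  have eq: "s1 x = span {a}" if "a \<in> s1 x" "a \<noteq> 0" for a using rank1_bundle_span[OF P.rank1(1) that] .
  have eq2: "s2 x = span {a}" if "a \<in> s2 x" "a \<noteq> 0" for a using rank1_bundle_span[OF P.rank1(2) that] .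
  have eqT: "T1 x = span {a}" if "a \<in> T1 x" "a \<noteq> 0" for a using line_field_span[OF P.rank1(3) that] .
  have eqT2: "T2 x = span {a}" if "a \<in> T2 x" "a \<noteq> 0" for a using line_field_span[OF P.rank1(4) that] .
  have A: "\<sigma>1' x \<in> s1 x \<and> X' x \<in> T1 x \<or> \<sigma>1' x \<in> s2 x \<and> X' x \<in> T2 x"
    by (rule P.principal_section[OF Q.W Q.smooth(1) Q.section_mem(1) x x'])
      (use Q.sections x' Q.\<xi>_mem in \<open>auto simp: deriv_along_def\<close>)
  have B: "\<sigma>2' x \<in> s1 x \<and> Y' x \<in> T1 x \<or> \<sigma>2' x \<in> s2 x \<and> Y' x \<in> T2 x"
    by (rule P.principal_section[OF Q.W Q.smooth(2) Q.section_mem(2) x x'])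
      (use Q.sections x' Q.\<xi>'_mem in \<open>auto simp: deriv_along_def\<close>)
  have ne: "s1' x \<noteq> s2' x" using Q.rank1(7)[of x] Q.sections(1)[OF x'] by auto
  from A B show ?thesis
    using ne Q.spans[OF x'] Q.sections[OF x'] eq eq2 eqT eqT2 by metis
qed

text \<open>Each of the two ways of matching two sets of curvature data is an open condition.\<close>

lemma curvature_spheres_unique_local:
  assumes cs: "curvature_spheres A f s1 s2 T1 T2" and cs': "curvature_spheres A f s1' s2' T1' T2'"
    and eq: "s1' x = s1 x"
  obtains U where "open U" "x \<in> U" "\<And>y. y \<in> U \<Longrightarrow> s1' y = s1 y \<and> s2' y = s2 y \<and> T1' y = T1 y \<and> T2' y = T2 y"
proof -
  obtain W \<sigma>1 \<sigma>2 X Y where x: "x \<in> W" and cf: "curvature_frame A f s1 s2 T1 T2 W \<sigma>1 \<sigma>2 X Y"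
    using curvature_frame_exists[OF cs] .
  interpret P: curvature_frame A f s1 s2 T1 T2 W \<sigma>1 \<sigma>2 X Y by fact
  obtain W' \<sigma>1' \<sigma>2' X' Y' where x': "x \<in> W'" and cf': "curvature_frame A f s1' s2' T1' T2' W' \<sigma>1' \<sigma>2' X' Y'"
    using curvature_frame_exists[OF cs'] .
  interpret Q: curvature_frame A f s1' s2' T1' T2' W' \<sigma>1' \<sigma>2' X' Y' by fact
  have op: "open (W \<inter> W')" using P.W Q.W by auto
  have sm: "smooth_map A (W \<inter> W') \<sigma>1" "smooth_map A (W \<inter> W') \<sigma>2" "smooth_map A (W \<inter> W') \<sigma>1'"
    using smooth_map_subset P.smooth Q.smooth by blast+
  obtain \<kappa> \<mu> where k: "smooth_map A (W \<inter> W') \<kappa>"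
    "\<And>y. y \<in> W \<inter> W' \<Longrightarrow> \<sigma>1' y = \<kappa> y *\<^sub>R \<sigma>1 y + \<mu> y *\<^sub>R \<sigma>2 y"
  proof (rule rank2_coefficients[OF op sm])
    fix y assume "y \<in> W \<inter> W'"
    then show "\<sigma>2 y \<noteq> 0" "\<sigma>1 y \<notin> span {\<sigma>2 y}" "\<sigma>1' y \<in> span {\<sigma>1 y, \<sigma>2 y}"
      using P.sections(2)[of y] P.independent_sections(1)[of y] P.f_span[of y] Q.section_mem(1)[of y] by auto
  qed blast
  have "\<kappa> x \<noteq> 0"
  proof
    assume "\<kappa> x = 0"
    then have "\<sigma>1' x \<in> s2 x" using k(2)[of x] P.spans(2)[OF x] x x' by (simp add: span_scale span_base)
    moreover have "\<sigma>1' x \<in> s1 x" using Q.sections(1)[OF x'] eq by simp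
    ultimately show False using P.rank1(7)[of x] Q.sections(1)[OF x'] by auto
  qed
  define U where "U = (W \<inter> W') \<inter> \<kappa> -` (- {0})"
  have U: "open U" unfolding U_def
    by (rule continuous_open_preimage[OF smooth_map_continuous[OF op k(1)] op]) auto
  have "s1' y \<noteq> s2 y" if y: "y \<in> U" for y
  proof
    assume "s1' y = s2 y"
    then have "\<kappa> y *\<^sub>R \<sigma>1 y + \<mu> y *\<^sub>R \<sigma>2 y \<in> span {\<sigma>2 y}"
      using y Q.sections(1)[of y] k(2)[of y] P.spans(2)[of y] by (simp add: U_def)
    then have "\<kappa> y *\<^sub>R \<sigma>1 y \<in> span {\<sigma>2 y}"
      by (metis add_diff_cancel_right' singletonI span_base span_diff span_scale)
    then show False using y P.independent_sections(1)[of y] by (auto simp: U_def dest: span_scale_cancel)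
  qed
  then have "s1' y = s1 y \<and> s2' y = s2 y \<and> T1' y = T1 y \<and> T2' y = T2 y" if "y \<in> U" for y
    using curvature_spheres_unique[OF cs cs', of y] that by blast
  then show ?thesis using that[of U] U x x' \<open>\<kappa> x \<noteq> 0\<close> by (simp add: U_def)
qed

end

section \<open>Constant osculating bundles\<close>

context surface
begin

lemma dif_in_subspace:
  assumes V: "subspace V" and W: "open W" "x \<in> W" "smooth_map A W a" "\<And>y. y \<in> W \<Longrightarrow> a y \<in> V"
  shows "dif A a x v \<in> (V :: r42 set)"
proof -
  have "form z (dif A a x v) = 0" if z: "z \<in> perp V" for z
  proof -
    have "form z (a y) = 0" if "y \<in> W" for y
      using z W(4)[OF that] by (auto simp: perp_def form_commute)
    from form_const_dif[OF W(1,2) smooth_map_const W(3) this, where v = v] show ?thesis by (simp add: form_simps)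
  qed
  then have "dif A a x v \<in> perp (perp V)" by (simp add: perp_def)
  then show ?thesis using perp_perp[OF V] by simp
qed

lemma unit_section_exists:
  assumes L: "subbundle A 1 L" and pos: "\<forall>x. \<forall>a\<in>L x. a \<noteq> 0 \<longrightarrow> form a a > 0"
  obtains W l where "x \<in> W" "local_section A W L l" "\<forall>y\<in>W. form (l y) (l y) = 1"
proof -
  obtain W \<sigma> where W: "open W" "x \<in> W" "smooth_map A W \<sigma>" "\<And>y. y \<in> W \<Longrightarrow> \<sigma> y \<in> L y \<and> \<sigma> y \<noteq> 0"
    using rank1_bundle_section[OF L] by metis
  have p: "form (\<sigma> y) (\<sigma> y) > 0" if "y \<in> W" for y using pos W(4)[OF that] by blast
  define l where "l y = inverse (sqrt (form (\<sigma> y) (\<sigma> y))) *\<^sub>R \<sigma> y" for y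
  have "smooth_map A W l" unfolding l_def[abs_def]
    by (intro smooth_map_scaleR smooth_map_inverse smooth_map_sqrt smooth_map_form W) (use p in force)+
  moreover have "l y \<in> L y" if "y \<in> W" for y
    using L W(4)[OF that] unfolding l_def subbundle_def by (simp add: subspace_scale)
  moreover have "form (l y) (l y) = 1" if "y \<in> W" for y
    using p[OF that] by (simp add: l_def form_simps field_simps)
  ultimately show ?thesis using that[of W l] W unfolding local_section_def by blast
qed

end

lemma osculating_frameI:
  assumes "curvature_frame A f s1 s2 T1 T2 W \<sigma>1 \<sigma>2 X Y"
    "osculating_complex A (sphere_osc A s1 T2) (sphere_osc A s2 T1) L"
    "local_section A W' L l" "\<And>y. y \<in> W' \<Longrightarrow> form (l y) (l y) = 1"
  shows "osculating_frame A f s1 s2 T1 T2 (W \<inter> W') \<sigma>1 \<sigma>2 X Y L l"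
proof -
  interpret curvature_frame A f s1 s2 T1 T2 W \<sigma>1 \<sigma>2 X Y by fact
  have W': "open W'" "smooth_map A W' l" using assms(3) unfolding local_section_def by auto
  have "curvature_frame A f s1 s2 T1 T2 (W \<inter> W') \<sigma>1 \<sigma>2 X Y"
    by (rule frame_restrict) (use W W' in auto)
  moreover have "local_section A (W \<inter> W') L l"
    using assms(3) W smooth_map_subset[OF W'(2), of "W \<inter> W'"] unfolding local_section_def by auto
  ultimately show ?thesis
    unfolding osculating_frame_def osculating_frame_axioms_def using assms by auto
qed

text \<open>Curvature data whose osculating bundles are the same two Lorentzian 3-spaces at all points. The data
  are symmetric under exchange of the two families.\<close>

locale joachimsthal = legendre_surface A f
  for A :: "'a::{t2_space, second_countable_topology} chart set" and f +
  fixes s1 s2 T1 T2 L1 L2 H1 H2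
  assumes spheres: "curvature_spheres A f s1 s2 T1 T2"
    and complex1: "osculating_complex A (sphere_osc A s1 T2) (sphere_osc A s2 T1) L1"
    and complex2: "osculating_complex A (sphere_osc A s2 T1) (sphere_osc A s1 T2) L2"
    and H1: "\<And>x. osculating_bundle A L1 T2 x = H1" and H2: "\<And>x. osculating_bundle A L2 T1 x = H2"
    and signature1: "has_signature H1 2 1" and signature2: "has_signature H2 2 1"

locale joachimsthal_frame = joachimsthal A f s1 s2 T1 T2 L1 L2 H1 H2 +
  P: osculating_frame A f s1 s2 T1 T2 W \<sigma>1 \<sigma>2 X Y L1 l1 +
  Q: osculating_frame A f s2 s1 T2 T1 W \<sigma>2 \<sigma>1 Y X L2 l2
  for A :: "'a::{t2_space, second_countable_topology} chart set" and f s1 s2 T1 T2 L1 L2 H1 H2 W \<sigma>1 \<sigma>2 X Y l1 l2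

context joachimsthal
begin

lemma joachimsthal_swap: "joachimsthal A f s2 s1 T2 T1 L2 L1 H2 H1"
  by unfold_locales
    (use curvature_spheres_swap[OF spheres] complex1 complex2 H1 H2 signature1 signature2 in auto)

lemma frame_exists_over:
  assumes "x \<in> W1" "local_section A W1 L1 l1" "\<forall>y\<in>W1. form (l1 y) (l1 y) = 1"
    and "x \<in> W2" "local_section A W2 L2 l2" "\<forall>y\<in>W2. form (l2 y) (l2 y) = 1"
  obtains W \<sigma>1 \<sigma>2 X Y where "x \<in> W" "W \<subseteq> W1 \<inter> W2"
    "joachimsthal_frame A f s1 s2 T1 T2 L1 L2 H1 H2 W \<sigma>1 \<sigma>2 X Y l1 l2"
proof -
  obtain W \<sigma>1 \<sigma>2 X Y where x: "x \<in> W" and cf: "curvature_frame A f s1 s2 T1 T2 W \<sigma>1 \<sigma>2 X Y"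
    using curvature_frame_exists[OF spheres] .
  interpret C: curvature_frame A f s1 s2 T1 T2 W \<sigma>1 \<sigma>2 X Y by fact
  have o: "open W1" "open W2" using assms unfolding local_section_def by auto
  have r: "local_section A (W1 \<inter> W2) L1 l1" "local_section A (W1 \<inter> W2) L2 l2"
    using assms(2,5) smooth_map_subset[of W1 l1 "W1 \<inter> W2"] smooth_map_subset[of W2 l2 "W1 \<inter> W2"]
    unfolding local_section_def by auto
  have "osculating_frame A f s1 s2 T1 T2 (W \<inter> (W1 \<inter> W2)) \<sigma>1 \<sigma>2 X Y L1 l1"
    by (rule osculating_frameI[OF cf complex1 r(1)]) (use assms in auto)
  moreover have "osculating_frame A f s2 s1 T2 T1 (W \<inter> (W1 \<inter> W2)) \<sigma>2 \<sigma>1 Y X L2 l2"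
    by (rule osculating_frameI[OF C.frame_swap complex2 r(2)]) (use assms in auto)
  ultimately have "joachimsthal_frame A f s1 s2 T1 T2 L1 L2 H1 H2 (W \<inter> (W1 \<inter> W2)) \<sigma>1 \<sigma>2 X Y l1 l2"
    unfolding joachimsthal_frame_def using joachimsthal_axioms by blast
  then show ?thesis using that[of "W \<inter> (W1 \<inter> W2)"] x assms by blast
qed

lemma unit_sections:
  obtains W1 l1 W2 l2 where "x \<in> W1" "local_section A W1 L1 l1" "\<forall>y\<in>W1. form (l1 y) (l1 y) = 1"
    "x \<in> W2" "local_section A W2 L2 l2" "\<forall>y\<in>W2. form (l2 y) (l2 y) = 1"
proof -
  have L: "subbundle A 1 L1" "\<forall>x. \<forall>a\<in>L1 x. a \<noteq> 0 \<longrightarrow> form a a > 0"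
    using complex1 unfolding osculating_complex_def by blast+
  have L': "subbundle A 1 L2" "\<forall>x. \<forall>a\<in>L2 x. a \<noteq> 0 \<longrightarrow> form a a > 0"
    using complex2 unfolding osculating_complex_def by blast+
  show ?thesis
    by (rule unit_section_exists[OF L, where x = x], rule unit_section_exists[OF L', where x = x], rule that)
qed

lemma frame_exists:
  obtains W \<sigma>1 \<sigma>2 X Y l1 l2 where "x \<in> W"
    "joachimsthal_frame A f s1 s2 T1 T2 L1 L2 H1 H2 W \<sigma>1 \<sigma>2 X Y l1 l2"
proof -
  obtain W1 l1 W2 l2 where 1: "x \<in> W1" "local_section A W1 L1 l1" "\<forall>y\<in>W1. form (l1 y) (l1 y) = 1"
    "x \<in> W2" "local_section A W2 L2 l2" "\<forall>y\<in>W2. form (l2 y) (l2 y) = 1"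
    by (rule unit_sections)
  show ?thesis by (rule frame_exists_over[OF 1]) (rule that)
qed

lemma subspaces: "subspace H1" "subspace H2"
  using lorentz_subspace signature1 signature2 by auto

text \<open>The osculating bundles are orthogonal: every generator of \<open>H\<^sub>1\<close> is orthogonal to \<open>l\<^sub>2\<close>, at all points
  since \<open>H\<^sub>1\<close> is constant, hence also to the derivatives of \<open>l\<^sub>2\<close>.\<close>

lemma H1_perp_l2:
  assumes a: "a \<in> H1" and 2: "x \<in> W2" "local_section A W2 L2 l2" "\<And>y. y \<in> W2 \<Longrightarrow> form (l2 y) (l2 y) = 1"
  shows "form a (l2 x) = 0"
  using a[folded H1[of x]] unfolding osculating_bundle_def
proof (rule osc_span_orthogonal)
  fix W1 l1 Y z
  assume 1: "x \<in> W1" "local_section A W1 L1 l1" "\<And>y. y \<in> W1 \<Longrightarrow> form (l1 y) (l1 y) = 1"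
    and Y: "local_field A W1 T2 Y" "\<And>y. y \<in> W1 \<Longrightarrow> Y y \<noteq> 0"
    and z: "z \<in> {l1 x, deriv_along A Y l1 x, deriv_along A Y (deriv_along A Y l1) x}"
  obtain W \<sigma>1 \<sigma>2 X Y0 where x: "x \<in> W" and sub: "W \<subseteq> W1 \<inter> W2"
    and jf: "joachimsthal_frame A f s1 s2 T1 T2 L1 L2 H1 H2 W \<sigma>1 \<sigma>2 X Y0 l1 l2"
    using frame_exists_over[OF 1(1,2) _ 2(1,2)] 1(3) 2(3) by blast
  interpret joachimsthal_frame A f s1 s2 T1 T2 L1 L2 H1 H2 W \<sigma>1 \<sigma>2 X Y0 l1 l2 by fact
  have Y': "smooth_vector_field A W Y"
    using Y(1) sub smooth_vector_field_subset unfolding local_field_def by blast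
  have sY: "smooth_map A W (deriv_along A Y l1)" by (intro smooth_map_deriv_along P.W Y' P.smooth_l)
  have a: "form (l1 y) (l2 y) = 0" "form (deriv_along A Y l1 y) (l2 y) = 0"
    "form (deriv_along A Y l1 y) (deriv_along A Y l2 y) = 0" if "y \<in> W" for y
    using sphere_osc_orthogonal[OF spheres] P.l_mem[OF that] Q.l_mem[OF that] P.dif_l_mem[OF that] Q.dif_l_mem[OF that]
    unfolding deriv_along_def by blast+
  have "form (deriv_along A Y (deriv_along A Y l1) x) (l2 x) = 0"
    using P.form_deriv[OF sY Q.smooth_l a(2) x, of Y] a(3)[OF x] by simp
  then show "form z (l2 x) = 0" using z a[OF x] by blast
qed

lemma H1_perp_H2:
  assumes a: "a \<in> H1" and b: "b \<in> H2"
  shows "form a b = 0"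
proof -
  define x :: 'a where "x = undefined"
  have "form b a = 0"
    using b[folded H2[of x]] unfolding osculating_bundle_def
  proof (rule osc_span_orthogonal)
    fix W l2 X z
    assume 2: "x \<in> W" "local_section A W L2 l2" "\<And>y. y \<in> W \<Longrightarrow> form (l2 y) (l2 y) = 1"
      and X: "local_field A W T1 X" "\<And>y. y \<in> W \<Longrightarrow> X y \<noteq> 0"
      and z: "z \<in> {l2 x, deriv_along A X l2 x, deriv_along A X (deriv_along A X l2) x}"
    have W: "open W" "smooth_map A W l2" "smooth_vector_field A W X"
      using 2 X unfolding local_section_def local_field_def by auto
    have 0: "form a (l2 y) = 0" if "y \<in> W" for y using H1_perp_l2[OF a that 2(2,3)] .
    have 1: "form a (deriv_along A X l2 y) = 0" if "y \<in> W" for y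
      using form_const_dif[OF W(1) that smooth_map_const W(2) 0, where v = "X y"]
      by (simp add: deriv_along_def form_simps)
    have "form a (deriv_along A X (deriv_along A X l2) x) = 0"
      using form_const_dif[OF W(1) 2(1) smooth_map_const smooth_map_deriv_along[OF W(1,3,2)] 1, where v = "X x"]
      by (simp add: deriv_along_def form_simps)
    then show "form z a = 0" using z 0[OF 2(1)] 1[OF 2(1)] by (auto simp: form_commute)
  qed
  then show ?thesis by (simp add: form_commute)
qed

end

context joachimsthal_frame
begin

lemma jframe_swap: "joachimsthal_frame A f s2 s1 T2 T1 L2 L1 H2 H1 W \<sigma>2 \<sigma>1 Y X l2 l1"
  unfolding joachimsthal_frame_def
  using joachimsthal_swap P.osculating_frame_axioms Q.osculating_frame_axioms
    P.curvature_frame_axioms Q.curvature_frame_axioms by (metis osculating_frame.intro)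

lemma l1_mem:
  assumes x: "x \<in> W"
  shows "l1 x \<in> H1" "deriv_along A Y l1 x \<in> H1" "deriv_along A Y (deriv_along A Y l1) x \<in> H1"
proof -
  have "{l1 x, deriv_along A Y l1 x, deriv_along A Y (deriv_along A Y l1) x} \<subseteq> osculating_bundle A L1 T2 x"
    unfolding osculating_bundle_def
    by (rule osc_span_generator[where P = "\<lambda>a. form a a = 1", OF x P.unit_section])
      (use P.W P.smooth P.sections in \<open>auto simp: local_field_def\<close>)
  then show "l1 x \<in> H1" "deriv_along A Y l1 x \<in> H1" "deriv_along A Y (deriv_along A Y l1) x \<in> H1"
    unfolding H1 by auto
qed

lemma dif_l1_mem: "x \<in> W \<Longrightarrow> dif A l1 x v \<in> H1"
  using dif_in_subspace[OF subspaces(1) P.W _ P.smooth_l l1_mem(1)] .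

text \<open>If \<open>d\<^sub>X l\<^sub>1 \<noteq> 0\<close>, then \<open>H\<^sub>1\<close> contains \<open>\<sigma>\<^sub>1\<close>, hence also \<open>d\<^sub>X \<sigma>\<^sub>1\<close> and so the null plane \<open>f\<close>: impossible.\<close>

lemma dX_l1_zero:
  assumes x: "x \<in> W"
  shows "deriv_along A X l1 x = 0"
proof (rule ccontr)
  assume nz: "deriv_along A X l1 x \<noteq> 0"
  have sm: "smooth_map A W (deriv_along A X l1)" by (intro smooth_map_deriv_along P.W P.smooth P.smooth_l)
  define U where "U = W \<inter> deriv_along A X l1 -` (- {0})"
  have U: "open U" unfolding U_def
    by (rule continuous_open_preimage[OF smooth_map_continuous[OF P.W sm] P.W]) auto
  have \<sigma>1: "\<sigma>1 y \<in> H1" if y: "y \<in> U" for y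
  proof -
    have yW: "y \<in> W" and nzy: "deriv_along A X l1 y \<noteq> 0" using y by (auto simp: U_def)
    obtain \<nu> where \<nu>: "deriv_along A X l1 y = \<nu> *\<^sub>R \<sigma>1 y" using P.dX_l[OF yW] .
    have "\<nu> \<noteq> 0" using nzy \<nu> by auto
    have "inverse \<nu> *\<^sub>R deriv_along A X l1 y \<in> H1"
      using dif_l1_mem[OF yW] subspaces by (simp add: deriv_along_def subspace_scale)
    then show ?thesis using \<nu> \<open>\<nu> \<noteq> 0\<close> by simp
  qed
  have xU: "x \<in> U" using x nz by (simp add: U_def)
  have s: "smooth_map A U \<sigma>1" by (rule smooth_map_subset[OF P.smooth(1)]) (auto simp: U_def)
  obtain \<alpha> \<beta> where ab: "P.\<xi> x = \<alpha> *\<^sub>R \<sigma>1 x + \<beta> *\<^sub>R \<sigma>2 x" "\<beta> \<noteq> 0" using P.\<xi>_coefficients[OF x] .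
  have "P.\<xi> x \<in> H1" unfolding deriv_along_def by (rule dif_in_subspace[OF subspaces(1) U xU s \<sigma>1])
  then have "inverse \<beta> *\<^sub>R (P.\<xi> x - \<alpha> *\<^sub>R \<sigma>1 x) \<in> H1"
    using \<sigma>1[OF xU] subspaces by (simp add: subspace_scale subspace_diff)
  then have \<sigma>2: "\<sigma>2 x \<in> H1" using ab by simp
  note m = P.section_mem[OF x]
  obtain c where "\<sigma>2 x = c *\<^sub>R \<sigma>1 x"
    using lorentz_null_null[OF signature1 \<sigma>1[OF xU] form_null[OF m(1) m(1)] _ \<sigma>2 form_null[OF m(2) m(2)]
        form_null[OF m]] P.sections(1)[OF x] by metis
  then show False using P.independent_sections(2)[OF x] by (simp add: span_scale span_base)
qed

lemma dif_l1_T1: "x \<in> W \<Longrightarrow> v \<in> T1 x \<Longrightarrow> dif A l1 x v = 0"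
  using dX_l1_zero P.spans(3)[of x] dif_scale_vec[OF P.smooth_l, of x]
  by (auto simp: deriv_along_def elim!: span_singletonE)

text \<open>A vector of \<open>f\<close> in \<open>H\<^sub>1\<close> is orthogonal to \<open>d\<^sub>X l\<^sub>2\<close> and \<open>d\<^sub>X d\<^sub>X l\<^sub>2\<close>, but \<open>(\<sigma>\<^sub>2, d\<^sub>X l\<^sub>2) \<noteq> 0 = (\<sigma>\<^sub>1, d\<^sub>X l\<^sub>2)\<close> and therefore
  \<open>(\<sigma>\<^sub>1, d\<^sub>X d\<^sub>X l\<^sub>2) = - (d\<^sub>X \<sigma>\<^sub>1, d\<^sub>X l\<^sub>2) \<noteq> 0\<close>.\<close>

lemma f_inter_H1:
  assumes x: "x \<in> W" and z: "z \<in> f x" "z \<in> H1"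
  shows "z = 0"
proof -
  interpret sw: joachimsthal_frame A f s2 s1 T2 T1 L2 L1 H2 H1 W \<sigma>2 \<sigma>1 Y X l2 l1 by (rule jframe_swap)
  have sX: "smooth_map A W (deriv_along A X l2)" by (intro smooth_map_deriv_along P.W P.smooth Q.smooth_l)
  obtain a b where zab: "z = a *\<^sub>R \<sigma>1 x + b *\<^sub>R \<sigma>2 x" using span_pairE z(1) P.f_span[OF x] by metis
  have 0: "form (\<sigma>1 y) (deriv_along A X l2 y) = 0" if "y \<in> W" for y
    using Q.\<sigma>2_dY_l[OF that] by (simp add: deriv_along_def)
  have 1: "form (\<sigma>2 x) (deriv_along A X l2 x) \<noteq> 0" by (rule Q.\<sigma>1_dY_l[OF x])
  have "form z (deriv_along A X l2 x) = 0" by (rule H1_perp_H2[OF z(2) sw.l1_mem(2)[OF x]])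
  then have b: "b = 0" using 0[OF x] 1 by (simp add: zab form_simps)
  obtain \<alpha> \<beta> where ab: "P.\<xi> x = \<alpha> *\<^sub>R \<sigma>1 x + \<beta> *\<^sub>R \<sigma>2 x" "\<beta> \<noteq> 0" using P.\<xi>_coefficients[OF x] .
  have "form (\<sigma>1 x) (deriv_along A X (deriv_along A X l2) x) \<noteq> 0"
    using P.form_deriv[OF P.smooth(1) sX 0 x, of X] 0[OF x] 1 ab by (simp add: form_simps)
  moreover have "form z (deriv_along A X (deriv_along A X l2) x) = 0" by (rule H1_perp_H2[OF z(2) sw.l1_mem(3)[OF x]])
  ultimately show ?thesis using b by (simp add: zab form_simps)
qed

end

section \<open>The points where the osculating complexes are not lightlike curves\<close>

context joachimsthal_frame
begin

text \<open>Other curvature data that share \<open>s\<^sub>1\<close> at \<open>x\<close> agree with the given data nearby, so that their osculating complex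
  is spanned by \<open>l\<^sub>1\<close> as well.\<close>

lemma dif_complex_not_null:
  assumes x: "x \<in> W" and nn: "form (deriv_along A Y l1 x) (deriv_along A Y l1 x) \<noteq> 0"
    and cs': "curvature_spheres A f s1' s2' T1' T2'" and eq: "s1' x = s1 x"
    and oc': "osculating_complex A (sphere_osc A s1' T2') (sphere_osc A s2' T1') L'"
    and l': "local_section A W' L' l'" "\<forall>y\<in>W'. form (l' y) (l' y) = 1" and x': "x \<in> W'"
    and v: "v \<in> T2' x" "v \<noteq> 0"
  shows "form (dif A l' x v) (dif A l' x v) \<noteq> 0"
proof -
  have W': "open W'" using l' unfolding local_section_def by auto
  obtain U where U: "open U" "x \<in> U" "\<And>y. y \<in> U \<Longrightarrow> s1' y = s1 y \<and> s2' y = s2 y \<and> T1' y = T1 y \<and> T2' y = T2 y"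
    using curvature_spheres_unique_local[OF spheres cs' eq] by blast
  have op: "open (W \<inter> U)" using P.W U(1) by auto
  have cfU: "curvature_frame A f s1 s2 T1 T2 (W \<inter> U) \<sigma>1 \<sigma>2 X Y" by (rule P.frame_restrict[OF op]) auto
  interpret U: curvature_frame A f s1 s2 T1 T2 "W \<inter> U" \<sigma>1 \<sigma>2 X Y by fact
  have cf': "curvature_frame A f s1' s2' T1' T2' (W \<inter> U) \<sigma>1 \<sigma>2 X Y"
    by unfold_locales (use cs' op U.smooth U.sections U(3) in auto)
  have 1: "osculating_frame A f s1' s2' T1' T2' (W \<inter> U \<inter> W') \<sigma>1 \<sigma>2 X Y L' l'"
    by (rule osculating_frameI[OF cf' oc' l'(1)]) (use l' in auto)
  have "osculating_frame A f s1 s2 T1 T2 (W \<inter> (W \<inter> U \<inter> W')) \<sigma>1 \<sigma>2 X Y L1 l1"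
    by (rule osculating_frameI[OF P.curvature_frame_axioms complex1])
      (use P.unit_section op W' smooth_map_subset[OF P.smooth_l, of "W \<inter> U \<inter> W'"] in \<open>auto simp: local_section_def\<close>)
  then have 2: "osculating_frame A f s1 s2 T1 T2 (W \<inter> U \<inter> W') \<sigma>1 \<sigma>2 X Y L1 l1"
    by (simp add: Int_left_absorb Int_assoc)
  obtain \<epsilon> where \<epsilon>: "\<epsilon> * \<epsilon> = 1" "\<And>v. dif A l' x v = \<epsilon> *\<^sub>R dif A l1 x v"
    using osculating_complex_unique[OF 2 1] x x' U(2) by blast
  obtain k where k: "v = k *\<^sub>R Y x" using v(1) U(3)[OF U(2)] P.spans(4)[OF x] by (auto elim: span_singletonE)
  have "form (dif A l' x v) (dif A l' x v) = k * k * form (deriv_along A Y l1 x) (deriv_along A Y l1 x)"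
    using \<epsilon>(1) by (simp add: \<epsilon>(2) k dif_scale_vec[OF P.smooth_l x] form_simps deriv_along_def algebra_simps)
  then show ?thesis using nn k v(2) by auto
qed

text \<open>The set of non-lightlike points, whose definition refers to all possible curvature data, described in terms of the given data.\<close>

lemma non_lightlike_iff:
  assumes x: "x \<in> W"
  shows "x \<in> non_lightlike_set A f \<longleftrightarrow>
    form (deriv_along A Y l1 x) (deriv_along A Y l1 x) \<noteq> 0 \<and> form (deriv_along A X l2 x) (deriv_along A X l2 x) \<noteq> 0"
    (is "_ \<longleftrightarrow> ?R")
proof
  assume "x \<in> non_lightlike_set A f"
  then have *: "form (dif A l x v) (dif A l x v) \<noteq> 0"
    if "curvature_spheres A f s1 s2 T1 T2" "osculating_complex A (sphere_osc A s1 T2) (sphere_osc A s2 T1) L"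
      "local_section A W L l" "x \<in> W" "\<forall>y\<in>W. form (l y) (l y) = 1" "v \<in> T2 x" "v \<noteq> 0" for s1 s2 T1 T2 L W l v
    using that unfolding non_lightlike_set_def by blast
  show ?R unfolding deriv_along_def
    using *[OF spheres complex1 P.unit_section(1) x] *[OF curvature_spheres_swap[OF spheres] complex2 Q.unit_section(1) x]
      P.unit_section(2) Q.unit_section(2) P.sections[OF x] by blast
next
  assume R: ?R
  show "x \<in> non_lightlike_set A f" unfolding non_lightlike_set_def mem_Collect_eq
  proof (intro allI impI, elim conjE)
    fix s1' s2' T1' T2' L' W' l' v
    assume cs': "curvature_spheres A f s1' s2' T1' T2'"
      and oc': "osculating_complex A (sphere_osc A s1' T2') (sphere_osc A s2' T1') L'"
      and l': "local_section A W' L' l'" "\<forall>y\<in>W'. form (l' y) (l' y) = 1" and x': "x \<in> W'"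
      and v: "v \<in> T2' x" "v \<noteq> 0"
    consider "s1' x = s1 x" | "s1' x = s2 x" using curvature_spheres_unique[OF spheres cs', of x] by blast
    then show "form (dif A l' x v) (dif A l' x v) \<noteq> 0"
    proof cases
      case 1
      then show ?thesis using dif_complex_not_null[OF x conjunct1[OF R] cs' _ oc' l' x' v] by blast
    next
      case 2
      interpret sw: joachimsthal_frame A f s2 s1 T2 T1 L2 L1 H2 H1 W \<sigma>2 \<sigma>1 Y X l2 l1 by (rule jframe_swap)
      show ?thesis using sw.dif_complex_not_null[OF x conjunct2[OF R] cs' 2 oc' l' x' v] .
    qed
  qed
qed

text \<open>If \<open>d\<^sub>Y l\<^sub>1\<close> were null on an open set, it would be orthogonal to \<open>l\<^sub>1\<close>, \<open>d\<^sub>Y l\<^sub>1\<close> and \<open>d\<^sub>Y d\<^sub>Y l\<^sub>1\<close> there, hence to the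
  nondegenerate space \<open>H\<^sub>1\<close>.\<close>

lemma dY_l1_not_null:
  assumes U: "open U" "U \<subseteq> W" "x \<in> U"
  shows "\<exists>y\<in>U. form (deriv_along A Y l1 y) (deriv_along A Y l1 y) \<noteq> 0"
proof (rule ccontr)
  assume "\<not> ?thesis"
  then have null: "\<And>y. y \<in> U \<Longrightarrow> form (deriv_along A Y l1 y) (deriv_along A Y l1 y) = 0" by blast
  have xW: "x \<in> W" using U by auto
  have "form a (deriv_along A Y l1 x) = 0" if a: "a \<in> H1" for a
    using a[folded H1[of x]] unfolding osculating_bundle_def
  proof (rule osc_span_orthogonal)
    fix W1 l Z z
    assume 1: "x \<in> W1" "local_section A W1 L1 l" "\<And>y. y \<in> W1 \<Longrightarrow> form (l y) (l y) = 1"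
      and Z: "local_field A W1 T2 Z" "\<And>y. y \<in> W1 \<Longrightarrow> Z y \<noteq> 0"
      and z: "z \<in> {l x, deriv_along A Z l x, deriv_along A Z (deriv_along A Z l) x}"
    have W1: "open W1" "smooth_map A W1 l" "smooth_vector_field A W1 Z"
      using 1 Z unfolding local_section_def local_field_def by auto
    let ?V = "U \<inter> W1"
    have V: "open ?V" "x \<in> ?V" "?V \<subseteq> W" using U W1 1 by auto
    have cf: "curvature_frame A f s1 s2 T1 T2 ?V \<sigma>1 \<sigma>2 X Y" by (rule P.frame_restrict[OF V(1,3)])
    have "osculating_frame A f s1 s2 T1 T2 (?V \<inter> W1) \<sigma>1 \<sigma>2 X Y L1 l"
      by (rule osculating_frameI[OF cf complex1 1(2,3)])
    then have o: "osculating_frame A f s1 s2 T1 T2 ?V \<sigma>1 \<sigma>2 X Y L1 l" by (simp add: Int_assoc)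
    have "osculating_frame A f s1 s2 T1 T2 (?V \<inter> W) \<sigma>1 \<sigma>2 X Y L1 l1"
      by (rule osculating_frameI[OF cf complex1 P.unit_section])
    then have o1: "osculating_frame A f s1 s2 T1 T2 ?V \<sigma>1 \<sigma>2 X Y L1 l1" using V(3) by (simp add: Int_absorb2)
    have par: "\<exists>c. c \<noteq> 0 \<and> deriv_along A Z l y = c *\<^sub>R deriv_along A Y l1 y" if y: "y \<in> ?V" for y
    proof -
      obtain \<epsilon> where \<epsilon>: "\<epsilon> * \<epsilon> = 1" "\<And>v. dif A l y v = \<epsilon> *\<^sub>R dif A l1 y v"
        using osculating_complex_unique[OF o1 o y] by blast
      have yW: "y \<in> W" using y V by auto
      obtain k where k: "Z y = k *\<^sub>R Y y"
        using Z(1) y P.spans(4)[OF yW] unfolding local_field_def by (metis IntD2 span_singletonE)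
      have "k \<noteq> 0" "\<epsilon> \<noteq> 0" using k Z(2)[of y] y \<epsilon>(1) by auto
      then show ?thesis
        by (intro exI[of _ "\<epsilon> * k"]) (simp add: deriv_along_def \<epsilon>(2) k dif_scale_vec[OF P.smooth_l yW])
    qed
    have sl: "smooth_map A ?V l" by (rule smooth_map_subset[OF W1(2)]) auto
    have sZ: "smooth_map A ?V (deriv_along A Z l)"
      by (rule smooth_map_deriv_along[OF V(1) smooth_vector_field_subset[OF W1(3)] sl]) auto
    have nZ: "form (deriv_along A Z l y) (deriv_along A Z l y) = 0" if "y \<in> ?V" for y
      using par[OF that] null[of y] that by (auto simp: form_simps)
    have "form (l x) (deriv_along A Z l x) = 0"
      unfolding deriv_along_def by (rule form_square_dif[OF V(1,2) sl]) (use 1 in auto)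
    moreover have "form (deriv_along A Z l x) (deriv_along A Z (deriv_along A Z l) x) = 0"
      unfolding deriv_along_def[of A Z "deriv_along A Z l"] by (rule form_square_dif[OF V(1,2) sZ nZ])
    ultimately have "form z (deriv_along A Z l x) = 0" using z nZ[OF V(2)] by (auto simp: form_commute)
    then show "form z (deriv_along A Y l1 x) = 0" using par[OF V(2)] by (auto simp: form_simps)
  qed
  then have "deriv_along A Y l1 x = 0"
    using lorentz_nondegenerate[OF signature1 l1_mem(2)[OF xW]] by (simp add: form_commute)
  then show False using P.\<sigma>1_dY_l[OF xW] by (simp add: form_simps)
qed

lemma open_not_null:
  assumes "open U" "U \<subseteq> W"
  shows "open {y \<in> U. form (deriv_along A Y l1 y) (deriv_along A Y l1 y) \<noteq> 0}"
proof -
  have "smooth_map A U (\<lambda>y. form (deriv_along A Y l1 y) (deriv_along A Y l1 y))"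
    by (rule smooth_map_subset[OF _ assms(2)])
      (intro smooth_map_form smooth_map_deriv_along P.W P.smooth P.smooth_l)
  from smooth_map_continuous[OF assms(1) this]
  have "open (U \<inter> (\<lambda>y. form (deriv_along A Y l1 y) (deriv_along A Y l1 y)) -` (- {0}))"
    by (rule continuous_open_preimage[OF _ assms(1)]) auto
  also have "U \<inter> (\<lambda>y. form (deriv_along A Y l1 y) (deriv_along A Y l1 y)) -` (- {0}) =
     {y \<in> U. form (deriv_along A Y l1 y) (deriv_along A Y l1 y) \<noteq> 0}" by auto
  finally show ?thesis .
qed

end

context joachimsthal
begin

lemma open_non_lightlike: "open (non_lightlike_set A f)"
proof (rule topological_space_class.openI)
  fix x assume x: "x \<in> non_lightlike_set A f"
  obtain W \<sigma>1 \<sigma>2 X Y l1 l2 where xW: "x \<in> W"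
    and jf: "joachimsthal_frame A f s1 s2 T1 T2 L1 L2 H1 H2 W \<sigma>1 \<sigma>2 X Y l1 l2" using frame_exists .
  interpret joachimsthal_frame A f s1 s2 T1 T2 L1 L2 H1 H2 W \<sigma>1 \<sigma>2 X Y l1 l2 by fact
  interpret sw: joachimsthal_frame A f s2 s1 T2 T1 L2 L1 H2 H1 W \<sigma>2 \<sigma>1 Y X l2 l1 by (rule jframe_swap)
  let ?U = "{y \<in> {y \<in> W. form (deriv_along A Y l1 y) (deriv_along A Y l1 y) \<noteq> 0}.
    form (deriv_along A X l2 y) (deriv_along A X l2 y) \<noteq> 0}"
  have "open ?U" by (intro sw.open_not_null open_not_null P.W) auto
  moreover have "x \<in> ?U" using x xW non_lightlike_iff by auto
  moreover have "?U \<subseteq> non_lightlike_set A f" using non_lightlike_iff by auto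
  ultimately show "\<exists>T. open T \<and> x \<in> T \<and> T \<subseteq> non_lightlike_set A f" by blast
qed

lemma dense_non_lightlike: "closure (non_lightlike_set A f) = UNIV"
proof -
  have "\<exists>y\<in>non_lightlike_set A f. y \<in> O'" if O: "open O'" "x \<in> O'" for x O'
  proof -
    obtain W \<sigma>1 \<sigma>2 X Y l1 l2 where xW: "x \<in> W"
      and jf: "joachimsthal_frame A f s1 s2 T1 T2 L1 L2 H1 H2 W \<sigma>1 \<sigma>2 X Y l1 l2" using frame_exists .
    interpret joachimsthal_frame A f s1 s2 T1 T2 L1 L2 H1 H2 W \<sigma>1 \<sigma>2 X Y l1 l2 by fact
    interpret sw: joachimsthal_frame A f s2 s1 T2 T1 L2 L1 H2 H1 W \<sigma>2 \<sigma>1 Y X l2 l1 by (rule jframe_swap)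
    let ?U = "{y \<in> W \<inter> O'. form (deriv_along A Y l1 y) (deriv_along A Y l1 y) \<noteq> 0}"
    have oWO: "open (W \<inter> O')" using P.W O by auto
    have U: "open ?U" by (rule open_not_null[OF oWO]) auto
    obtain y where y: "y \<in> ?U" using dY_l1_not_null[OF oWO, of x] xW O by auto
    obtain z where "z \<in> ?U" "form (deriv_along A X l2 z) (deriv_along A X l2 z) \<noteq> 0"
      using sw.dY_l1_not_null[OF U _ y] by auto
    then show ?thesis using non_lightlike_iff[of z] by auto
  qed
  then show ?thesis unfolding closure_def islimpt_def by blast
qed

end

section \<open>Pairs of null curves in a Lorentzian 3-space\<close>

lemma linear_forms_common_kernel:
  fixes \<phi> \<psi> :: "real^2 \<Rightarrow> real"
  assumes l: "linear \<phi>" "linear \<psi>" and t: "t \<noteq> 0" "\<phi> t = 0" "\<psi> t = 0"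
  shows "\<phi> v * \<psi> w = \<phi> w * \<psi> v"
proof -
  have "dim (span {t}) \<noteq> dim (UNIV :: (real^2) set)" using t by simp
  then obtain u where u: "u \<notin> span {t}" by (metis UNIV_eq_I)
  then have "dim (span {u, t}) = 2" using t by (simp add: dim_insert)
  then have "span {u, t} = UNIV" by (simp add: dim_eq_full[symmetric])
  then obtain a b c d where v: "v = a *\<^sub>R u + b *\<^sub>R t" and w: "w = c *\<^sub>R u + d *\<^sub>R t"
    using span_pairE[of v u t] span_pairE[of w u t] by (metis UNIV_I)
  show ?thesis
    using t by (simp add: v w linear_add[OF l(1)] linear_add[OF l(2)] linear_scale[OF l(1)] linear_scale[OF l(2)])
qed

lemma wedge_self [simp]: "wedge a a = 0"
  by (rule blinfun_eqI) (simp add: wedge_apply)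

context surface
begin

lemma subbundle1I:
  assumes "smooth_map A UNIV \<sigma>" "\<And>x. \<sigma> x \<noteq> 0"
  shows "subbundle A 1 (\<lambda>x. span {\<sigma> x})"
  unfolding subbundle_def
proof (intro allI conjI)
  fix x
  show "\<exists>W \<sigma>'. open W \<and> x \<in> W \<and> (\<forall>i<1. smooth_map A W (\<sigma>' i)) \<and>
      (\<forall>y\<in>W. span {\<sigma> y} = span ((\<lambda>i. \<sigma>' i y) ` {..<1::nat}))"
    by (rule exI[of _ UNIV], rule exI[of _ "\<lambda>_. \<sigma>"]) (use assms in \<open>simp add: lessThan_Suc\<close>)
qed (use assms in auto)

lemma subbundle2I:
  assumes "smooth_map A UNIV \<sigma>" "smooth_map A UNIV \<tau>" "\<And>x. \<tau> x \<noteq> 0" "\<And>x. \<sigma> x \<notin> span {\<tau> x}"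
  shows "subbundle A 2 (\<lambda>x. span {\<sigma> x, \<tau> x})"
  unfolding subbundle_def
proof (intro allI conjI)
  fix x
  show "dim (span {\<sigma> x, \<tau> x}) = 2" using assms by (simp add: dim_insert)
  have "(\<lambda>i. (if i = 0 then \<sigma> else \<tau>) y) ` {..<2::nat} = {\<sigma> y, \<tau> y}" for y
    by (auto simp: numeral_2_eq_2 lessThan_Suc)
  then show "\<exists>W \<sigma>'. open W \<and> x \<in> W \<and> (\<forall>i<2. smooth_map A W (\<sigma>' i)) \<and>
      (\<forall>y\<in>W. span {\<sigma> y, \<tau> y} = span ((\<lambda>i. \<sigma>' i y) ` {..<2::nat}))"
    by (intro exI[of _ UNIV] exI[of _ "\<lambda>i. if i = 0 then \<sigma> else \<tau>"]) (use assms in auto)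
qed auto

end

text \<open>Two null sections \<open>n\<^sup>+\<close>, \<open>n\<^sup>-\<close> of a constant Lorentzian 3-space \<open>H\<close> such that the orthogonal complement
  of their span in \<open>H\<close>, locally spanned by a unit section \<open>l\<close>, is constant along \<open>T\<close>.\<close>

locale null_pair = surface A
  for A :: "'a::{t2_space, second_countable_topology} chart set" +
  fixes T :: "'a \<Rightarrow> (real^2) set" and H :: "r42 set" and np nm :: "'a \<Rightarrow> r42" and \<kappa> :: real
  assumes line: "line_field A T" and signature: "has_signature H 2 1"
    and smooth: "smooth_map A UNIV np" "smooth_map A UNIV nm" and mem: "\<And>x. np x \<in> H" "\<And>x. nm x \<in> H"
    and forms: "\<And>x. form (np x) (np x) = 0" "\<And>x. form (nm x) (nm x) = 0" "\<And>x. form (np x) (nm x) = \<kappa>" "\<kappa> \<noteq> 0"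
    and normal_exists: "\<And>x. \<exists>W l. x \<in> W \<and> open W \<and> smooth_map A W l \<and> (\<forall>y\<in>W. l y \<in> H \<and> form (l y) (l y) = 1 \<and>
      form (l y) (np y) = 0 \<and> form (l y) (nm y) = 0 \<and> (\<forall>v\<in>T y. dif A l y v = 0))"
begin

text \<open>\<open>l\<close> is a unit section over \<open>W\<close> of the complement of \<open>n\<^sup>+\<close> and \<open>n\<^sup>-\<close> in \<open>H\<close>, constant along \<open>T\<close>. It is determined up
  to sign, and only used locally.\<close>

definition normal :: "'a set \<Rightarrow> ('a \<Rightarrow> r42) \<Rightarrow> bool" where
  "normal W l \<longleftrightarrow> open W \<and> smooth_map A W l \<and> (\<forall>y\<in>W. l y \<in> H \<and> form (l y) (l y) = 1 \<and>
      form (l y) (np y) = 0 \<and> form (l y) (nm y) = 0 \<and> (\<forall>v\<in>T y. dif A l y v = 0))"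

lemma normal_at: obtains W l where "x \<in> W" "normal W l"
  using normal_exists[of x] unfolding normal_def by blast

lemma forms': "form (nm x) (np x) = \<kappa>"
  using forms(3) by (simp add: form_commute)

lemma subspace_H: "subspace H"
  using signature by (rule lorentz_subspace)

lemma dif_mem: "dif A np x v \<in> H" "dif A nm x v \<in> H"
  using dif_in_subspace[OF subspace_H open_UNIV UNIV_I smooth(1)] dif_in_subspace[OF subspace_H open_UNIV UNIV_I smooth(2)] mem
  by blast+

lemma dif_forms: "form (np x) (dif A np x v) = 0" "form (nm x) (dif A nm x v) = 0"
  "form (np x) (dif A nm x v) = - form (nm x) (dif A np x v)"
  using form_square_dif[OF open_UNIV UNIV_I smooth(1) forms(1)] form_square_dif[OF open_UNIV UNIV_I smooth(2) forms(2)]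
    form_const_dif[OF open_UNIV UNIV_I smooth forms(3), of x v] by (simp_all add: form_commute)

lemma expand:
  assumes l: "normal W l" "x \<in> W" and w: "w \<in> H"
  shows "w = form w (l x) *\<^sub>R l x + (form w (nm x) / \<kappa>) *\<^sub>R np x + (form w (np x) / \<kappa>) *\<^sub>R nm x"
proof -
  have lx: "l x \<in> H" "form (l x) (l x) = 1" "form (l x) (np x) = 0" "form (l x) (nm x) = 0"
    "form (np x) (l x) = 0" "form (nm x) (l x) = 0"
    using l unfolding normal_def by (auto simp: form_commute)
  note F = forms forms' lx
  define z where "z = w - (form w (l x) *\<^sub>R l x + (form w (nm x) / \<kappa>) *\<^sub>R np x + (form w (np x) / \<kappa>) *\<^sub>R nm x)"
  have zH: "z \<in> H" unfolding z_def
    using w mem lx subspace_H by (simp add: subspace_add subspace_diff subspace_scale)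
  have z: "form z (l x) = 0" "form z (np x) = 0" "form z (nm x) = 0"
    using F by (simp_all add: z_def form_simps)
  have "span {l x, np x + nm x, np x - nm x} = H"
    by (rule orthogonal_triple_span[OF subspace_H lorentz_dim[OF signature]])
      (use F mem subspace_H in \<open>simp_all add: subspace_add subspace_diff form_simps\<close>)
  moreover have "form z u = 0" if "u \<in> {l x, np x + nm x, np x - nm x}" for u
    using that z by (auto simp: form_simps)
  ultimately have "form z u = 0" if "u \<in> H" for u
    using form_span_zero'[of u "{l x, np x + nm x, np x - nm x}" z] that by blast
  then have "z = 0" using lorentz_nondegenerate[OF signature zH] by blast
  then show ?thesis by (simp add: z_def)
qed

text \<open>\<open>\<omega>\<close> is the component of \<open>d n\<^sup>-\<close> orthogonal to \<open>n\<^sup>+\<close> and \<open>n\<^sup>-\<close>. The factor in the 1-form \<open>\<eta>\<close> is chosen such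
  that \<open>\<eta> n\<^sup>- = - \<omega>\<close>, so that \<open>n\<^sup>-\<close> spans a line that is parallel for \<open>d + \<eta>\<close>.\<close>

definition \<omega> :: "'a \<Rightarrow> real^2 \<Rightarrow> r42" where
  "\<omega> x v = dif A nm x v - (form (dif A nm x v) (np x) / \<kappa>) *\<^sub>R nm x"

definition \<eta> :: "'a \<Rightarrow> real^2 \<Rightarrow> r42 \<Rightarrow>\<^sub>L r42" where
  "\<eta> x v = (- 1 / \<kappa>) *\<^sub>R wedge (np x) (\<omega> x v)"

lemma \<omega>_mem: "\<omega> x v \<in> H"
  unfolding \<omega>_def using dif_mem mem subspace_H by (simp add: subspace_diff subspace_scale)

lemma \<omega>_forms: "form (\<omega> x v) (np x) = 0" "form (\<omega> x v) (nm x) = 0"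
  using forms forms' dif_forms(2)[of x v]
  by (simp_all add: \<omega>_def form_simps form_commute[of "dif A nm x v" "nm x"])

lemma dif_nm: "dif A nm x v = \<omega> x v + (form (dif A nm x v) (np x) / \<kappa>) *\<^sub>R nm x"
  by (simp add: \<omega>_def)

context
  fixes W l x
  assumes l: "normal W l" and x: "x \<in> W"
begin

lemma normal_smooth: "open W" "smooth_map A W l"
  using l unfolding normal_def by auto

lemma normal_forms: "l x \<in> H" "form (l x) (l x) = 1" "form (l x) (np x) = 0" "form (l x) (nm x) = 0"
    "form (np x) (l x) = 0" "form (nm x) (l x) = 0" "v \<in> T x \<Longrightarrow> dif A l x v = 0"
  using l x unfolding normal_def by (auto simp: form_commute)

lemma normal_dif: "dif A l x v \<in> H" "form (l x) (dif A l x v) = 0"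
  "form (np x) (dif A l x v) = - form (l x) (dif A np x v)" "form (nm x) (dif A l x v) = - form (l x) (dif A nm x v)"
proof -
  have "smooth_map A W np" "smooth_map A W nm" using smooth smooth_map_subset by blast+
  note s = this normal_smooth
  have *: "\<And>y. y \<in> W \<Longrightarrow> l y \<in> H \<and> form (l y) (l y) = 1 \<and> form (np y) (l y) = 0 \<and> form (nm y) (l y) = 0"
    using l unfolding normal_def by (auto simp: form_commute)
  show "dif A l x v \<in> H" using dif_in_subspace[OF subspace_H s(3) x s(4)] * by blast
  show "form (l x) (dif A l x v) = 0" using form_square_dif[OF s(3) x s(4)] * by blast
  show "form (np x) (dif A l x v) = - form (l x) (dif A np x v)"
    using form_const_dif[OF s(3) x s(1,4), of 0 v] * by (simp add: form_commute)
  show "form (nm x) (dif A l x v) = - form (l x) (dif A nm x v)"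
    using form_const_dif[OF s(3) x s(2,4), of 0 v] * by (simp add: form_commute)
qed

lemma \<omega>_normal: "\<omega> x v = (- form (nm x) (dif A l x v)) *\<^sub>R l x"
proof -
  have "\<omega> x v = form (\<omega> x v) (l x) *\<^sub>R l x" using expand[OF l x \<omega>_mem[of x v]] \<omega>_forms by simp
  also have "form (\<omega> x v) (l x) = - form (nm x) (dif A l x v)"
    using normal_forms normal_dif(4) by (simp add: \<omega>_def form_simps form_commute)
  finally show ?thesis .
qed

lemma \<eta>_normal: "\<eta> x v = (form (nm x) (dif A l x v) / \<kappa>) *\<^sub>R wedge (np x) (l x)"
  unfolding \<eta>_def \<omega>_normal by (simp add: wedge.scaleR_right wedge.minus_right)

lemma dif_np_normal: "dif A np x v = form (dif A np x v) (l x) *\<^sub>R l x + (form (dif A np x v) (nm x) / \<kappa>) *\<^sub>R np x"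
  using expand[OF l x dif_mem(1)[of x v]] dif_forms(1)[of x v] by (simp add: form_commute)

lemma dif_l_expand: "dif A l x v = (form (nm x) (dif A l x v) / \<kappa>) *\<^sub>R np x + (form (np x) (dif A l x v) / \<kappa>) *\<^sub>R nm x"
  using expand[OF l x normal_dif(1), of v] normal_dif(2) by (simp add: form_commute)

text \<open>The null line spanned by \<open>n\<^sup>+\<close> is stationary only in directions in which \<open>(dl, dl)\<close> vanishes.\<close>

lemma form_\<omega>_dif_np: "form (\<omega> x v) (dif A np x v) = \<kappa> / 2 * form (dif A l x v) (dif A l x v)"
proof -
  have "form (\<omega> x v) (dif A np x v) = form (nm x) (dif A l x v) * form (np x) (dif A l x v)"
    using normal_dif(3) by (simp add: \<omega>_normal form_simps)
  moreover have "form (dif A l x v) (dif A l x v) =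
      2 / \<kappa> * (form (nm x) (dif A l x v) * form (np x) (dif A l x v))"
    by (subst (1) dif_l_expand) (simp add: form_simps field_simps forms)
  ultimately show ?thesis using forms by simp
qed

end

lemma linear_\<omega>: "linear (\<omega> x)"
proof (rule linearI)
  note l = linear_dif[OF smooth(2) UNIV_I, of x]
  show "\<omega> x (v + w) = \<omega> x v + \<omega> x w" for v w
    by (simp add: \<omega>_def linear_add[OF l] form_simps add_divide_distrib algebra_simps)
  show "\<omega> x (r *\<^sub>R v) = r *\<^sub>R \<omega> x v" for r v
    by (simp add: \<omega>_def linear_scale[OF l] form_simps algebra_simps)
qed

lemma linear_\<eta>: "linear (\<eta> x)"
  by (rule linearI) (simp_all add: \<eta>_def linear_add[OF linear_\<omega>] linear_scale[OF linear_\<omega>] wedge.add_right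
      wedge.scaleR_right algebra_simps)

lemma \<omega>_T: "v \<in> T x \<Longrightarrow> \<omega> x v = 0"
  by (rule normal_at[of x]) (simp add: \<omega>_normal normal_forms form_simps)

lemma dif_np_T: "v \<in> T x \<Longrightarrow> dif A np x v \<in> span {np x}"
proof (rule normal_at[of x])
  fix W l assume v: "v \<in> T x" and l: "x \<in> W" "normal W l"
  have "form (l x) (dif A np x v) = 0" using normal_dif(3)[OF l(2,1), of v] normal_forms(7)[OF l(2,1) v] by (simp add: form_simps)
  then have "dif A np x v = (form (dif A np x v) (nm x) / \<kappa>) *\<^sub>R np x"
    using dif_np_normal[OF l(2,1), of v] by (simp add: form_commute)
  then show "dif A np x v \<in> span {np x}" by (metis singletonI span_base span_scale)
qed

lemma dif_np_stationary:
  assumes "dif A np x v \<in> span {np x}"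
  shows "form (\<omega> x v) (dif A np x v) = 0"
  using assms \<omega>_forms(1)[of x v] by (auto elim!: span_singletonE simp: form_simps)

lemma smooth_one_form_\<eta>: "smooth_one_form A \<eta>"
  unfolding smooth_one_form_def
proof (intro conjI allI impI linear_\<eta>, elim conjE)
  fix W X assume W: "open W" "smooth_vector_field A W X"
  have s: "smooth_map A W np" "smooth_map A W nm" using smooth smooth_map_subset by blast+
  have "smooth_map A W (\<lambda>x. (- 1 / \<kappa>) *\<^sub>R wedge (np x)
      (deriv_along A X nm x - (form (deriv_along A X nm x) (np x) * (1 / \<kappa>)) *\<^sub>R nm x))"
    by (intro smooth_map_scaleR smooth_map_const smooth_map_bilinear[OF _ bounded_bilinear_wedge] smooth_map_diff
        smooth_map_mult smooth_map_form smooth_map_deriv_along W s)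
  then show "smooth_map A W (\<lambda>x. \<eta> x (X x))" by (simp add: \<eta>_def \<omega>_def deriv_along_def)
qed

text \<open>Closedness: locally \<open>\<eta> = (n\<^sup>-, dl) n\<^sup>+ \<and> l / \<kappa>\<close>. Its exterior derivative is a multiple of
  \<open>(n\<^sup>-, dl) \<and> (n\<^sup>+, dl)\<close>, as the second derivatives of \<open>l\<close> cancel, and this 2-form on the surface vanishes because
  \<open>l\<close> is constant along \<open>T\<close>.\<close>

lemma ext_deriv_\<eta>: "ext_deriv A \<eta> x v w = 0"
proof -
  define c where "c = chart_at A x"
  have c: "c \<in> A" "x \<in> fst c" using chart_at c_def by auto
  obtain W l where x: "x \<in> W" and l: "normal W l" using normal_at .
  define U where "U = W \<inter> fst c"
  have U: "open U" "x \<in> U" using normal_smooth[OF l x] chart_homeomorphism(1)[OF c(1)] c x by (auto simp: U_def)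
  have sm: "smooth_map A U np" "smooth_map A U nm" using smooth smooth_map_subset by blast+
  have sl: "smooth_map A U l" by (rule smooth_map_subset[OF normal_smooth(2)[OF l x]]) (auto simp: U_def)
  define V where "V u = coord_field A c u" for u
  have V: "smooth_vector_field A U (V u)" for u
    unfolding V_def by (rule smooth_vector_field_subset[OF smooth_vector_field_coord_field[OF c(1)]]) (auto simp: U_def)
  have Vx: "V u x = u" for u by (simp add: V_def c_def)
  have sdl: "smooth_map A U (deriv_along A (V u) l)" for u by (intro smooth_map_deriv_along U V sl)
  let ?h = "\<lambda>u y. form (nm y) (deriv_along A (V u) l y)"
  let ?\<Omega> = "\<lambda>y. wedge (np y) (l y)"
  have sh: "smooth_map A U (?h u)" for u by (intro smooth_map_form U sm sdl)
  have s\<Omega>: "smooth_map A U ?\<Omega>" by (intro smooth_map_bilinear[OF _ bounded_bilinear_wedge] U sm sl)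
  have sh\<Omega>: "smooth_map A U (\<lambda>y. ?h u y *\<^sub>R ?\<Omega> y)" for u by (intro smooth_map_scaleR U sh s\<Omega>)
  have sg: "smooth_map A U (\<lambda>y. (1 / \<kappa>) *\<^sub>R (?h u y *\<^sub>R ?\<Omega> y))" for u
    by (intro smooth_map_scaleR smooth_map_const U sh s\<Omega>)
  have eq: "(1 / \<kappa>) *\<^sub>R (?h u y *\<^sub>R ?\<Omega> y) = \<eta> y (V u y)" if "y \<in> U" for u y
    using \<eta>_normal[OF l, of y "V u y"] that by (simp add: U_def deriv_along_def)
  have d\<eta>: "dif A (\<lambda>y. \<eta> y (V u y)) x v = (1 / \<kappa>) *\<^sub>R (?h u x *\<^sub>R dif A ?\<Omega> x v + dif A (?h u) x v *\<^sub>R ?\<Omega> x)" for u v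
  proof -
    have "dif A (\<lambda>y. \<eta> y (V u y)) x v = dif A (\<lambda>y. (1 / \<kappa>) *\<^sub>R (?h u y *\<^sub>R ?\<Omega> y)) x v"
      using dif_cong[OF U sg eq] by simp
    also have "\<dots> = (1 / \<kappa>) *\<^sub>R dif A (\<lambda>y. ?h u y *\<^sub>R ?\<Omega> y) x v"
      by (rule dif_linear[OF bounded_linear_scaleR_right sh\<Omega> U(2)])
    finally show ?thesis by (simp add: dif_scaleR[OF sh s\<Omega> U(2)])
  qed
  define P where "P v = form (np x) (dif A l x v)" for v
  define M where "M v = form (nm x) (dif A l x v)" for v
  define C where "C v = form (dif A np x v) (nm x) / \<kappa>" for v
  have hx: "?h u x = M u" for u by (simp add: deriv_along_def Vx M_def)
  have dl: "dif A l x v = (M v / \<kappa>) *\<^sub>R np x + (P v / \<kappa>) *\<^sub>R nm x" for v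
    unfolding M_def P_def by (rule dif_l_expand[OF l x])
  have dnp: "dif A np x v = form (dif A np x v) (l x) *\<^sub>R l x + C v *\<^sub>R np x" for v
    unfolding C_def by (rule dif_np_normal[OF l x])
  have d\<Omega>: "dif A ?\<Omega> x v = (P v / \<kappa>) *\<^sub>R wedge (np x) (nm x) + C v *\<^sub>R ?\<Omega> x" for v
  proof -
    have "dif A ?\<Omega> x v = wedge (np x) (dif A l x v) + wedge (dif A np x v) (l x)"
      by (rule dif_bilinear[OF bounded_bilinear_wedge sm(1) sl U(2)])
    also have "wedge (np x) (dif A l x v) = (P v / \<kappa>) *\<^sub>R wedge (np x) (nm x)"
      unfolding dl[of v] by (simp add: wedge.add_right wedge.scaleR_right)
    also have "wedge (dif A np x v) (l x) = C v *\<^sub>R ?\<Omega> x"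
      using arg_cong[OF dnp[of v], of "\<lambda>u. wedge u (l x)"] by (simp add: wedge.add_left wedge.scaleR_left)
    finally show ?thesis .
  qed
  define S where "S u v = form (nm x) (dif A (deriv_along A (V u) l) x v)" for u v
  have S: "S u v = S v u" for u v
    unfolding S_def deriv_along_def[abs_def] V_def c_def
    using coord_fields_commute[OF normal_smooth(2,1)[OF l x] x, of u v] by simp
  have dh: "dif A (?h u) x v = S u v - C v * M u" for u v
  proof -
    have "form (np x) (dif A nm x v) = - (\<kappa> * C v)"
      using dif_forms(3)[of x v] forms(4) by (simp add: C_def form_commute)
    then have "form (dif A nm x v) (dif A l x u) = - (C v * M u)"
      using dif_forms(2)[of x v] forms(4) by (simp add: dl[of u] form_simps form_commute[of "dif A nm x v"])
    then show ?thesis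
      using dif_form[OF sm(2) sdl U(2), of u v] by (simp add: deriv_along_def[of A "V u" l] Vx S_def)
  qed
  have dd: "dif A (\<lambda>y. \<eta> y (V u y)) x v = (1 / \<kappa>) *\<^sub>R ((M u * P v / \<kappa>) *\<^sub>R wedge (np x) (nm x) + S u v *\<^sub>R ?\<Omega> x)" for u v
    unfolding d\<eta> d\<Omega> dh hx by (simp add: algebra_simps)
  obtain W' X where "x \<in> W'" "\<And>y. y \<in> W' \<Longrightarrow> X y \<in> T y \<and> X y \<noteq> 0" using line_field_section[OF line] by metis
  then have t: "X x \<noteq> 0" "dif A l x (X x) = 0" using normal_forms(7)[OF l x] by blast+
  have lin: "linear P" "linear M" unfolding P_def M_def
    by (rule linearI; simp add: form_simps dif_add_vec[OF sl U(2)] dif_scale_vec[OF sl U(2)])+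
  have "P v * M w = P w * M v"
    by (rule linear_forms_common_kernel[OF lin t(1)]) (simp_all add: P_def M_def t form_simps)
  then have "M w * P v = M v * P w" by (simp add: mult.commute)
  then show ?thesis
    unfolding ext_deriv_def c_def[symmetric] V_def[symmetric] dd using S[of v w] by simp
qed

lemma \<eta>_commute: "\<eta> x v o\<^sub>L \<eta> x w = \<eta> x w o\<^sub>L \<eta> x v"
proof (rule normal_at[of x])
  fix W l assume l: "x \<in> W" "normal W l"
  show ?thesis unfolding \<eta>_normal[OF l(2,1)]
    by (rule blinfun_eqI) (simp add: blinfun.scaleR_left blinfun.scaleR_right mult.commute)
qed

lemma \<eta>_apply: "blinfun_apply (\<eta> x v) c = (- form (np x) c / \<kappa>) *\<^sub>R \<omega> x v + (form (\<omega> x v) c / \<kappa>) *\<^sub>R np x"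
  unfolding \<eta>_def blinfun.scaleR_left wedge_apply by (simp add: algebra_simps)

lemma \<eta>_np: "blinfun_apply (\<eta> x v) (np x) = 0"
  by (simp add: \<eta>_apply forms \<omega>_forms)

lemma \<eta>_nm: "blinfun_apply (\<eta> x v) (nm x) = - \<omega> x v"
  by (simp add: \<eta>_apply forms \<omega>_forms)

lemma \<eta>_dif_np: "blinfun_apply (\<eta> x v) (dif A np x w) = (form (\<omega> x v) (dif A np x w) / \<kappa>) *\<^sub>R np x"
  by (simp add: \<eta>_apply dif_forms)

lemma \<eta>_orthogonal: "(\<And>a. a \<in> H \<Longrightarrow> form a c = 0) \<Longrightarrow> blinfun_apply (\<eta> x v) c = 0"
  by (simp add: \<eta>_apply mem \<omega>_mem)

lemma np_nonzero: "np x \<noteq> 0"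
  using forms(3)[of x] forms(4) by (auto simp: form_simps)

text \<open>Along a leaf, \<open>n\<^sup>+\<close> divided by its inner product with a timelike vector is constant.\<close>

lemma constant_along_np: "constant_along A T (\<lambda>x. span {np x})"
  unfolding constant_along_def
proof (intro allI ballI)
  fix x y assume "y \<in> leaf A T x"
  then obtain \<gamma> where \<gamma>: "y = \<gamma> 1" "path \<gamma>" "\<gamma> 0 = x"
    "\<And>t. t \<in> {0..1} \<Longrightarrow> \<exists>v\<in>T (\<gamma> t). ((snd (chart_at A (\<gamma> t)) \<circ> \<gamma>) has_vector_derivative v) (at t within {0..1})"
    unfolding leaf_def by blast
  obtain t where t: "t \<in> H" "form t t = -1" using lorentz_timelike[OF signature] .
  define h where "h x = form (np x) t" for x
  have h: "h x \<noteq> 0" for x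
    unfolding h_def using lorentz_null_timelike[OF signature t(1) _ mem(1) np_nonzero forms(1)] t by simp
  have sh: "smooth_map A UNIV (\<lambda>x. inverse (h x))"
    using h unfolding h_def[abs_def] by (intro smooth_map_inverse smooth_map_form smooth smooth_map_const) auto
  define N where "N x = inverse (h x) *\<^sub>R np x" for x
  have sN: "smooth_map A UNIV N" unfolding N_def[abs_def] by (intro smooth_map_scaleR open_UNIV sh smooth)
  have dN: "dif A N z v = 0" if v: "v \<in> T z" for z v
  proof -
    obtain k where k: "dif A np z v = k *\<^sub>R np z" using dif_np_T[OF v] by (auto elim: span_singletonE)
    have "dif A N z v = inverse (h z) *\<^sub>R dif A np z v + dif A (\<lambda>x. inverse (h x)) z v *\<^sub>R np z"
      unfolding N_def[abs_def] by (rule dif_scaleR[OF sh smooth(1) UNIV_I])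
    then have r: "dif A N z v = (inverse (h z) * k + dif A (\<lambda>x. inverse (h x)) z v) *\<^sub>R np z"
      by (simp add: k algebra_simps)
    have "form (N y) t = 1" for y using h[of y] by (simp add: N_def form_simps h_def[symmetric])
    from form_const_dif[OF open_UNIV UNIV_I sN smooth_map_const this, of z v]
    have "form (dif A N z v) t = 0" by (simp add: form_simps)
    then have "inverse (h z) * k + dif A (\<lambda>x. inverse (h x)) z v = 0"
      using h[of z] by (simp add: r form_simps h_def)
    then show ?thesis using r by simp
  qed
  have "((\<lambda>u. N (\<gamma> u)) has_vector_derivative 0) (at u within {0..1})" if u: "u \<in> {0..1}" for u
  proof -
    obtain v where v: "v \<in> T (\<gamma> u)" "((snd (chart_at A (\<gamma> u)) \<circ> \<gamma>) has_vector_derivative v) (at u within {0..1})"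
      using \<gamma>(4)[OF u] by blast
    show ?thesis using dif_along_curve[OF \<gamma>(2) u v(2) sN UNIV_I] dN[OF v(1)] by simp
  qed
  then obtain k where k: "\<And>u. u \<in> {0..1} \<Longrightarrow> N (\<gamma> u) = k"
    using has_vector_derivative_zero_constant[of "{0..1}" "\<lambda>u. N (\<gamma> u)"] by (metis convex_real_interval(5))
  have "N y = N x" using k[of 0] k[of 1] \<gamma>(1,3) by simp
  moreover have "span {N z} = span {np z}" for z
    using span_image_scale[of "{np z}" "\<lambda>_. inverse (h z)"] h[of z] by (simp add: N_def)
  ultimately show "span {np y} = span {np x}" by metis
qed

end

section \<open>Darboux pairs from two null pairs\<close>

lemma (in surface) dif_rank1:
  fixes \<sigma> :: "'a \<Rightarrow> 'b::euclidean_space"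
  assumes W: "open W" "x \<in> W" and s: "smooth_map A W \<sigma>" "smooth_map A W \<tau>"
    and nz: "\<And>y. y \<in> W \<Longrightarrow> \<sigma> y \<noteq> 0" and sp: "\<And>y. y \<in> W \<Longrightarrow> \<tau> y \<in> span {\<sigma> y}"
  obtains c c' where "\<tau> x = c *\<^sub>R \<sigma> x" "dif A \<tau> x v = c *\<^sub>R dif A \<sigma> x v + c' *\<^sub>R \<sigma> x"
proof -
  obtain k where k: "smooth_map A W k" "\<And>y. y \<in> W \<Longrightarrow> \<tau> y = k y *\<^sub>R \<sigma> y"
    using rank1_coefficient[OF W(1) s nz sp] by metis
  have "dif A \<tau> x v = dif A (\<lambda>y. k y *\<^sub>R \<sigma> y) x v"
    using dif_cong[OF W s(2) k(2)] by simp
  then show ?thesis using that[of "k x" "dif A k x v"] k(2)[OF W(2)] dif_scaleR[OF k(1) s(1) W(2)] by simp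
qed

lemma (in null_pair) dif_section_T:
  assumes "local_section A W (\<lambda>x. span {np x}) \<sigma>" "x \<in> W" "v \<in> T x"
  shows "dif A \<sigma> x v \<in> span {np x}"
proof -
  have W: "open W" "smooth_map A W \<sigma>" "\<And>y. y \<in> W \<Longrightarrow> \<sigma> y \<in> span {np y}"
    using assms(1) unfolding local_section_def by auto
  have s: "smooth_map A W np" using smooth smooth_map_subset by blast
  obtain c c' where "dif A \<sigma> x v = c *\<^sub>R dif A np x v + c' *\<^sub>R np x"
    using dif_rank1[OF W(1) assms(2) s W(2) np_nonzero W(3)] by metis
  then show ?thesis using dif_np_T[OF assms(3)] by (simp add: span_add span_scale span_base)
qed

text \<open>The Legendre map \<open>f\<close> spanned by the sums of two null pairs in orthogonal 3-spaces; the relation \<open>contact\<close>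
  is what remains of the orthogonality of \<open>df\<close> and \<open>f\<close>. By the two non-stationarity conditions the null curves
  \<open>n\<^sub>1\<^sup>+\<close> and \<open>n\<^sub>2\<^sup>+\<close> are immersed over \<open>D\<close>. The opposite products \<open>\<kappa>\<close> and \<open>- \<kappa>\<close> make the two sums orthogonal
  to each other.\<close>

locale null_pairs = surface A +
  N1: null_pair A T1 H1 np1 nm1 \<kappa> + N2: null_pair A T2 H2 np2 nm2 "- \<kappa>"
  for A :: "'a::{t2_space, second_countable_topology} chart set" and T1 T2 H1 H2 np1 nm1 np2 nm2 \<kappa> +
  fixes f :: "'a \<Rightarrow> r42 set" and D :: "'a set"
  assumes orthogonal: "\<And>a b. a \<in> H1 \<Longrightarrow> b \<in> H2 \<Longrightarrow> form a b = 0"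
    and directions: "\<And>x v. \<exists>v1\<in>T1 x. \<exists>v2\<in>T2 x. v = v1 + v2"
    and f_eq: "\<And>x. f x = span {np1 x + np2 x, nm1 x + nm2 x}"
    and contact: "\<And>x v. form (dif A nm1 x v) (np1 x) + form (dif A nm2 x v) (np2 x) = 0"
    and not_stationary1: "\<And>x v. x \<in> D \<Longrightarrow> v \<in> T2 x \<Longrightarrow> v \<noteq> 0 \<Longrightarrow> form (N1.\<omega> x v) (dif A np1 x v) \<noteq> 0"
    and not_stationary2: "\<And>x v. x \<in> D \<Longrightarrow> v \<in> T1 x \<Longrightarrow> v \<noteq> 0 \<Longrightarrow> form (N2.\<omega> x v) (dif A np2 x v) \<noteq> 0"
    and nonempty: "D \<noteq> {}"
begin

text \<open>The Dupin cyclide spanned by \<open>n\<^sub>1\<^sup>+\<close>, whose span is constant along \<open>T\<^sub>1\<close>, and \<open>n\<^sub>2\<^sup>+\<close>, whose span is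
  constant along \<open>T\<^sub>2\<close>; and its gauge potential.\<close>

definition cyclide :: "'a \<Rightarrow> r42 set" where "cyclide x = span {np1 x, np2 x}"

definition potential :: "'a \<Rightarrow> real^2 \<Rightarrow> r42 \<Rightarrow>\<^sub>L r42" where "potential x v = N1.\<eta> x v + N2.\<eta> x v"

lemma orthogonal': "b \<in> H2 \<Longrightarrow> a \<in> H1 \<Longrightarrow> form b a = 0"
  using orthogonal by (simp add: form_commute)

lemma cross: "form (np1 x) (np2 y) = 0" "form (np2 y) (np1 x) = 0" "form (np1 x) (nm2 y) = 0" "form (nm2 y) (np1 x) = 0"
  "form (nm1 x) (np2 y) = 0" "form (np2 y) (nm1 x) = 0" "form (nm1 x) (nm2 y) = 0" "form (nm2 y) (nm1 x) = 0"
  using orthogonal orthogonal' N1.mem N2.mem by blast+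

lemma cross_dif: "form (np1 x) (dif A np2 y v) = 0" "form (np2 x) (dif A np1 y v) = 0"
  using orthogonal orthogonal' N1.mem N2.mem N1.dif_mem N2.dif_mem by blast+

lemma independent: "np1 x \<notin> span {np2 x}" "np2 x \<notin> span {np1 x}"
proof -
  show "np1 x \<notin> span {np2 x}"
    using N1.forms(3)[of x] N1.forms(4) cross by (auto elim!: span_singletonE simp: form_simps)
  show "np2 x \<notin> span {np1 x}"
    using N2.forms(3)[of x] N1.forms(4) cross by (auto elim!: span_singletonE simp: form_simps)
qed

lemma subspace_cyclide: "subspace (cyclide x)"
  by (simp add: cyclide_def)

lemma mem_cyclide: "np1 x \<in> cyclide x" "np2 x \<in> cyclide x"
  unfolding cyclide_def by (simp_all add: span_base)

lemma isotropic: "totally_isotropic (cyclide x)"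
  unfolding totally_isotropic_def cyclide_def
  by (auto elim!: span_pairE simp: form_simps cross N1.forms N2.forms)

lemma section_coefficients:
  assumes W: "open W" "x \<in> W" and \<sigma>: "smooth_map A W \<sigma>" "\<And>y. y \<in> W \<Longrightarrow> \<sigma> y \<in> cyclide y"
  obtains \<alpha> \<beta> u where "\<sigma> x = \<alpha> *\<^sub>R np1 x + \<beta> *\<^sub>R np2 x" "u \<in> cyclide x"
    "dif A \<sigma> x v = \<alpha> *\<^sub>R dif A np1 x v + \<beta> *\<^sub>R dif A np2 x v + u"
proof -
  have sm: "smooth_map A W np1" "smooth_map A W np2" using N1.smooth N2.smooth smooth_map_subset by blast+
  obtain \<alpha> \<beta> where ab: "smooth_map A W \<alpha>" "smooth_map A W \<beta>" "\<And>y. y \<in> W \<Longrightarrow> \<sigma> y = \<alpha> y *\<^sub>R np1 y + \<beta> y *\<^sub>R np2 y"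
    using rank2_coefficients[OF W(1) sm \<sigma>(1) N2.np_nonzero independent(1)] \<sigma>(2) unfolding cyclide_def by metis
  have "dif A \<sigma> x v = \<alpha> x *\<^sub>R dif A np1 x v + \<beta> x *\<^sub>R dif A np2 x v + (dif A \<alpha> x v *\<^sub>R np1 x + dif A \<beta> x v *\<^sub>R np2 x)"
    using dif_combination[OF ab(1,2) sm W ab(3), of v] by simp
  moreover have "dif A \<alpha> x v *\<^sub>R np1 x + dif A \<beta> x v *\<^sub>R np2 x \<in> cyclide x"
    unfolding cyclide_def by (rule span_pairI)
  ultimately show ?thesis using that ab(3)[OF W(2)] by blast
qed

lemma dif_cyclide_perp: "dif A np1 x v \<in> perp (cyclide x)" "dif A np2 x v \<in> perp (cyclide x)"
  unfolding perp_def cyclide_def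
  by (auto elim!: span_pairE simp: form_simps N1.dif_forms N2.dif_forms cross_dif)

lemma cyclide_subset_perp: "cyclide x \<subseteq> perp (cyclide x)"
  using isotropic unfolding totally_isotropic_def perp_def by blast

lemma cyclide_inter: "a \<in> H1 \<Longrightarrow> a \<in> cyclide x \<Longrightarrow> a \<in> span {np1 x}" "b \<in> H2 \<Longrightarrow> b \<in> cyclide x \<Longrightarrow> b \<in> span {np2 x}"
proof -
  assume a: "a \<in> H1" "a \<in> cyclide x"
  then obtain \<alpha> \<beta> where ab: "a = \<alpha> *\<^sub>R np1 x + \<beta> *\<^sub>R np2 x" unfolding cyclide_def by (auto elim: span_pairE)
  have "form a (nm2 x) = 0" using a orthogonal N2.mem by blast
  then have "\<beta> = 0" using N2.forms N1.forms(4) cross by (simp add: ab form_simps)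
  then show "a \<in> span {np1 x}" by (simp add: ab span_scale span_base)
next
  assume b: "b \<in> H2" "b \<in> cyclide x"
  then obtain \<alpha> \<beta> where ab: "b = \<alpha> *\<^sub>R np1 x + \<beta> *\<^sub>R np2 x" unfolding cyclide_def by (auto elim: span_pairE)
  have "form b (nm1 x) = 0" using b orthogonal' N1.mem by blast
  then have "\<alpha> = 0" using N1.forms cross by (simp add: ab form_simps)
  then show "b \<in> span {np2 x}" by (simp add: ab span_scale span_base)
qed

lemma immersive_cyclide:
  assumes x: "x \<in> D"
  shows "immersive_at A cyclide x"
  unfolding immersive_at_def
proof (intro allI impI)
  fix v assume "\<forall>W \<sigma>. local_section A W cyclide \<sigma> \<and> x \<in> W \<longrightarrow> dif A \<sigma> x v \<in> cyclide x"
  moreover have "local_section A UNIV cyclide np1" "local_section A UNIV cyclide np2"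
    using N1.smooth N2.smooth mem_cyclide unfolding local_section_def by auto
  ultimately have d: "dif A np1 x v \<in> span {np1 x}" "dif A np2 x v \<in> span {np2 x}"
    using cyclide_inter N1.dif_mem N2.dif_mem by blast+
  obtain v1 v2 where v: "v1 \<in> T1 x" "v2 \<in> T2 x" "v = v1 + v2" using directions by metis
  have "dif A np1 x v2 = dif A np1 x v - dif A np1 x v1" "dif A np2 x v1 = dif A np2 x v - dif A np2 x v2"
    by (simp_all add: v dif_add_vec[OF N1.smooth(1) UNIV_I] dif_add_vec[OF N2.smooth(1) UNIV_I])
  then have "dif A np1 x v2 \<in> span {np1 x}" "dif A np2 x v1 \<in> span {np2 x}"
    using d N1.dif_np_T[OF v(1)] N2.dif_np_T[OF v(2)] by (simp_all add: span_diff)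
  then have "v2 = 0" "v1 = 0"
    using N1.dif_np_stationary N2.dif_np_stationary not_stationary1[OF x v(2)] not_stationary2[OF x v(1)] by blast+
  then show "v = 0" using v by simp
qed

lemma subbundle_cyclide: "subbundle A 2 cyclide"
  unfolding cyclide_def[abs_def]
  by (rule subbundle2I[OF N1.smooth(1) N2.smooth(1) N2.np_nonzero independent(1)])

lemma legendre_cyclide: "legendre_map_on A D cyclide"
  unfolding legendre_map_on_def
proof (intro conjI allI impI ballI, goal_cases)
  case (3 W \<sigma> x v)
  then have W: "open W" "x \<in> W" "smooth_map A W \<sigma>" "\<And>y. y \<in> W \<Longrightarrow> \<sigma> y \<in> cyclide y"
    unfolding local_section_def by auto
  obtain \<alpha> \<beta> u where "u \<in> cyclide x" "dif A \<sigma> x v = \<alpha> *\<^sub>R dif A np1 x v + \<beta> *\<^sub>R dif A np2 x v + u"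
    using section_coefficients[OF W] by metis
  then show ?case
    using dif_cyclide_perp[of x v] cyclide_subset_perp[of x] subspace_perp[of "cyclide x"]
    by (auto simp: subspace_add subspace_scale)
qed (simp_all add: subbundle_cyclide isotropic immersive_cyclide)

lemma curvature_spheres_cyclide:
  "curvature_spheres A cyclide (\<lambda>x. span {np1 x}) (\<lambda>x. span {np2 x}) T1 T2"
proof -
  have 4: "span {np1 x} \<subseteq> cyclide x \<and> span {np2 x} \<subseteq> cyclide x" for x
    unfolding cyclide_def by (simp add: span_mono)
  have 1: "dif A \<sigma> x v \<in> cyclide x"
    if "local_section A W (\<lambda>x. span {np1 x}) \<sigma>" "x \<in> W" "v \<in> T1 x" for W \<sigma> x v
    using N1.dif_section_T[OF that] 4 by blast
  have 2: "dif A \<sigma> x v \<in> cyclide x"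
    if "local_section A W (\<lambda>x. span {np2 x}) \<sigma>" "x \<in> W" "v \<in> T2 x" for W \<sigma> x v
    using N2.dif_section_T[OF that] 4 by blast
  have 3: "span {np1 x} \<inter> span {np2 x} = {0}" for x
  proof -
    have "a = 0" if a: "a \<in> span {np1 x}" "a \<in> span {np2 x}" for a
    proof -
      obtain c where c: "a = c *\<^sub>R np1 x" using a(1) by (rule span_singletonE)
      show ?thesis using a(2) independent(1)[of x] span_scale_cancel[of c "np1 x" "{np2 x}"] c by auto
    qed
    then show ?thesis using span_zero by blast
  qed
  show ?thesis
    unfolding curvature_spheres_def
    by (intro conjI allI impI; (elim conjE)?;
        fact subbundle1I[OF N1.smooth(1) N1.np_nonzero] subbundle1I[OF N2.smooth(1) N2.np_nonzero] N1.line N2.line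
          1 2 3 4[THEN conjunct1] 4[THEN conjunct2])
qed

lemma dupin_cyclide: "dupin_cyclide_on A D cyclide"
  unfolding dupin_cyclide_on_def
  using legendre_cyclide curvature_spheres_cyclide N1.constant_along_np N2.constant_along_np by blast

subsection \<open>The gauge potential\<close>

lemma \<omega>_perp: "N1.\<omega> x v \<in> perp (cyclide x)" "N2.\<omega> x v \<in> perp (cyclide x)"
proof -
  have "form (np2 x) (N1.\<omega> x v) = 0" "form (np1 x) (N2.\<omega> x v) = 0"
    using orthogonal orthogonal' N1.mem N2.mem N1.\<omega>_mem N2.\<omega>_mem by blast+
  then show "N1.\<omega> x v \<in> perp (cyclide x)" "N2.\<omega> x v \<in> perp (cyclide x)"
    unfolding perp_def cyclide_def
    by (auto elim!: span_pairE simp: form_simps N1.\<omega>_forms N2.\<omega>_forms form_commute[of "np1 x" "N1.\<omega> x v"]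
        form_commute[of "np2 x" "N2.\<omega> x v"])
qed

lemma potential_np: "blinfun_apply (potential x v) (np1 x) = 0" "blinfun_apply (potential x v) (np2 x) = 0"
  using N1.\<eta>_orthogonal[OF orthogonal[OF _ N2.mem(1)]] N2.\<eta>_orthogonal[OF orthogonal'[OF _ N1.mem(1)]]
  by (simp_all add: potential_def blinfun.add_left N1.\<eta>_np N2.\<eta>_np)

lemma potential_nm: "blinfun_apply (potential x v) (nm1 x) = - N1.\<omega> x v" "blinfun_apply (potential x v) (nm2 x) = - N2.\<omega> x v"
  using N1.\<eta>_orthogonal[OF orthogonal[OF _ N2.mem(2)]] N2.\<eta>_orthogonal[OF orthogonal'[OF _ N1.mem(2)]]
  by (simp_all add: potential_def blinfun.add_left N1.\<eta>_nm N2.\<eta>_nm)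

lemma potential_cyclide: "u \<in> cyclide x \<Longrightarrow> blinfun_apply (potential x v) u = 0"
  unfolding cyclide_def
  by (auto elim!: span_pairE simp: blinfun.add_right blinfun.scaleR_right potential_np)

lemma potential_dif:
  "blinfun_apply (potential x v) (dif A np1 x w) = (form (N1.\<omega> x v) (dif A np1 x w) / \<kappa>) *\<^sub>R np1 x"
  "blinfun_apply (potential x v) (dif A np2 x w) = - (form (N2.\<omega> x v) (dif A np2 x w) / \<kappa>) *\<^sub>R np2 x"
  using N1.\<eta>_orthogonal[OF orthogonal[OF _ N2.dif_mem(1)]] N2.\<eta>_orthogonal[OF orthogonal'[OF _ N1.dif_mem(1)]]
  by (simp_all add: potential_def blinfun.add_left N1.\<eta>_dif_np N2.\<eta>_dif_np)

lemma \<eta>_commute_cross: "N1.\<eta> x v o\<^sub>L N2.\<eta> x w = N2.\<eta> x w o\<^sub>L N1.\<eta> x v"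
proof (rule blinfun_eqI)
  fix c
  have "form (np1 x) (N2.\<omega> x w) = 0" "form (N1.\<omega> x v) (N2.\<omega> x w) = 0" "form (N1.\<omega> x v) (np2 x) = 0"
    "form (N2.\<omega> x w) (N1.\<omega> x v) = 0" "form (np2 x) (N1.\<omega> x v) = 0" "form (N2.\<omega> x w) (np1 x) = 0"
    using orthogonal orthogonal' N1.mem N2.mem N1.\<omega>_mem N2.\<omega>_mem by blast+
  then show "blinfun_apply (N1.\<eta> x v o\<^sub>L N2.\<eta> x w) c = blinfun_apply (N2.\<eta> x w o\<^sub>L N1.\<eta> x v) c"
    by (simp add: N1.\<eta>_apply N2.\<eta>_apply form_simps cross)
qed

lemma smooth_one_form_potential: "smooth_one_form A potential"
  using N1.smooth_one_form_\<eta> N2.smooth_one_form_\<eta> unfolding smooth_one_form_def potential_def[abs_def]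
  by (auto intro: linear_compose_add smooth_map_add)

lemma ext_deriv_potential: "ext_deriv A potential x v w = 0"
proof -
  define c where "c = chart_at A x"
  have c: "c \<in> A" "x \<in> fst c" using chart_at c_def by auto
  note V = chart_homeomorphism(1)[OF c(1)] smooth_vector_field_coord_field[OF c(1)]
  have s1: "smooth_map A (fst c) (\<lambda>y. N1.\<eta> y (coord_field A c u y))" for u
    using N1.smooth_one_form_\<eta> V unfolding smooth_one_form_def by blast
  have s2: "smooth_map A (fst c) (\<lambda>y. N2.\<eta> y (coord_field A c u y))" for u
    using N2.smooth_one_form_\<eta> V unfolding smooth_one_form_def by blast
  have "ext_deriv A potential x v w = ext_deriv A N1.\<eta> x v w + ext_deriv A N2.\<eta> x v w"
    unfolding ext_deriv_def c_def[symmetric] potential_def by (simp add: dif_add[OF s1 s2 c(2)])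
  then show ?thesis by (simp add: N1.ext_deriv_\<eta> N2.ext_deriv_\<eta>)
qed

lemma bracket_potential: "bracket_wedge potential x v w = 0"
proof -
  have "potential x v o\<^sub>L potential x w = potential x w o\<^sub>L potential x v"
    unfolding potential_def
    by (simp add: bounded_bilinear.add_left[OF bounded_bilinear_blinfun_compose]
        bounded_bilinear.add_right[OF bounded_bilinear_blinfun_compose] N1.\<eta>_commute[of x v w] N2.\<eta>_commute[of x v w]
        \<eta>_commute_cross[of x v w] \<eta>_commute_cross[of x w v])
  then show ?thesis unfolding bracket_wedge_def by simp
qed

lemma potential_wedge: "potential x v \<in> wedge_space (cyclide x) (perp (cyclide x))"
  unfolding potential_def N1.\<eta>_def N2.\<eta>_def wedge_space_def
  by (intro span_add span_scale span_base) (use mem_cyclide \<omega>_perp in blast)+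

text \<open>Along \<open>T\<^sub>2\<close> the endomorphism whose trace is taken is diagonal with respect to \<open>n\<^sub>1\<^sup>+\<close>, \<open>n\<^sub>2\<^sup>+\<close> and only its
  entry at \<open>n\<^sub>1\<^sup>+\<close> is non-zero.\<close>

lemma quadratic_differential_cyclide:
  assumes v: "v \<in> T2 x"
  shows "quadratic_differential A cyclide potential x v v = form (N1.\<omega> x v) (dif A np1 x v) / \<kappa>"
proof -
  let ?g = "\<lambda>u. blinfun_apply (potential x v)
       (dif A (SOME \<sigma>. \<exists>W. x \<in> W \<and> local_section A W cyclide \<sigma> \<and> \<sigma> x = u) x v)"
  have "trace_on (cyclide x) ?g = form (N1.\<omega> x v) (dif A np1 x v) / \<kappa> + 0"
  proof (rule trace_on_diagonal[where u = "np1 x" and v = "np2 x"])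
    show "np1 x \<noteq> np2 x" using independent(1)[of x] span_base[of "np1 x" "{np2 x}"] by auto
    then show "independent {np1 x, np2 x}" using independent(1)[of x] N2.np_nonzero[of x] by (simp add: independent_insert)
    fix \<alpha> \<beta>
    let ?u = "\<alpha> *\<^sub>R np1 x + \<beta> *\<^sub>R np2 x"
    let ?P = "\<lambda>\<sigma>. \<exists>W. x \<in> W \<and> local_section A W cyclide \<sigma> \<and> \<sigma> x = ?u"
    have "local_section A UNIV cyclide (\<lambda>y. \<alpha> *\<^sub>R np1 y + \<beta> *\<^sub>R np2 y)"
      unfolding local_section_def cyclide_def
      by (auto intro!: smooth_map_add smooth_map_scaleR N1.smooth N2.smooth span_pairI)
    then have "\<exists>\<sigma>. ?P \<sigma>" by (intro exI[of _ "\<lambda>y. \<alpha> *\<^sub>R np1 y + \<beta> *\<^sub>R np2 y"]) auto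
    from someI_ex[OF this] obtain W where W: "x \<in> W" "local_section A W cyclide (Eps ?P)" "(Eps ?P) x = ?u" by blast
    obtain a b z where z: "(Eps ?P) x = a *\<^sub>R np1 x + b *\<^sub>R np2 x" "z \<in> cyclide x"
      "dif A (Eps ?P) x v = a *\<^sub>R dif A np1 x v + b *\<^sub>R dif A np2 x v + z"
      using section_coefficients[of W x "Eps ?P" v] W unfolding local_section_def by blast
    have "form ?u (nm1 x) = form (a *\<^sub>R np1 x + b *\<^sub>R np2 x) (nm1 x)" using z(1) W(3) by simp
    then have "a = \<alpha>" using N1.forms cross by (simp add: form_simps)
    then show "?g ?u = (form (N1.\<omega> x v) (dif A np1 x v) / \<kappa> * \<alpha>) *\<^sub>R np1 x + (0 * \<beta>) *\<^sub>R np2 x"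
      unfolding z(3)
      by (simp add: blinfun.add_right blinfun.scaleR_right potential_dif potential_cyclide[OF z(2)] N2.\<omega>_T[OF v] form_simps)
  qed (simp add: cyclide_def)
  then show ?thesis unfolding quadratic_differential_def by simp
qed

lemma gauge_potential: "gauge_potential A cyclide potential"
proof -
  obtain x where x: "x \<in> D" using nonempty by blast
  obtain W Y where "x \<in> W" "\<And>y. y \<in> W \<Longrightarrow> Y y \<in> T2 y \<and> Y y \<noteq> 0" using line_field_section[OF N2.line] by metis
  then have Y: "Y x \<in> T2 x" "Y x \<noteq> 0" by auto
  have "quadratic_differential A cyclide potential x (Y x) (Y x) \<noteq> 0"
    unfolding quadratic_differential_cyclide[OF Y(1)] using not_stationary1[OF x Y] N1.forms(4) by simp
  then show ?thesis
    unfolding gauge_potential_def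
    using smooth_one_form_potential potential_wedge ext_deriv_potential bracket_potential by blast
qed

text \<open>The sum \<open>n\<^sub>1\<^sup>- + n\<^sub>2\<^sup>-\<close> spans a parallel line; the contact condition matches the two factors of proportionality.\<close>

lemma darboux: "darboux_transform A cyclide f"
proof -
  define \<tau> where "\<tau> x = nm1 x + nm2 x" for x
  have s\<tau>: "smooth_map A UNIV \<tau>" unfolding \<tau>_def[abs_def] by (intro smooth_map_add open_UNIV N1.smooth N2.smooth)
  have \<tau>np: "form (\<tau> x) (np1 x) = \<kappa>" "form (\<tau> x) (np2 x) = - \<kappa>" for x
    by (simp_all add: \<tau>_def form_simps cross N1.forms' N2.forms')
  have \<tau>0: "\<tau> x \<noteq> 0" for x using \<tau>np(1)[of x] N1.forms(4) by (auto simp: form_simps)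
  have \<tau>\<tau>: "form (\<tau> x) (\<tau> x) = 0" for x by (simp add: \<tau>_def form_simps cross N1.forms N2.forms)
  have par: "dif A \<tau> x v + blinfun_apply (potential x v) (\<tau> x) = (form (dif A nm1 x v) (np1 x) / \<kappa>) *\<^sub>R \<tau> x" for x v
  proof -
    have "form (dif A nm2 x v) (np2 x) = - form (dif A nm1 x v) (np1 x)" using contact[of x v] by simp
    then have "dif A nm2 x v = N2.\<omega> x v + (form (dif A nm1 x v) (np1 x) / \<kappa>) *\<^sub>R nm2 x"
      using N2.dif_nm[of x v] by simp
    moreover have "dif A \<tau> x v = dif A nm1 x v + dif A nm2 x v"
      unfolding \<tau>_def[abs_def] by (rule dif_add[OF N1.smooth(2) N2.smooth(2) UNIV_I])
    ultimately show ?thesis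
      using N1.dif_nm[of x v] by (simp add: \<tau>_def blinfun.add_right potential_nm algebra_simps)
  qed
  have "parallel_subbundle A potential 1 (\<lambda>x. span {\<tau> x})"
    unfolding parallel_subbundle_def
  proof (intro allI impI, elim conjE)
    fix W \<sigma> x v assume ls: "local_section A W (\<lambda>x. span {\<tau> x}) \<sigma>" "x \<in> W"
    then have W: "open W" "smooth_map A W \<sigma>" "\<And>y. y \<in> W \<Longrightarrow> \<sigma> y \<in> span {\<tau> y}"
      unfolding local_section_def by auto
    have s: "smooth_map A W \<tau>" using s\<tau> smooth_map_subset by blast
    obtain c c' where c: "\<sigma> x = c *\<^sub>R \<tau> x" "dif A \<sigma> x v = c *\<^sub>R dif A \<tau> x v + c' *\<^sub>R \<tau> x"
      using dif_rank1[OF W(1) ls(2) s W(2) \<tau>0 W(3)] by metis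
    have "dif A \<sigma> x v + 1 *\<^sub>R blinfun_apply (potential x v) (\<sigma> x) =
        c *\<^sub>R (dif A \<tau> x v + blinfun_apply (potential x v) (\<tau> x)) + c' *\<^sub>R \<tau> x"
      by (simp add: c blinfun.scaleR_right algebra_simps)
    then show "dif A \<sigma> x v + 1 *\<^sub>R blinfun_apply (potential x v) (\<sigma> x) \<in> span {\<tau> x}"
      unfolding par by (simp add: span_add span_scale span_base)
  qed
  moreover have "totally_isotropic (span {\<tau> x})" for x
    unfolding totally_isotropic_def by (auto elim!: span_singletonE simp: form_simps \<tau>\<tau>)
  moreover have "\<not> span {\<tau> x} \<subseteq> perp (cyclide x)" for x
  proof
    assume "span {\<tau> x} \<subseteq> perp (cyclide x)"
    then have "form (np1 x) (\<tau> x) = 0" using span_base[of "\<tau> x" "{\<tau> x}"] mem_cyclide(1)[of x] unfolding perp_def by auto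
    then show False using \<tau>np(1)[of x] N1.forms(4) by (simp add: form_commute)
  qed
  moreover have "f x = {a + b |a b. a \<in> span {\<tau> x} \<and> b \<in> cyclide x \<inter> perp (span {\<tau> x})}" for x
  proof (intro equalityI subsetI)
    fix z assume "z \<in> f x"
    then obtain \<alpha> \<beta> where z: "z = \<alpha> *\<^sub>R (np1 x + np2 x) + \<beta> *\<^sub>R \<tau> x" unfolding f_eq \<tau>_def by (rule span_pairE)
    have "\<alpha> *\<^sub>R (np1 x + np2 x) \<in> cyclide x \<inter> perp (span {\<tau> x})"
      using mem_cyclide[of x] subspace_cyclide[of x] \<tau>np
      by (auto simp: subspace_add subspace_scale perp_def form_simps elim!: span_singletonE)
    moreover have "\<beta> *\<^sub>R \<tau> x \<in> span {\<tau> x}" by (simp add: span_scale span_base)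
    moreover have "z = \<beta> *\<^sub>R \<tau> x + \<alpha> *\<^sub>R (np1 x + np2 x)" by (simp add: z)
    ultimately show "z \<in> {a + b |a b. a \<in> span {\<tau> x} \<and> b \<in> cyclide x \<inter> perp (span {\<tau> x})}" by blast
  next
    fix z assume "z \<in> {a + b |a b. a \<in> span {\<tau> x} \<and> b \<in> cyclide x \<inter> perp (span {\<tau> x})}"
    then obtain a b where ab: "z = a + b" "a \<in> span {\<tau> x}" "b \<in> cyclide x" "b \<in> perp (span {\<tau> x})" by blast
    obtain \<alpha> \<beta> where b: "b = \<alpha> *\<^sub>R np1 x + \<beta> *\<^sub>R np2 x" using ab(3) unfolding cyclide_def by (rule span_pairE)
    have "form (\<tau> x) b = 0" using ab(4) span_base[of "\<tau> x" "{\<tau> x}"] unfolding perp_def by auto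
    then have "\<alpha> = \<beta>" using \<tau>np N1.forms(4) by (simp add: b form_simps)
    then have "b = \<alpha> *\<^sub>R (np1 x + np2 x)" by (simp add: b algebra_simps)
    moreover obtain c where "a = c *\<^sub>R \<tau> x" using ab(2) by (rule span_singletonE)
    ultimately show "z \<in> f x" unfolding f_eq ab(1) by (simp add: \<tau>_def span_add span_scale span_base)
  qed
  moreover have "subbundle A 1 (\<lambda>x. span {\<tau> x})" by (rule subbundle1I[OF s\<tau> \<tau>0])
  ultimately show ?thesis
    unfolding darboux_transform_def using gauge_potential
    by (intro exI[of _ potential] exI[of _ "1 :: real"] exI[of _ "\<lambda>x. span {\<tau> x}"]) auto
qed

end

section \<open>The two Dupin cyclides of a Joachimsthal surface\<close>

context joachimsthal
begin

text \<open>In the Lorentzian 3-space \<open>H\<^sub>1\<close>, the complement of any null pair obtained by splitting sections of \<open>f\<close> is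
  spanned by \<open>l\<^sub>1\<close>, because \<open>f\<close> is orthogonal to \<open>l\<^sub>1\<close>.\<close>

lemma null_pair1I:
  assumes s: "smooth_map A UNIV np1" "smooth_map A UNIV nm1" and H: "\<And>x. np1 x \<in> H1" "\<And>x. nm1 x \<in> H1"
    "\<And>x. np2 x \<in> H2" "\<And>x. nm2 x \<in> H2"
    and F: "\<And>x. form (np1 x) (np1 x) = 0" "\<And>x. form (nm1 x) (nm1 x) = 0" "\<And>x. form (np1 x) (nm1 x) = \<kappa>" "\<kappa> \<noteq> 0"
    and f: "\<And>x. np1 x + np2 x \<in> f x" "\<And>x. nm1 x + nm2 x \<in> f x"
  shows "null_pair A T1 H1 np1 nm1 \<kappa>"
    and "joachimsthal_frame A f s1 s2 T1 T2 L1 L2 H1 H2 W \<sigma>1 \<sigma>2 X Y l1 l2 \<Longrightarrow> null_pair.normal A T1 H1 np1 nm1 W l1"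
proof -
  have n: "open W \<and> smooth_map A W l1 \<and> (\<forall>y\<in>W. l1 y \<in> H1 \<and> form (l1 y) (l1 y) = 1 \<and>
      form (l1 y) (np1 y) = 0 \<and> form (l1 y) (nm1 y) = 0 \<and> (\<forall>v\<in>T1 y. dif A l1 y v = 0))"
    if jf: "joachimsthal_frame A f s1 s2 T1 T2 L1 L2 H1 H2 W \<sigma>1 \<sigma>2 X Y l1 l2" for W \<sigma>1 \<sigma>2 X Y l1 l2
  proof -
    interpret joachimsthal_frame A f s1 s2 T1 T2 L1 L2 H1 H2 W \<sigma>1 \<sigma>2 X Y l1 l2 by fact
    have "form (l1 y) (np1 y) = 0 \<and> form (l1 y) (nm1 y) = 0" if y: "y \<in> W" for y
      using P.l_perp_f[OF y f(1)] P.l_perp_f[OF y f(2)] H1_perp_H2[OF l1_mem(1)[OF y] H(3)[of y]]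
        H1_perp_H2[OF l1_mem(1)[OF y] H(4)[of y]] by (simp add: form_simps)
    then show ?thesis using P.W P.smooth_l l1_mem(1) P.unit_section(2) dif_l1_T1 by simp
  qed
  have line: "line_field A T1" using spheres unfolding curvature_spheres_def by blast
  show np: "null_pair A T1 H1 np1 nm1 \<kappa>"
  proof
    fix x
    obtain W \<sigma>1 \<sigma>2 X Y l1 l2 where x: "x \<in> W"
      and jf: "joachimsthal_frame A f s1 s2 T1 T2 L1 L2 H1 H2 W \<sigma>1 \<sigma>2 X Y l1 l2" using frame_exists .
    show "\<exists>W l. x \<in> W \<and> open W \<and> smooth_map A W l \<and> (\<forall>y\<in>W. l y \<in> H1 \<and> form (l y) (l y) = 1 \<and>
      form (l y) (np1 y) = 0 \<and> form (l y) (nm1 y) = 0 \<and> (\<forall>v\<in>T1 y. dif A l y v = 0))"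
      by (rule exI[of _ W], rule exI[of _ l1], rule conjI[OF x n[OF jf]])
  qed (fact line signature1 s H(1,2) F)+
  show "joachimsthal_frame A f s1 s2 T1 T2 L1 L2 H1 H2 W \<sigma>1 \<sigma>2 X Y l1 l2 \<Longrightarrow> null_pair.normal A T1 H1 np1 nm1 W l1"
    unfolding null_pair.normal_def[OF np] by (rule n)
qed

lemma null_pairsI:
  assumes s: "smooth_map A UNIV np1" "smooth_map A UNIV nm1" "smooth_map A UNIV np2" "smooth_map A UNIV nm2"
    and H: "\<And>x. np1 x \<in> H1" "\<And>x. nm1 x \<in> H1" "\<And>x. np2 x \<in> H2" "\<And>x. nm2 x \<in> H2"
    and F: "\<And>x. form (np1 x) (np1 x) = 0" "\<And>x. form (nm1 x) (nm1 x) = 0" "\<And>x. form (np1 x) (nm1 x) = \<kappa>" "\<kappa> \<noteq> 0"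
      "\<And>x. form (np2 x) (np2 x) = 0" "\<And>x. form (nm2 x) (nm2 x) = 0" "\<And>x. form (np2 x) (nm2 x) = - \<kappa>"
    and f: "\<And>x. np1 x + np2 x \<in> f x" "\<And>x. nm1 x + nm2 x \<in> f x"
  shows "null_pairs A T1 T2 H1 H2 np1 nm1 np2 nm2 \<kappa> f (non_lightlike_set A f)"
proof -
  interpret sw: joachimsthal A f s2 s1 T2 T1 L2 L1 H2 H1 by (rule joachimsthal_swap)
  have f': "\<And>x. np2 x + np1 x \<in> f x" "\<And>x. nm2 x + nm1 x \<in> f x" using f by (simp_all add: add.commute)
  have \<kappa>: "- \<kappa> \<noteq> 0" using F by simp
  note n1 = null_pair1I[OF s(1,2) H F(1-4) f]
  note n2 = sw.null_pair1I[OF s(3,4) H(3,4,1,2) F(5-7) \<kappa> f']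
  interpret N1: null_pair A T1 H1 np1 nm1 \<kappa> by (rule n1(1))
  interpret N2: null_pair A T2 H2 np2 nm2 "- \<kappa>" by (rule n2(1))
  have cross: "form a b = 0" "form b a = 0" if "a \<in> H1" "b \<in> H2" for a b
    using H1_perp_H2[OF that] by (simp_all add: form_commute)
  show ?thesis
  proof
    show "form a b = 0" if "a \<in> H1" "b \<in> H2" for a b using cross[OF that] by simp
    show "\<exists>v1\<in>T1 x. \<exists>v2\<in>T2 x. v = v1 + v2" for x v
    proof -
      obtain W \<sigma>1 \<sigma>2 X Y where x: "x \<in> W" and "curvature_frame A f s1 s2 T1 T2 W \<sigma>1 \<sigma>2 X Y"
        using curvature_frame_exists[OF spheres] .
      then interpret curvature_frame A f s1 s2 T1 T2 W \<sigma>1 \<sigma>2 X Y by simp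
      obtain a b where "v = a *\<^sub>R X x + b *\<^sub>R Y x" using direction_span[OF x] .
      moreover have "a *\<^sub>R X x \<in> T1 x" "b *\<^sub>R Y x \<in> T2 x" unfolding spans(3,4)[OF x] by (simp_all add: span_scale span_base)
      ultimately show ?thesis by blast
    qed
    show "f x = span {np1 x + np2 x, nm1 x + nm2 x}" for x
    proof -
      have "np1 x + np2 x \<notin> span {nm1 x + nm2 x}"
      proof
        assume "np1 x + np2 x \<in> span {nm1 x + nm2 x}"
        then obtain c where c: "np1 x + np2 x = c *\<^sub>R (nm1 x + nm2 x)" by (rule span_singletonE)
        have "form (nm1 x) (np1 x + np2 x) = \<kappa>" "form (nm1 x) (nm1 x + nm2 x) = 0"
          using N1.forms' cross[OF H(2,3)] cross[OF H(2,4)] F by (simp_all add: form_simps)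
        then show False using F(4) by (simp add: c form.scaleR_right)
      qed
      moreover have "nm1 x + nm2 x \<noteq> 0"
      proof
        assume 0: "nm1 x + nm2 x = 0"
        have "form (np1 x) (nm1 x + nm2 x) = \<kappa>" using F cross[OF H(1,4)] by (simp add: form_simps)
        then show False using F(4) by (simp add: 0 form_simps)
      qed
      ultimately have "dim (span {np1 x + np2 x, nm1 x + nm2 x}) = 2" by (simp add: dim_insert)
      moreover have "span {np1 x + np2 x, nm1 x + nm2 x} \<subseteq> f x" using f null_plane(1) by (simp add: span_minimal)
      ultimately have "span {np1 x + np2 x, nm1 x + nm2 x} = f x"
        using null_plane[of x] by (intro subspace_dim_equal subspace_span) auto
      then show ?thesis by simp
    qed
    show "form (dif A nm1 x v) (np1 x) + form (dif A nm2 x v) (np2 x) = 0" for x v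
    proof -
      have "form (np1 x + np2 x) (dif A (\<lambda>y. nm1 y + nm2 y) x v) = 0"
        by (rule form_dif_section[OF open_UNIV _ f(2) UNIV_I f(1)]) (intro smooth_map_add open_UNIV s)
      then show ?thesis
        using cross[OF H(1) N2.dif_mem(2)] cross[OF N1.dif_mem(2) H(3)]
        by (simp add: dif_add[OF s(2,4) UNIV_I] form_simps form_commute)
    qed
    show "non_lightlike_set A f \<noteq> {}" using dense_non_lightlike by auto
    fix x v
    assume x: "x \<in> non_lightlike_set A f"
    obtain W \<sigma>1 \<sigma>2 X Y l1 l2 where xW: "x \<in> W"
      and jf: "joachimsthal_frame A f s1 s2 T1 T2 L1 L2 H1 H2 W \<sigma>1 \<sigma>2 X Y l1 l2" using frame_exists .
    interpret jf: joachimsthal_frame A f s1 s2 T1 T2 L1 L2 H1 H2 W \<sigma>1 \<sigma>2 X Y l1 l2 by fact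
    note nl = jf.non_lightlike_iff[OF xW, THEN iffD1, OF x]
    show "form (N1.\<omega> x v) (dif A np1 x v) \<noteq> 0" if v: "v \<in> T2 x" "v \<noteq> 0"
    proof -
      obtain c where c: "v = c *\<^sub>R Y x" using v(1) jf.P.spans(4)[OF xW] by (auto elim: span_singletonE)
      have "form (dif A l1 x v) (dif A l1 x v) = c * c * form (deriv_along A Y l1 x) (deriv_along A Y l1 x)"
        by (simp add: c dif_scale_vec[OF jf.P.smooth_l xW] form_simps deriv_along_def)
      then show ?thesis using N1.form_\<omega>_dif_np[OF n1(2)[OF jf] xW, of v] nl c v(2) F(4) by auto
    qed
    show "form (N2.\<omega> x v) (dif A np2 x v) \<noteq> 0" if v: "v \<in> T1 x" "v \<noteq> 0"
    proof -
      obtain c where c: "v = c *\<^sub>R X x" using v(1) jf.P.spans(3)[OF xW] by (auto elim: span_singletonE)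
      have "form (dif A l2 x v) (dif A l2 x v) = c * c * form (deriv_along A X l2 x) (deriv_along A X l2 x)"
        by (simp add: c dif_scale_vec[OF jf.Q.smooth_l xW] form_simps deriv_along_def)
      then show ?thesis using N2.form_\<omega>_dif_np[OF n2(2)[OF jf.jframe_swap] xW, of v] nl c v(2) F(4) by auto
    qed
  qed
qed

end

subsection \<open>A global frame\<close>

text \<open>\<open>\<pi>\<close> is the orthogonal projection to \<open>H\<^sub>1\<close>.\<close>

locale euclidean_joachimsthal = joachimsthal A f s1 s2 T1 T2 L1 L2 H1 H2
  for A :: "'a::{t2_space, second_countable_topology} chart set" and f s1 s2 T1 T2 L1 L2 H1 H2 +
  fixes p q :: r42 and \<pi> :: "r42 \<Rightarrow> r42"
  assumes p: "p \<in> H1" "form p p = -1" and q: "q \<in> H2"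
    and point: "\<And>x. \<exists>!y. y \<in> f x \<inter> space_form p q"
    and proj: "bounded_linear \<pi>" "\<And>w. \<pi> w \<in> H1" "\<And>w. w - \<pi> w \<in> H2"
begin

text \<open>The point sphere: the intersection of \<open>f\<close> with the space form.\<close>

definition pt where "pt x = (THE y. y \<in> f x \<inter> space_form p q)"

lemma pt: "pt x \<in> f x" "form (pt x) q = -1" "form (pt x) p = 0"
proof -
  have "pt x \<in> f x \<inter> space_form p q" unfolding pt_def by (rule theI'[OF point])
  then show "pt x \<in> f x" "form (pt x) q = -1" "form (pt x) p = 0" unfolding space_form_def by auto
qed

lemma pt_unique: "a \<in> f x \<Longrightarrow> form a q = -1 \<Longrightarrow> form a p = 0 \<Longrightarrow> a = pt x"
  using point[of x] pt[of x] form_null[of _ x] unfolding space_form_def by blast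

lemma f_perp_pq:
  assumes "a \<in> f x" "form a p = 0" "form a q = 0"
  shows "a = 0"
  using pt_unique[of "pt x + a" x] pt[of x] assms null_plane(1)[of x] by (simp add: subspace_add form_simps)

lemma form_proj: "h \<in> H1 \<Longrightarrow> form (\<pi> w) h = form w h" "h \<in> H1 \<Longrightarrow> form h (\<pi> w) = form h w"
  "form a b = form (\<pi> a) (\<pi> b) + form (a - \<pi> a) (b - \<pi> b)"
proof -
  have *: "form h (w - \<pi> w) = 0" "form (w - \<pi> w) h = 0" if "h \<in> H1" for h w
    using H1_perp_H2[OF that proj(3)] by (simp_all add: form_commute)
  show "h \<in> H1 \<Longrightarrow> form (\<pi> w) h = form w h" "h \<in> H1 \<Longrightarrow> form h (\<pi> w) = form h w"
    using *[of h w] by (simp_all add: form_simps)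
  show "form a b = form (\<pi> a) (\<pi> b) + form (a - \<pi> a) (b - \<pi> b)"
    using *[OF proj(2)[of a], of b] *[OF proj(2)[of b], of a] by (simp add: form_simps)
qed

text \<open>As \<open>f\<close> meets \<open>H\<^sub>2\<close> only in 0, it is mapped injectively by \<open>\<pi>\<close>.\<close>

lemma proj_nonzero:
  assumes "a \<in> f x" "a \<noteq> 0"
  shows "\<pi> a \<noteq> 0"
proof
  assume 0: "\<pi> a = 0"
  obtain W \<sigma>1 \<sigma>2 X Y l1 l2 where xW: "x \<in> W"
    and jf: "joachimsthal_frame A f s1 s2 T1 T2 L1 L2 H1 H2 W \<sigma>1 \<sigma>2 X Y l1 l2" using frame_exists .
  interpret joachimsthal_frame A f s1 s2 T1 T2 L1 L2 H1 H2 W \<sigma>1 \<sigma>2 X Y l1 l2 by fact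
  interpret sw: joachimsthal_frame A f s2 s1 T2 T1 L2 L1 H2 H1 W \<sigma>2 \<sigma>1 Y X l2 l1 by (rule jframe_swap)
  have "a \<in> H2" using proj(3)[of a] 0 by simp
  then show False using sw.f_inter_H1[OF xW assms(1)] assms(2) by blast
qed

lemma smooth_pt: "smooth_map A UNIV pt"
proof (rule smooth_map_local)
  fix x
  obtain W \<sigma>1 \<sigma>2 X Y where x: "x \<in> W" and "curvature_frame A f s1 s2 T1 T2 W \<sigma>1 \<sigma>2 X Y"
    using curvature_frame_exists[OF spheres] .
  then interpret curvature_frame A f s1 s2 T1 T2 W \<sigma>1 \<sigma>2 X Y by simp
  \<comment> \<open>Cramer's rule for the two equations \<open>(y, q) = -1\<close> and \<open>(y, p) = 0\<close>\<close>
  define \<Delta> where "\<Delta> z = form (\<sigma>1 z) q * form (\<sigma>2 z) p - form (\<sigma>2 z) q * form (\<sigma>1 z) p" for z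
  have \<Delta>: "\<Delta> z \<noteq> 0" if z: "z \<in> W" for z
  proof
    assume 0: "\<Delta> z = 0"
    note m = section_mem[OF z]
    have i: "a = 0 \<and> b = 0" if "a *\<^sub>R \<sigma>1 z + b *\<^sub>R \<sigma>2 z = 0" for a b
    proof -
      have "a *\<^sub>R \<sigma>1 z = (- b) *\<^sub>R \<sigma>2 z" using that by (simp add: eq_neg_iff_add_eq_0)
      then have "a *\<^sub>R \<sigma>1 z \<in> span {\<sigma>2 z}" by (simp only: span_scale[OF span_base] insertI1)
      then have "a = 0" using independent_sections(1)[OF z] span_scale_cancel by blast
      then show ?thesis using that sections(2)[OF z] by simp
    qed
    have "(- form (\<sigma>2 z) p) *\<^sub>R \<sigma>1 z + form (\<sigma>1 z) p *\<^sub>R \<sigma>2 z = 0"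
      by (rule f_perp_pq[of _ z])
        (use m null_plane(1) 0 in \<open>simp_all only: subspace_add subspace_scale form_simps \<Delta>_def, simp_all add: algebra_simps\<close>)
    from i[OF this] have p0: "form (\<sigma>1 z) p = 0" "form (\<sigma>2 z) p = 0" by auto
    have "(- form (\<sigma>2 z) q) *\<^sub>R \<sigma>1 z + form (\<sigma>1 z) q *\<^sub>R \<sigma>2 z = 0"
      by (rule f_perp_pq[of _ z])
        (use m null_plane(1) p0 in \<open>simp_all only: subspace_add subspace_scale form_simps, simp_all add: algebra_simps\<close>)
    from i[OF this] have "form (\<sigma>1 z) q = 0" "form (\<sigma>2 z) q = 0" by auto
    then have "\<sigma>1 z = 0" using f_perp_pq[OF m(1)] p0 by simp
    then show False using sections(1)[OF z] by simp
  qed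
  define y' where "y' z = (form (\<sigma>1 z) p / \<Delta> z) *\<^sub>R \<sigma>2 z - (form (\<sigma>2 z) p / \<Delta> z) *\<^sub>R \<sigma>1 z" for z
  have "smooth_map A W y'" unfolding y'_def[abs_def] \<Delta>_def[abs_def]
    by (intro smooth_map_diff smooth_map_scaleR smooth_map_divide smooth_map_mult smooth_map_form smooth_map_const W smooth \<Delta>[unfolded \<Delta>_def])
  moreover have "y' z = pt z" if z: "z \<in> W" for z
  proof (rule pt_unique)
    show "y' z \<in> f z" unfolding y'_def using section_mem[OF z] null_plane(1) by (simp add: subspace_diff subspace_scale)
    have "form (\<sigma>1 z) p * form (\<sigma>2 z) q - form (\<sigma>2 z) p * form (\<sigma>1 z) q = - \<Delta> z" by (simp add: \<Delta>_def)
    moreover have "form (y' z) q = (form (\<sigma>1 z) p * form (\<sigma>2 z) q - form (\<sigma>2 z) p * form (\<sigma>1 z) q) / \<Delta> z"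
      unfolding y'_def form_simps by (simp add: diff_divide_distrib)
    ultimately have "form (y' z) q = - (\<Delta> z / \<Delta> z)" by simp
    then show "form (y' z) q = -1" using \<Delta>[OF z] by simp
    show "form (y' z) p = 0" unfolding y'_def form_simps by simp
  qed
  ultimately have "smooth_map A W pt" using smooth_map_cong[OF W] by blast
  then show "\<exists>U. open U \<and> x \<in> U \<and> smooth_map A U pt" using W x by blast
qed

text \<open>The length of the component of the point sphere in \<open>H\<^sub>1\<close>, which is spacelike because it is orthogonal to \<open>p\<close>.\<close>

definition r where "r x = sqrt (form (\<pi> (pt x)) (\<pi> (pt x)))"

lemma r_pos: "form (\<pi> (pt x)) (\<pi> (pt x)) > 0" "r x > 0"
proof -
  have "pt x \<noteq> 0" using pt(2)[of x] by (auto simp: form_simps)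
  then have "\<pi> (pt x) \<noteq> 0" using proj_nonzero pt(1) by blast
  moreover have "form p (\<pi> (pt x)) = 0" using form_proj(2)[OF p(1)] pt(3)[of x] by (simp add: form_commute)
  ultimately show "form (\<pi> (pt x)) (\<pi> (pt x)) > 0"
    using lorentz_timelike_orthogonal[OF signature1 p(1) _ proj(2)] p(2) by simp
  then show "r x > 0" by (simp add: r_def)
qed

text \<open>The point sphere, rescaled to have a spacelike unit component \<open>e\<close> in \<open>H\<^sub>1\<close>.\<close>

definition unit_pt where "unit_pt x = inverse (r x) *\<^sub>R pt x"
definition e where "e x = \<pi> (unit_pt x)"

lemma smooth_unit_pt: "smooth_map A UNIV unit_pt"
proof -
  have "smooth_map A UNIV (\<lambda>x. \<pi> (pt x))" by (rule smooth_map_linear[OF open_UNIV proj(1) smooth_pt])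
  then have "smooth_map A UNIV r" unfolding r_def[abs_def]
    using r_pos by (intro smooth_map_sqrt smooth_map_form open_UNIV)
  then show ?thesis unfolding unit_pt_def[abs_def]
    using r_pos(2) by (intro smooth_map_scaleR smooth_map_inverse open_UNIV smooth_pt) (auto simp: less_imp_neq[symmetric])
qed

lemma smooth_e: "smooth_map A UNIV e"
  unfolding e_def[abs_def] by (rule smooth_map_linear[OF open_UNIV proj(1) smooth_unit_pt])

lemma unit_pt_mem: "unit_pt x \<in> f x"
  unfolding unit_pt_def using pt(1) null_plane(1) by (simp add: subspace_scale)

lemma e_mem: "e x \<in> H1" by (simp add: e_def proj)

lemma e_e: "form (e x) (e x) = 1"
proof -
  have "e x = inverse (r x) *\<^sub>R \<pi> (pt x)" by (simp add: e_def unit_pt_def linear_scale[OF bounded_linear.linear[OF proj(1)]])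
  then have "form (e x) (e x) = inverse (r x) * inverse (r x) * form (\<pi> (pt x)) (\<pi> (pt x))" by (simp add: form_simps)
  also have "form (\<pi> (pt x)) (\<pi> (pt x)) = r x * r x" using r_pos(1)[of x] by (simp add: r_def)
  finally show ?thesis using r_pos(2)[of x] by (simp add: field_simps)
qed

lemma unit_pt_e: "form (unit_pt x) (e x) = 1"
  using form_proj(1)[OF e_mem, of "unit_pt x" x] e_e by (simp add: e_def[symmetric])

text \<open>A second frame vector of \<open>f\<close>, with a timelike unit component orthogonal to \<open>e\<close> in \<open>H\<^sub>1\<close>. Its sign is fixed by the
  timelike vector \<open>p\<close>, so that it is defined on the whole surface.\<close>

definition normalised where
  "normalised x n \<longleftrightarrow> n \<in> f x \<and> form n (e x) = 0 \<and> form (\<pi> n) (\<pi> n) = -1 \<and> form n p < 0"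

lemma perp_e_timelike:
  assumes n: "n \<in> f x" "n \<noteq> 0" "form n (e x) = 0"
  shows "form (\<pi> n) (\<pi> n) < 0" "form n p \<noteq> 0"
proof -
  obtain W \<sigma>1 \<sigma>2 X Y l1 l2 where xW: "x \<in> W"
    and jf: "joachimsthal_frame A f s1 s2 T1 T2 L1 L2 H1 H2 W \<sigma>1 \<sigma>2 X Y l1 l2" using frame_exists .
  interpret joachimsthal_frame A f s1 s2 T1 T2 L1 L2 H1 H2 W \<sigma>1 \<sigma>2 X Y l1 l2 by fact
  have l: "form (l1 x) (\<pi> w) = 0" if "w \<in> f x" for w
    using form_proj(2)[OF l1_mem(1)[OF xW]] P.l_perp_f[OF xW that] by simp
  have nz: "\<pi> n \<noteq> 0" by (rule proj_nonzero[OF n(1,2)])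
  show neg: "form (\<pi> n) (\<pi> n) < 0"
    by (rule lorentz_spacelike_pair[OF signature1 l1_mem(1)[OF xW] e_mem])
      (use l[OF unit_pt_mem] l[OF n(1)] P.unit_section(2)[OF xW] e_e nz n(3) form_proj(2)[OF e_mem] proj(2)
        in \<open>simp_all add: e_def form_commute\<close>)
  show "form n p \<noteq> 0"
  proof
    assume "form n p = 0"
    then have "form p (\<pi> n) = 0" using form_proj(2)[OF p(1)] by (simp add: form_commute)
    then show False using lorentz_timelike_orthogonal[OF signature1 p(1) _ proj(2)[of n]] p(2) nz neg by simp
  qed
qed

lemma normalised_local:
  obtains W n where "open W" "x \<in> W" "smooth_map A W n" "\<forall>z\<in>W. \<forall>n'. normalised z n' \<longleftrightarrow> n' = n z"
proof -
  obtain W \<sigma>1 \<sigma>2 X Y where x: "x \<in> W" and "curvature_frame A f s1 s2 T1 T2 W \<sigma>1 \<sigma>2 X Y"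
    using curvature_frame_exists[OF spheres] .
  then interpret curvature_frame A f s1 s2 T1 T2 W \<sigma>1 \<sigma>2 X Y by simp
  have sm: "smooth_map A W e" using smooth_e smooth_map_subset by blast
  \<comment> \<open>the line in \<open>f\<close> orthogonal to \<open>e\<close>\<close>
  define n0 where "n0 z = form (\<sigma>1 z) (e z) *\<^sub>R \<sigma>2 z - form (\<sigma>2 z) (e z) *\<^sub>R \<sigma>1 z" for z
  have s0: "smooth_map A W n0" unfolding n0_def[abs_def]
    by (intro smooth_map_diff smooth_map_scaleR smooth_map_form W smooth sm)
  have m0: "n0 z \<in> f z" "form (n0 z) (e z) = 0" if z: "z \<in> W" for z
    unfolding n0_def using section_mem[OF z] null_plane(1) by (simp_all add: subspace_diff subspace_scale form_simps)
  have gen: "\<exists>c. w = c *\<^sub>R n0 z" if z: "z \<in> W" and w: "w \<in> f z" "form w (e z) = 0" for z w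
  proof -
    obtain a b where ab: "w = a *\<^sub>R \<sigma>1 z + b *\<^sub>R \<sigma>2 z" using w(1) f_span[OF z] span_pairE by blast
    let ?A = "form (\<sigma>1 z) (e z)" and ?B = "form (\<sigma>2 z) (e z)"
    have eq: "a * ?A + b * ?B = 0" using w(2) by (simp add: ab form_simps)
    have nz: "?A \<noteq> 0 \<or> ?B \<noteq> 0"
    proof -
      obtain a b where "unit_pt z = a *\<^sub>R \<sigma>1 z + b *\<^sub>R \<sigma>2 z" using unit_pt_mem[of z] f_span[OF z] span_pairE by blast
      then show ?thesis using unit_pt_e[of z] by (auto simp: form_simps)
    qed
    show ?thesis
    proof (cases "?A = 0")
      case False
      then have "a = - (b / ?A) * ?B" using eq by (simp add: field_simps)
      then have "w = (b / ?A) *\<^sub>R n0 z" using False by (simp add: ab n0_def scaleR_diff_right)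
      then show ?thesis by blast
    next
      case True
      then have "b = 0" "?B \<noteq> 0" using eq nz by auto
      then have "w = (- a / ?B) *\<^sub>R n0 z" using True by (simp add: ab n0_def)
      then show ?thesis by blast
    qed
  qed
  have nz: "n0 z \<noteq> 0" if z: "z \<in> W" for z
  proof
    assume 0: "n0 z = 0"
    have "form (\<sigma>1 z) (e z) *\<^sub>R \<sigma>2 z = form (\<sigma>2 z) (e z) *\<^sub>R \<sigma>1 z" using 0 by (simp add: n0_def)
    then have "form (\<sigma>2 z) (e z) *\<^sub>R \<sigma>1 z \<in> span {\<sigma>2 z}" by (metis singletonI span_base span_scale)
    then have B: "form (\<sigma>2 z) (e z) = 0" using independent_sections(1)[OF z] span_scale_cancel by blast
    then have A: "form (\<sigma>1 z) (e z) = 0" using 0 sections(2)[OF z] by (simp add: n0_def)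
    obtain a b where "unit_pt z = a *\<^sub>R \<sigma>1 z + b *\<^sub>R \<sigma>2 z" using unit_pt_mem[of z] f_span[OF z] span_pairE by blast
    then show False using unit_pt_e[of z] A B by (simp add: form_simps)
  qed
  define P where "P z = form (n0 z) p" for z
  define N where "N z = - form (\<pi> (n0 z)) (\<pi> (n0 z))" for z
  have PN: "P z \<noteq> 0" "N z > 0" if z: "z \<in> W" for z
    using perp_e_timelike[OF m0(1)[OF z] nz[OF z] m0(2)[OF z]] by (simp_all add: P_def N_def)
  have pos: "P z * P z * N z > 0" if "z \<in> W" for z
    using PN[OF that] by (auto simp: zero_less_mult_iff linorder_neq_iff)
  have sq: "sqrt (P z * P z * N z) \<noteq> 0" if "z \<in> W" for z using pos[OF that] by auto
  define n where "n z = (- P z / sqrt (P z * P z * N z)) *\<^sub>R n0 z" for z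
  have sP: "smooth_map A W P" unfolding P_def[abs_def] by (intro smooth_map_form smooth_map_const W s0)
  have "smooth_map A W (\<lambda>z. \<pi> (n0 z))" by (rule smooth_map_linear[OF W proj(1) s0])
  then have sN: "smooth_map A W N" unfolding N_def[abs_def] by (intro smooth_map_uminus smooth_map_form W)
  have sn: "smooth_map A W n" unfolding n_def[abs_def]
    by (intro smooth_map_scaleR smooth_map_divide smooth_map_uminus smooth_map_sqrt smooth_map_mult W sP sN s0 pos sq)
  have "normalised z n' \<longleftrightarrow> n' = n z" if z: "z \<in> W" for z n'
  proof -
    define Q where "Q = sqrt (P z * P z * N z)"
    have Q: "Q > 0" "Q * Q = P z * P z * N z" using pos[OF z] by (simp_all add: Q_def)
    have \<pi>s: "\<pi> (c *\<^sub>R n0 z) = c *\<^sub>R \<pi> (n0 z)" for c by (rule linear_scale[OF bounded_linear.linear[OF proj(1)]])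
    have norm: "normalised z (c *\<^sub>R n0 z) \<longleftrightarrow> c * c * N z = 1 \<and> c * P z < 0" for c
      using m0[OF z] null_plane(1)[of z]
      by (auto simp: normalised_def form_simps \<pi>s subspace_scale N_def P_def)
    have "c * c * N z = 1 \<and> c * P z < 0 \<longleftrightarrow> c = - P z / Q" for c
    proof
      assume c: "c * c * N z = 1 \<and> c * P z < 0"
      have "(c * Q) * (c * Q) = c * c * (Q * Q)" by simp
      also have "\<dots> = (c * c * N z) * (P z * P z)" by (simp add: Q(2))
      finally have "(c * Q) * (c * Q) = P z * P z" using c by simp
      then have "c * Q = P z \<or> c * Q = - P z" using square_eq_iff by blast
      moreover have "c * Q \<noteq> P z"
      proof
        assume "c * Q = P z"
        then have "c * P z = (c * c) * Q" by (metis mult.assoc)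
        then show False using c Q(1) by (metis not_less zero_le_square mult_nonneg_nonneg less_imp_le)
      qed
      ultimately show "c = - P z / Q" using Q(1) by (simp add: field_simps)
    next
      assume c: "c = - P z / Q"
      have "c * c * N z = (P z * P z * N z) / (Q * Q)" by (simp add: c)
      then have "c * c * N z = 1" using Q PN[OF z] by simp
      moreover have "c * P z = - (P z * P z) / Q" by (simp add: c)
      moreover have "P z * P z > 0" using PN(1)[OF z] by (auto simp: zero_less_mult_iff linorder_neq_iff)
      ultimately show "c * c * N z = 1 \<and> c * P z < 0" using Q(1) by (simp add: divide_neg_pos)
    qed
    note norm' = norm[unfolded this]
    show ?thesis
    proof
      assume n': "normalised z n'"
      then obtain c where "n' = c *\<^sub>R n0 z" using gen[OF z] unfolding normalised_def by blast
      then show "n' = n z" using n' norm'[of c] by (simp add: n_def Q_def)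
    next
      assume "n' = n z"
      then show "normalised z n'" using norm'[of "- P z / Q"] by (simp add: n_def Q_def)
    qed
  qed
  then show ?thesis using that[of W n] W x sn by blast
qed

text \<open>\<open>f\<close> is spanned by \<open>e + b\<close> and \<open>\<nu> = m + k\<close>, with \<open>e\<close>, \<open>m\<close> orthonormal in \<open>H\<^sub>1\<close> and \<open>b\<close>, \<open>k\<close> orthonormal in \<open>H\<^sub>2\<close>; \<open>m\<close> and \<open>b\<close>
  are timelike.\<close>

definition \<nu> where "\<nu> x = (THE n. normalised x n)"

lemma normalised_\<nu>: "normalised x (\<nu> x)" and smooth_\<nu>: "smooth_map A UNIV \<nu>"
proof -
  have *: "\<exists>W n'. open W \<and> x \<in> W \<and> smooth_map A W n' \<and> (\<forall>z\<in>W. normalised z (\<nu> z) \<and> \<nu> z = n' z)" for x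
  proof -
    obtain W n' where W: "open W" "x \<in> W" "smooth_map A W n'" "\<forall>z\<in>W. \<forall>k. normalised z k \<longleftrightarrow> k = n' z"
      by (rule normalised_local)
    then have "normalised z (\<nu> z) \<and> \<nu> z = n' z" if "z \<in> W" for z
    proof -
      have "normalised z = (\<lambda>k. k = n' z)" using W(4) that by blast
      then show ?thesis unfolding \<nu>_def by simp
    qed
    then show ?thesis using W by blast
  qed
  show "normalised x (\<nu> x)" using *[of x] by blast
  show "smooth_map A UNIV \<nu>"
  proof (rule smooth_map_local)
    fix x
    obtain W n' where W: "open W" "x \<in> W" "smooth_map A W n'" "\<forall>z\<in>W. \<nu> z = n' z" using *[of x] by blast
    then have "smooth_map A W \<nu>" using smooth_map_cong[OF W(1) _ W(3), of \<nu>] by simp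
    then show "\<exists>U. open U \<and> x \<in> U \<and> smooth_map A U \<nu>" using W by blast
  qed
qed

definition m where "m x = \<pi> (\<nu> x)"
definition b where "b x = unit_pt x - \<pi> (unit_pt x)"
definition k where "k x = \<nu> x - \<pi> (\<nu> x)"

lemma frame_mem: "m x \<in> H1" "e x \<in> H1" "b x \<in> H2" "k x \<in> H2"
  by (simp_all add: m_def e_def b_def k_def proj)

lemma frame_smooth: "smooth_map A UNIV m" "smooth_map A UNIV e" "smooth_map A UNIV b" "smooth_map A UNIV k"
  unfolding m_def[abs_def] b_def[abs_def] k_def[abs_def]
  by (intro smooth_map_diff smooth_map_linear[OF open_UNIV proj(1)] smooth_\<nu> smooth_unit_pt smooth_e open_UNIV)+

lemma frame_sum: "e x + b x = unit_pt x" "m x + k x = \<nu> x"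
  by (simp_all add: e_def b_def m_def k_def)

lemma frame_forms: "form (e x) (e x) = 1" "form (m x) (m x) = -1" "form (e x) (m x) = 0" "form (m x) (e x) = 0"
  "form (b x) (b x) = -1" "form (k x) (k x) = 1" "form (b x) (k x) = 0" "form (k x) (b x) = 0"
proof -
  have n: "\<nu> x \<in> f x" "form (\<nu> x) (e x) = 0" "form (m x) (m x) = -1"
    using normalised_\<nu>[of x] unfolding normalised_def m_def by auto
  show "form (e x) (e x) = 1" "form (m x) (m x) = -1" using e_e n by auto
  show me: "form (m x) (e x) = 0" using form_proj(1)[OF e_mem] n(2) by (simp add: m_def)
  then show em: "form (e x) (m x) = 0" by (simp add: form_commute)
  have "form (unit_pt x) (unit_pt x) = 0" "form (\<nu> x) (\<nu> x) = 0" "form (unit_pt x) (\<nu> x) = 0"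
    using form_null unit_pt_mem n(1) by blast+
  then show "form (b x) (b x) = -1" "form (k x) (k x) = 1" "form (b x) (k x) = 0"
    unfolding b_def k_def
    using form_proj(3)[of "unit_pt x" "unit_pt x"] form_proj(3)[of "\<nu> x" "\<nu> x"] form_proj(3)[of "unit_pt x" "\<nu> x"]
      e_e[of x, unfolded e_def] n(3)[unfolded m_def] em[unfolded e_def m_def]
    by linarith+
  then show "form (k x) (b x) = 0" by (simp add: form_commute)
qed

text \<open>The null lines \<open>m \<plusminus> e\<close> and \<open>k \<plusminus> b\<close>. Both choices of the sign are admissible.\<close>

lemma two_null_pairs:
  "null_pairs A T1 T2 H1 H2 (\<lambda>x. m x + e x) (\<lambda>x. m x - e x) (\<lambda>x. k x + b x) (\<lambda>x. k x - b x) (-2) f (non_lightlike_set A f)"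
  "null_pairs A T1 T2 H1 H2 (\<lambda>x. m x - e x) (\<lambda>x. m x + e x) (\<lambda>x. k x - b x) (\<lambda>x. k x + b x) (-2) f (non_lightlike_set A f)"
proof -
  have s: "smooth_map A UNIV (\<lambda>x. m x + e x)" "smooth_map A UNIV (\<lambda>x. m x - e x)"
    "smooth_map A UNIV (\<lambda>x. k x + b x)" "smooth_map A UNIV (\<lambda>x. k x - b x)"
    by (intro smooth_map_add smooth_map_diff open_UNIV frame_smooth)+
  have H: "m x + e x \<in> H1" "m x - e x \<in> H1" "k x + b x \<in> H2" "k x - b x \<in> H2" for x
    using frame_mem subspaces by (simp_all add: subspace_add subspace_diff)
  have n: "\<nu> x \<in> f x" for x using normalised_\<nu>[of x] unfolding normalised_def by blast
  have "(m x + e x) + (k x + b x) = \<nu> x + unit_pt x" "(m x - e x) + (k x - b x) = \<nu> x - unit_pt x" for x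
    using frame_sum[of x] by (simp_all add: algebra_simps)
  then have f: "(m x + e x) + (k x + b x) \<in> f x" "(m x - e x) + (k x - b x) \<in> f x" for x
    using n unit_pt_mem null_plane(1) by (simp_all add: subspace_add subspace_diff)
  note F = form_simps frame_forms
  show "null_pairs A T1 T2 H1 H2 (\<lambda>x. m x + e x) (\<lambda>x. m x - e x) (\<lambda>x. k x + b x) (\<lambda>x. k x - b x) (-2) f (non_lightlike_set A f)"
    by (rule null_pairsI[OF s H _ _ _ _ _ _ _ f]) (simp_all add: F)
  show "null_pairs A T1 T2 H1 H2 (\<lambda>x. m x - e x) (\<lambda>x. m x + e x) (\<lambda>x. k x - b x) (\<lambda>x. k x + b x) (-2) f (non_lightlike_set A f)"
    by (rule null_pairsI[OF s(2,1,4,3) H(2,1,4,3) _ _ _ _ _ _ _ f(2,1)]) (simp_all add: F)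
qed

lemma two_cyclides:
  "\<exists>g h. g \<noteq> h \<and> dupin_cyclide_on A (non_lightlike_set A f) g \<and> dupin_cyclide_on A (non_lightlike_set A f) h \<and>
       darboux_transform A g f \<and> darboux_transform A h f"
proof -
  interpret P: null_pairs A T1 T2 H1 H2 "\<lambda>x. m x + e x" "\<lambda>x. m x - e x" "\<lambda>x. k x + b x" "\<lambda>x. k x - b x" "-2" f "non_lightlike_set A f"
    by (rule two_null_pairs)
  interpret Q: null_pairs A T1 T2 H1 H2 "\<lambda>x. m x - e x" "\<lambda>x. m x + e x" "\<lambda>x. k x - b x" "\<lambda>x. k x + b x" "-2" f "non_lightlike_set A f"
    by (rule two_null_pairs)
  have "P.cyclide \<noteq> Q.cyclide"
  proof
    assume eq: "P.cyclide = Q.cyclide"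
    define x :: 'a where "x = undefined"
    have "m x + e x \<in> Q.cyclide x" using P.mem_cyclide(1)[of x] eq by simp
    then have "m x + e x \<in> span {m x - e x}" by (rule Q.cyclide_inter(1)[OF P.N1.mem(1)])
    then obtain c where "m x + e x = c *\<^sub>R (m x - e x)" by (rule span_singletonE)
    then have "form (m x + e x) (m x - e x) = c * form (m x - e x) (m x - e x)" by (simp add: form.scaleR_left)
    then show False using P.N1.forms(2,3)[of x] by simp
  qed
  then show ?thesis using P.dupin_cyclide Q.dupin_cyclide P.darboux Q.darboux by blast
qed

end

theorem theorem6p6:
  fixes A :: "'a::{t2_space, second_countable_topology} chart set"
    and f :: "'a \<Rightarrow> r42 set" and p q :: r42
  assumes "smooth_surface A" and "simply_connected (UNIV :: 'a set)"
    and "legendre_map A f" and "umbilic_free A f" and "regular A f"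
    and "euclidean_space_form p q" and "projects_to_joachimsthal A p q f"
  shows "open (non_lightlike_set A f) \<and> closure (non_lightlike_set A f) = UNIV \<and>
    (\<exists>g h. g \<noteq> h \<and>
       dupin_cyclide_on A (non_lightlike_set A f) g \<and>
       dupin_cyclide_on A (non_lightlike_set A f) h \<and>
       darboux_transform A g f \<and> darboux_transform A h f)"
proof -
  from assms(7) obtain s1 s2 T1 T2 L1 L2 H1 H2 where
    point: "\<And>x. \<exists>!y. y \<in> f x \<inter> space_form p q" and
    J: "curvature_spheres A f s1 s2 T1 T2"
    "osculating_complex A (sphere_osc A s1 T2) (sphere_osc A s2 T1) L1"
    "osculating_complex A (sphere_osc A s2 T1) (sphere_osc A s1 T2) L2"
    "\<And>x. osculating_bundle A L1 T2 x = H1" "\<And>x. osculating_bundle A L2 T1 x = H2"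
    "has_signature H1 2 1" "has_signature H2 2 1" and pq: "p \<in> H1" "q \<in> H2"
    unfolding projects_to_joachimsthal_def by blast
  interpret joachimsthal A f s1 s2 T1 T2 L1 L2 H1 H2
    by unfold_locales (use assms J in auto)
  have pp: "form p p = -1" using assms(6) unfolding euclidean_space_form_def by simp
  obtain \<pi> where \<pi>: "bounded_linear \<pi>" "\<And>w. \<pi> w \<in> H1" "\<And>w. w - \<pi> w \<in> H2"
    using lorentz_projection[OF signature1 signature2 H1_perp_H2] by blast
  interpret euclidean_joachimsthal A f s1 s2 T1 T2 L1 L2 H1 H2 p q \<pi>
    by (rule euclidean_joachimsthal.intro[OF joachimsthal_axioms], rule euclidean_joachimsthal_axioms.intro)
      (fact pq pp point \<pi>)+
  show ?thesis using open_non_lightlike dense_non_lightlike two_cyclides by blast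
qed

end
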